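(* Let $f\colon M\to\mathbb{R}^4$ be an affine hypersphere with the null-direction $\mathcal{D}^+$ and a $\widetilde{J}$-tangent Blaschke field $C$. Then, locally (around every point of $M$), there exist an open interval $I\subset\mathbb{R}$, smooth planar curves $\alpha\colon I\to\mathbb{R}^2$, $\beta\colon I\to\mathbb{R}^2$ with the property $$\det[\alpha,\alpha']\cdot\det[\beta,\beta']\neq0,\qquad(1)$$ a smooth function $A\colon I\to\mathbb{R}$, and a non-zero constant $E$ such that $f$ can be expressed (in suitable local coordinates $(x,y,z)$) in the form $$f(x,y,z)=\widetilde{J}g(x,y)\cosh z-g(x,y)\sinh z,\qquad(2)$$ where $g(x,y)=(x+A(y))\cdot(\alpha,\alpha)(y)+B(y)(\alpha',\alpha')(y)+(\beta,-\beta)(y)$ and $$B(y)=\frac{E}{\sqrt{|\det[\alpha(y),\alpha'(y)]\cdot\det[\beta(y),\beta'(y)]|}}.$$ Moreover, for any smooth curves $\alpha,\beta\colon I\to\mathbb{R}^2$ on an open interval $I$ satisfying (1), any smooth function $A\colon I\to\mathbb{R}$ and any non-zero constant $E$, the function $f$ given by (2) (with $g(x,y)=(x+A(y))\cdot(\alpha,\alpha)(y)+B(y)(\alpha',\alpha')(y)+(\beta,-\beta)(y)$ and $B(y)=E/\sqrt{|\det[\alpha(y),\alpha'(y)]\cdot\det[\beta(y),\beta'(y)]|}$, $(x,y,z)\in\mathbb{R}\times I\times\mathbb{R}$) is a $\widetilde{J}$-tangent affine hypersphere with the null-direction $\mathcal{D}^+$.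
   Context: All objects are smooth. $M$ is a connected, orientable $3$-dimensional manifold and $f\colon M\to\mathbb{R}^4$ is an immersion (hypersurface), assumed nondegenerate; $D$ is the standard flat connection on $\mathbb{R}^4$. For a transversal vector field $C$ along $f$, the formulas $D_Xf_*Y=f_*(\nabla_XY)+h(X,Y)C$ and $D_XC=-f_*(SX)+\tau(X)C$ define the torsion-free connection $\nabla$, the second fundamental form $h$, the shape operator $S$ and the transversal connection form $\tau$. $f$ is nondegenerate if $h$ is nondegenerate (this does not depend on $C$). The induced volume element of $C$ is $\Theta(X_1,X_2,X_3)=\det[f_*X_1,f_*X_2,f_*X_3,C]$; the metric volume form is $\omega_h(X_1,X_2,X_3)=|\det[h(X_i,X_j)]|^{1/2}$ for bases positively oriented relative to $\Theta$. For nondegenerate $f$ the Blaschke field is the transversal field, unique up to sign, with $\tau=0$ and $\omega_h=\Theta$. $f$ is an affine hypersphere if the shape operator of its Blaschke field is $S=\lambda\,\mathrm{I}$ with $\lambda$ constant. The para-complex structure on $\mathbb{R}^4$ is $\widetilde{J}(x_1,x_2,y_1,y_2)=(y_1,y_2,x_1,x_2)$. A transversal field $C$ is $\widetilde{J}$-tangent if $\widetilde{J}C_x\in f_*(T_xM)$ for every $x\in M$. A $\widetilde{J}$-tangent affine hypersphere is an affine hypersphere whose Blaschke field is $\widetilde{J}$-tangent. The distribution $\mathcal{D}$ is the biggest $\widetilde{J}$-invariant distribution on $M$: $\mathcal{D}_x=f_*^{-1}\big(f_*(T_xM)\cap\widetilde{J}(f_*(T_xM))\big)$; when a $\widetilde{J}$-tangent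 transversal field exists it has rank $2$. $\mathcal{D}^{\pm}=\{v\in\mathcal{D}: \widetilde{J}f_*v=\pm f_*v\}$; these are $1$-dimensional distributions with $\mathcal{D}=\mathcal{D}^+\oplus\mathcal{D}^-$. A $1$-dimensional smooth distribution $\mathcal{A}\subset TM$ is a null-direction for $f$ if $h_x(v,v)=0$ for every $x\in M$ and $v\in\mathcal{A}_x$. For planar curves $\mu,\nu$, $(\mu,\nu)$ denotes the curve $(\mu_1,\mu_2,\nu_1,\nu_2)$ in $\mathbb{R}^4$.
   Formalization: Form (2) is proved for f minus its centre (the point c₀ with C = −λ(f − c₀), λ≠0) instead of for f itself: a translate of (2) is still such an affine hypersphere but is not of form (2); if C = −λf then c₀ = 0 and the claim is literal. *)

theory Defs
  imports "HOL-Analysis.Analysis"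
begin

section \<open>Smooth maps and smooth manifolds\<close>

fun Ck_on :: "nat \<Rightarrow> 'a::euclidean_space set \<Rightarrow> ('a \<Rightarrow> 'b::euclidean_space) \<Rightarrow> bool" where
  "Ck_on 0 S F \<longleftrightarrow> continuous_on S F"
| "Ck_on (Suc k) S F \<longleftrightarrow>
     (\<forall>p\<in>S. F differentiable (at p)) \<and> (\<forall>v. Ck_on k S (\<lambda>p. frechet_derivative F (at p) v))"

definition smooth_on :: "'a::euclidean_space set \<Rightarrow> ('a \<Rightarrow> 'b::euclidean_space) \<Rightarrow> bool" where
  "smooth_on S F \<longleftrightarrow> open S \<and> (\<forall>k. Ck_on k S F)"

text \<open>A chart is a pair of its domain and its coordinate map; values of the coordinate map outside
  the domain are irrelevant. The coordinate expression of a map \<open>f\<close> on the manifold is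
  \<open>f \<circ> \<phi>\<inverse>\<close>, to be read on the open set \<open>\<phi> ` U\<close>.\<close>

type_synonym 'm chart = "'m set \<times> ('m \<Rightarrow> real^3)"

definition is_chart :: "'m topology \<Rightarrow> 'm chart \<Rightarrow> bool" where
  "is_chart M = (\<lambda>(U, \<phi>). openin M U \<and> open (\<phi> ` U) \<and>
     homeomorphic_map (subtopology M U) (top_of_set (\<phi> ` U)) \<phi>)"

definition in_chart :: "'m chart \<Rightarrow> ('m \<Rightarrow> 'b) \<Rightarrow> real^3 \<Rightarrow> 'b" where
  "in_chart = (\<lambda>(U, \<phi>) f p. f (inv_into U \<phi> p))"

definition image_of_chart :: "'m chart \<Rightarrow> (real^3) set" where
  "image_of_chart = (\<lambda>(U, \<phi>). \<phi> ` U)"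

definition smooth_atlas :: "'m topology \<Rightarrow> 'm chart set \<Rightarrow> bool" where
  "smooth_atlas M \<A> \<longleftrightarrow>
     (\<forall>c\<in>\<A>. is_chart M c) \<and> (\<Union>c\<in>\<A>. fst c) = topspace M \<and>
     (\<forall>c\<in>\<A>. \<forall>d\<in>\<A>. smooth_on (snd c ` (fst c \<inter> fst d)) (in_chart c (snd d)))"

definition manifold3 :: "'m topology \<Rightarrow> 'm chart set \<Rightarrow> bool" where
  "manifold3 M \<A> \<longleftrightarrow> Hausdorff_space M \<and> second_countable M \<and> smooth_atlas M \<A>"

text \<open>\<open>smooth_atlas M (\<A> \<union> \<B>)\<close> expresses that the charts of \<open>\<B>\<close> belong to the smooth structure
  determined by the atlas \<open>\<A>\<close>.\<close>

definition orientable3 :: "'m topology \<Rightarrow> 'm chart set \<Rightarrow> bool" where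
  "orientable3 M \<A> \<longleftrightarrow> (\<exists>\<B>. smooth_atlas M \<B> \<and> smooth_atlas M (\<A> \<union> \<B>) \<and>
     (\<forall>c\<in>\<B>. \<forall>d\<in>\<B>. \<forall>p\<in>snd c ` (fst c \<inter> fst d).
        det (matrix (frechet_derivative (in_chart c (snd d)) (at p))) > 0))"

definition smooth_map :: "'m chart set \<Rightarrow> ('m \<Rightarrow> real^4) \<Rightarrow> bool" where
  "smooth_map \<A> f \<longleftrightarrow> (\<forall>c\<in>\<A>. smooth_on (image_of_chart c) (in_chart c f))"


section \<open>Affine hypersurfaces in coordinates\<close>

text \<open>Throughout, \<open>F\<close> and \<open>C\<close> are the coordinate expressions of the hypersurface and of a vector
  field along it. Tangent vectors are given by their coordinates in \<open>real^3\<close>, and vector fields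
  are functions of the coordinate point.\<close>

definition push :: "(real^3 \<Rightarrow> real^4) \<Rightarrow> real^3 \<Rightarrow> real^3 \<Rightarrow> real^4" where
  "push F p v = frechet_derivative F (at p) v"

definition flat_D :: "(real^3 \<Rightarrow> real^3) \<Rightarrow> (real^3 \<Rightarrow> real^4) \<Rightarrow> real^3 \<Rightarrow> real^4" where
  "flat_D X W p = frechet_derivative W (at p) (X p)"

definition immersed_at :: "(real^3 \<Rightarrow> real^4) \<Rightarrow> real^3 \<Rightarrow> bool" where
  "immersed_at F p \<longleftrightarrow> inj (push F p)"

definition transversal_at :: "(real^3 \<Rightarrow> real^4) \<Rightarrow> (real^3 \<Rightarrow> real^4) \<Rightarrow> real^3 \<Rightarrow> bool" where
  "transversal_at F C p \<longleftrightarrow> C p \<notin> range (push F p)"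

text \<open>The two components in \<open>w = f\<^sub>* v + c C\<close>; they are unique where \<open>F\<close> is immersed and
  \<open>C\<close> transversal.\<close>

definition tan_part :: "(real^3 \<Rightarrow> real^4) \<Rightarrow> (real^3 \<Rightarrow> real^4) \<Rightarrow> real^3 \<Rightarrow> real^4 \<Rightarrow> real^3" where
  "tan_part F C p w = (THE v. \<exists>c. w = push F p v + c *\<^sub>R C p)"

definition transv_part :: "(real^3 \<Rightarrow> real^4) \<Rightarrow> (real^3 \<Rightarrow> real^4) \<Rightarrow> real^3 \<Rightarrow> real^4 \<Rightarrow> real" where
  "transv_part F C p w = (THE c. \<exists>v. w = push F p v + c *\<^sub>R C p)"

text \<open>\<open>D\<^sub>X f\<^sub>*Y = f\<^sub>*(\<nabla>\<^sub>X Y) + h(X,Y) C\<close> and \<open>D\<^sub>X C = -f\<^sub>*(S X) + \<tau>(X) C\<close>.\<close>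

definition sff :: "(real^3 \<Rightarrow> real^4) \<Rightarrow> (real^3 \<Rightarrow> real^4) \<Rightarrow>
    (real^3 \<Rightarrow> real^3) \<Rightarrow> (real^3 \<Rightarrow> real^3) \<Rightarrow> real^3 \<Rightarrow> real" where
  "sff F C X Y p = transv_part F C p (flat_D X (\<lambda>q. push F q (Y q)) p)"

definition shape_op :: "(real^3 \<Rightarrow> real^4) \<Rightarrow> (real^3 \<Rightarrow> real^4) \<Rightarrow> (real^3 \<Rightarrow> real^3) \<Rightarrow> real^3 \<Rightarrow> real^3" where
  "shape_op F C X p = - tan_part F C p (flat_D X C p)"

definition transv_form :: "(real^3 \<Rightarrow> real^4) \<Rightarrow> (real^3 \<Rightarrow> real^4) \<Rightarrow> (real^3 \<Rightarrow> real^3) \<Rightarrow> real^3 \<Rightarrow> real" where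
  "transv_form F C X p = transv_part F C p (flat_D X C p)"

text \<open>\<open>h\<close> on tangent vectors at \<open>p\<close>, extended to coordinate-constant fields; by
  \<open>sff_tensorial\<close> below every other differentiable extension gives the same value.\<close>

definition sff_at :: "(real^3 \<Rightarrow> real^4) \<Rightarrow> (real^3 \<Rightarrow> real^4) \<Rightarrow> real^3 \<Rightarrow> real^3 \<Rightarrow> real^3 \<Rightarrow> real" where
  "sff_at F C p u v = sff F C (\<lambda>_. u) (\<lambda>_. v) p"

lemma sff_tensorial:
  assumes F: "smooth_on V F" and p: "p \<in> V" and Y: "Y differentiable (at p)"
  shows "sff F C X Y p = sff_at F C p (X p) (Y p)"
proof -
  have V: "open V" and F1: "\<And>q. q \<in> V \<Longrightarrow> F differentiable (at q)"
    using F Ck_on.simps(2)[of 0 V F] by (auto simp: smooth_on_def)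
  have "Ck_on (Suc (Suc 0)) V F" using F by (auto simp: smooth_on_def)
  then have F2: "(\<lambda>q. push F q v) differentiable (at p)" for v
    using p by (auto simp: push_def)
  have lin: "linear (push F q)" if "q \<in> V" for q
    using F1[OF that] linear_frechet_derivative unfolding push_def[abs_def] by blast
  define T where "T v = frechet_derivative (\<lambda>q. push F q v) (at p)" for v
  have T: "((\<lambda>q. push F q v) has_derivative T v) (at p)" for v
    using F2 frechet_derivative_works T_def by metis
  define Y' where "Y' = frechet_derivative Y (at p)"
  have Y': "(Y has_derivative Y') (at p)"
    using Y frechet_derivative_works Y'_def by metis
  have expand: "push F q w = (\<Sum>b\<in>Basis. (w \<bullet> b) *\<^sub>R push F q b)" if "q \<in> V" for q w
  proof -
    have "push F q w = push F q (\<Sum>b\<in>Basis. (w \<bullet> b) *\<^sub>R b)" by (simp add: euclidean_representation)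
    then show ?thesis using lin[OF that] by (simp add: linear_sum linear_cmul)
  qed
  have gen: "((\<lambda>q. push F q (Z q)) has_derivative
      (\<lambda>u. (\<Sum>b\<in>Basis. (Z p \<bullet> b) *\<^sub>R T b u) + push F p (Z' u))) (at p)"
    if Z: "(Z has_derivative Z') (at p)" for Z Z'
  proof -
    have "((\<lambda>q. \<Sum>b\<in>Basis. (Z q \<bullet> b) *\<^sub>R push F q b) has_derivative
      (\<lambda>u. (\<Sum>b\<in>Basis. (Z p \<bullet> b) *\<^sub>R T b u + (Z' u \<bullet> b) *\<^sub>R push F p b))) (at p)"
      by (intro has_derivative_sum has_derivative_scaleR T has_derivative_inner_left Z)
    moreover have "(\<Sum>b\<in>Basis. (Z p \<bullet> b) *\<^sub>R T b u + (Z' u \<bullet> b) *\<^sub>R push F p b)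
      = (\<Sum>b\<in>Basis. (Z p \<bullet> b) *\<^sub>R T b u) + push F p (Z' u)" for u
      unfolding sum.distrib expand[OF p, of "Z' u"] ..
    ultimately have "((\<lambda>q. \<Sum>b\<in>Basis. (Z q \<bullet> b) *\<^sub>R push F q b) has_derivative
      (\<lambda>u. (\<Sum>b\<in>Basis. (Z p \<bullet> b) *\<^sub>R T b u) + push F p (Z' u))) (at p)"
      by simp
    then show ?thesis
      by (rule has_derivative_transform_within_open[OF _ V p]) (rule expand[symmetric])
  qed
  have e1: "flat_D X (\<lambda>q. push F q (Y q)) p
      = (\<Sum>b\<in>Basis. (Y p \<bullet> b) *\<^sub>R T b (X p)) + push F p (Y' (X p))"
    unfolding flat_D_def frechet_derivative_at[OF gen[OF Y'], symmetric] ..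
  have e2: "flat_D (\<lambda>_. X p) (\<lambda>q. push F q (Y p)) p = (\<Sum>b\<in>Basis. (Y p \<bullet> b) *\<^sub>R T b (X p))"
    unfolding flat_D_def frechet_derivative_at[OF gen[OF has_derivative_const[of "Y p"]], symmetric]
    by (simp add: linear_0[OF lin[OF p]])
  have shift: "(\<exists>v. w + push F p a = push F p v + c *\<^sub>R C p) \<longleftrightarrow> (\<exists>v. w = push F p v + c *\<^sub>R C p)"
    for w a c
  proof
    assume "\<exists>v. w + push F p a = push F p v + c *\<^sub>R C p"
    then obtain v where "w + push F p a = push F p v + c *\<^sub>R C p" by blast
    then have "w = push F p (v - a) + c *\<^sub>R C p"
      by (simp add: linear_diff[OF lin[OF p]] diff_add_eq eq_diff_eq)
    then show "\<exists>v. w = push F p v + c *\<^sub>R C p" by blast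
  next
    assume "\<exists>v. w = push F p v + c *\<^sub>R C p"
    then obtain v where "w = push F p v + c *\<^sub>R C p" by blast
    then have "w + push F p a = push F p (v + a) + c *\<^sub>R C p"
      using linear_add[OF lin[OF p], of v a] by simp
    then show "\<exists>v. w + push F p a = push F p v + c *\<^sub>R C p" by blast
  qed
  show ?thesis
    unfolding sff_at_def sff_def e1 e2 transv_part_def shift ..
qed

definition nondegenerate_at :: "(real^3 \<Rightarrow> real^4) \<Rightarrow> (real^3 \<Rightarrow> real^4) \<Rightarrow> real^3 \<Rightarrow> bool" where
  "nondegenerate_at F C p \<longleftrightarrow> (\<forall>u. (\<forall>v. sff_at F C p u v = 0) \<longrightarrow> u = 0)"

text \<open>\<open>vector\<close> lists the rows of the matrix, which is the transpose of the one with the given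
  vectors as columns.\<close>

definition induced_volume :: "(real^3 \<Rightarrow> real^4) \<Rightarrow> (real^3 \<Rightarrow> real^4) \<Rightarrow> real^3 \<Rightarrow>
    real^3 \<Rightarrow> real^3 \<Rightarrow> real^3 \<Rightarrow> real" where
  "induced_volume F C p u v w =
     det (vector [push F p u, push F p v, push F p w, C p] :: real^4^4)"

text \<open>The factor \<open>sgn\<close> extends the formula for positively oriented bases to the volume form on
  all triples.\<close>

definition metric_volume :: "(real^3 \<Rightarrow> real^4) \<Rightarrow> (real^3 \<Rightarrow> real^4) \<Rightarrow> real^3 \<Rightarrow>
    real^3 \<Rightarrow> real^3 \<Rightarrow> real^3 \<Rightarrow> real" where
  "metric_volume F C p u v w =
     (let X = (vector [u, v, w] :: real^3^3) in
      sgn (induced_volume F C p u v w) *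
      sqrt \<bar>det (\<chi> i j. sff_at F C p (X $ i) (X $ j) :: real^3^3)\<bar>)"


section \<open>Affine hyperspheres\<close>

definition immersion :: "'m chart set \<Rightarrow> ('m \<Rightarrow> real^4) \<Rightarrow> bool" where
  "immersion \<A> f \<longleftrightarrow> smooth_map \<A> f \<and>
     (\<forall>c\<in>\<A>. \<forall>p\<in>image_of_chart c. immersed_at (in_chart c f) p)"

definition transversal_field :: "'m chart set \<Rightarrow> ('m \<Rightarrow> real^4) \<Rightarrow> ('m \<Rightarrow> real^4) \<Rightarrow> bool" where
  "transversal_field \<A> f C \<longleftrightarrow> smooth_map \<A> C \<and>
     (\<forall>c\<in>\<A>. \<forall>p\<in>image_of_chart c. transversal_at (in_chart c f) (in_chart c C) p)"

text \<open>Nondegeneracy of \<open>f\<close> does not depend on the transversal field \<open>C\<close> used to test it.\<close>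

definition nondegenerate :: "'m chart set \<Rightarrow> ('m \<Rightarrow> real^4) \<Rightarrow> ('m \<Rightarrow> real^4) \<Rightarrow> bool" where
  "nondegenerate \<A> f C \<longleftrightarrow>
     (\<forall>c\<in>\<A>. \<forall>p\<in>image_of_chart c. nondegenerate_at (in_chart c f) (in_chart c C) p)"

definition blaschke_field :: "'m chart set \<Rightarrow> ('m \<Rightarrow> real^4) \<Rightarrow> ('m \<Rightarrow> real^4) \<Rightarrow> bool" where
  "blaschke_field \<A> f C \<longleftrightarrow> transversal_field \<A> f C \<and>
     (\<forall>c\<in>\<A>. \<forall>p\<in>image_of_chart c.
        (\<forall>v. transv_form (in_chart c f) (in_chart c C) (\<lambda>_. v) p = 0) \<and>
        (\<forall>u v w. metric_volume (in_chart c f) (in_chart c C) p u v w =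
                 induced_volume (in_chart c f) (in_chart c C) p u v w))"

definition affine_hypersphere :: "'m topology \<Rightarrow> 'm chart set \<Rightarrow> ('m \<Rightarrow> real^4) \<Rightarrow> ('m \<Rightarrow> real^4) \<Rightarrow> bool" where
  "affine_hypersphere M \<A> f C \<longleftrightarrow>
     manifold3 M \<A> \<and> connected_space M \<and> orientable3 M \<A> \<and>
     immersion \<A> f \<and> nondegenerate \<A> f C \<and> blaschke_field \<A> f C \<and>
     (\<exists>l::real. \<forall>c\<in>\<A>. \<forall>p\<in>image_of_chart c. \<forall>v.
        shape_op (in_chart c f) (in_chart c C) (\<lambda>_. v) p = l *\<^sub>R v)"

text \<open>The affine normal lines of a hypersphere with \<open>S = l I\<close>, \<open>l \<noteq> 0\<close>, meet in its centre
  \<open>ctr\<close>. The models \<open>model_f\<close> below are centred at the origin, so for an arbitrarily placed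
  hypersphere they describe \<open>f - ctr\<close>; if \<open>C = -l f\<close>, then \<open>ctr = 0\<close>.\<close>

definition centre :: "'m topology \<Rightarrow> ('m \<Rightarrow> real^4) \<Rightarrow> ('m \<Rightarrow> real^4) \<Rightarrow> real^4 \<Rightarrow> bool" where
  "centre M f C ctr \<longleftrightarrow> (\<exists>l::real. l \<noteq> 0 \<and> (\<forall>m\<in>topspace M. C m = - l *\<^sub>R (f m - ctr)))"


section \<open>The para-complex structure\<close>

definition Jt :: "real^4 \<Rightarrow> real^4" where
  "Jt v = vector [v $ 3, v $ 4, v $ 1, v $ 2]"

definition Jt_tangent :: "'m chart set \<Rightarrow> ('m \<Rightarrow> real^4) \<Rightarrow> ('m \<Rightarrow> real^4) \<Rightarrow> bool" where
  "Jt_tangent \<A> f C \<longleftrightarrow>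
     (\<forall>c\<in>\<A>. \<forall>p\<in>image_of_chart c. Jt (in_chart c C p) \<in> range (push (in_chart c f) p))"

definition Dist :: "(real^3 \<Rightarrow> real^4) \<Rightarrow> real^3 \<Rightarrow> (real^3) set" where
  "Dist F p = push F p -` (range (push F p) \<inter> Jt ` range (push F p))"

definition Dist_plus :: "(real^3 \<Rightarrow> real^4) \<Rightarrow> real^3 \<Rightarrow> (real^3) set" where
  "Dist_plus F p = {v \<in> Dist F p. Jt (push F p v) = push F p v}"

definition smooth_line_distribution :: "(real^3) set \<Rightarrow> (real^3 \<Rightarrow> (real^3) set) \<Rightarrow> bool" where
  "smooth_line_distribution V L \<longleftrightarrow> (\<forall>p\<in>V. \<exists>W X. p \<in> W \<and> W \<subseteq> V \<and> smooth_on W X \<and>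
     (\<forall>q\<in>W. X q \<noteq> 0 \<and> L q = span {X q}))"

text \<open>A distribution on the manifold is given by its coordinate expressions \<open>L c\<close> in the charts
  \<open>c\<close>. Being a null-direction does not depend on \<open>C\<close>, since changing the transversal field
  multiplies \<open>h\<close> by a nowhere vanishing function.\<close>

definition null_direction :: "'m chart set \<Rightarrow> ('m \<Rightarrow> real^4) \<Rightarrow> ('m \<Rightarrow> real^4) \<Rightarrow>
    ('m chart \<Rightarrow> real^3 \<Rightarrow> (real^3) set) \<Rightarrow> bool" where
  "null_direction \<A> f C L \<longleftrightarrow> (\<forall>c\<in>\<A>. smooth_line_distribution (image_of_chart c) (L c) \<and>
     (\<forall>p\<in>image_of_chart c. \<forall>v\<in>L c p. sff_at (in_chart c f) (in_chart c C) p v v = 0))"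

definition D_plus :: "('m \<Rightarrow> real^4) \<Rightarrow> 'm chart \<Rightarrow> real^3 \<Rightarrow> (real^3) set" where
  "D_plus f c = Dist_plus (in_chart c f)"


section \<open>The model hypersurfaces\<close>

definition open_interval :: "real set \<Rightarrow> bool" where
  "open_interval I \<longleftrightarrow> open I \<and> is_interval I \<and> I \<noteq> {}"

definition det2 :: "real^2 \<Rightarrow> real^2 \<Rightarrow> real" where
  "det2 a b = det (vector [a, b] :: real^2^2)"

definition velocity :: "(real \<Rightarrow> real^2) \<Rightarrow> real \<Rightarrow> real^2" where
  "velocity \<gamma> y = vector_derivative \<gamma> (at y)"

definition join :: "real^2 \<Rightarrow> real^2 \<Rightarrow> real^4" where
  "join a b = vector [a $ 1, a $ 2, b $ 1, b $ 2]"

definition model_B :: "(real \<Rightarrow> real^2) \<Rightarrow> (real \<Rightarrow> real^2) \<Rightarrow> real \<Rightarrow> real \<Rightarrow> real" where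
  "model_B \<alpha> \<beta> E y =
     E / sqrt \<bar>det2 (\<alpha> y) (velocity \<alpha> y) * det2 (\<beta> y) (velocity \<beta> y)\<bar>"

definition model_g :: "(real \<Rightarrow> real^2) \<Rightarrow> (real \<Rightarrow> real^2) \<Rightarrow> (real \<Rightarrow> real) \<Rightarrow> real \<Rightarrow>
    real \<Rightarrow> real \<Rightarrow> real^4" where
  "model_g \<alpha> \<beta> A E x y =
     (x + A y) *\<^sub>R join (\<alpha> y) (\<alpha> y)
     + model_B \<alpha> \<beta> E y *\<^sub>R join (velocity \<alpha> y) (velocity \<alpha> y)
     + join (\<beta> y) (- \<beta> y)"

definition model_f :: "(real \<Rightarrow> real^2) \<Rightarrow> (real \<Rightarrow> real^2) \<Rightarrow> (real \<Rightarrow> real) \<Rightarrow> real \<Rightarrow>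
    real^3 \<Rightarrow> real^4" where
  "model_f \<alpha> \<beta> A E p =
     cosh (p $ 3) *\<^sub>R Jt (model_g \<alpha> \<beta> A E (p $ 1) (p $ 2))
     - sinh (p $ 3) *\<^sub>R model_g \<alpha> \<beta> A E (p $ 1) (p $ 2)"

definition model_data :: "real set \<Rightarrow> (real \<Rightarrow> real^2) \<Rightarrow> (real \<Rightarrow> real^2) \<Rightarrow> (real \<Rightarrow> real) \<Rightarrow>
    real \<Rightarrow> bool" where
  "model_data I \<alpha> \<beta> A E \<longleftrightarrow> open_interval I \<and> smooth_on I \<alpha> \<and> smooth_on I \<beta> \<and> smooth_on I A \<and>
     (\<forall>y\<in>I. det2 (\<alpha> y) (velocity \<alpha> y) * det2 (\<beta> y) (velocity \<beta> y) \<noteq> 0) \<and> E \<noteq> 0"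

definition slab :: "real set \<Rightarrow> (real^3) set" where
  "slab I = {p. p $ 2 \<in> I}"

end

theory Submission
  imports Defs
begin

text \<open>
  Everything becomes simple in the eigenspaces of \<open>Jt\<close>. Write a point of \<open>real^4\<close> as \<open>(u, w)\<close> with
  \<open>u\<close>, \<open>w\<close> in the planes on which \<open>Jt\<close> is \<open>1\<close> and \<open>-1\<close>. The flow of \<open>- Jt\<close> is
  \<open>(u, w) \<mapsto> (exp (- z) u, exp z w)\<close>, the model surface is
  \<open>(exp (- z) ((x + A) \<alpha> + B \<alpha>'), - exp z \<beta>)\<close>, and \<open>\<D>\<^sup>+\<close> consists of the tangent vectors along which
  \<open>w\<close> does not change.

  Let \<open>f\<close> be a hypersphere as in the first part. Since \<open>\<tau> = 0\<close> and \<open>S = l I\<close>, the field \<open>C + l f\<close> is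
  constant on the connected manifold. If \<open>l\<close> were \<open>0\<close>, the field \<open>Jt C\<close> would be constant and tangent,
  contradicting nondegeneracy (\<open>Jt_tangent_curvature_nonzero\<close>). So there is a centre, which may be
  placed at the origin, and then \<open>Jt f\<close> is tangent, that is, the surface is locally invariant under the
  flow. Because \<open>\<D>\<^sup>+\<close> is a line field, \<open>w\<close> is a submersion, and \<open>w = exp z (e + y e')\<close> together with a
  rescaled component \<open>x\<close> of \<open>u\<close> gives local coordinates (\<open>adapted_chart\<close>); the other component of \<open>u\<close>
  is \<open>exp (- z) Q\<close> for a function \<open>Q\<close>. Invariance under the flow says that \<open>Q\<close> does not depend on \<open>z\<close>.
  The null condition says that the second derivative of \<open>f\<close> in the direction of \<open>x\<close> is tangent, which forces
  \<open>Q\<close> to be affine in \<open>x\<close> (\<open>twist_normal_form\<close>). Hence \<open>u = exp (- z) (x \<alpha>(y) + \<gamma>(y))\<close>: the surface is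
  ruled by straight lines with direction depending on \<open>y\<close> only.

  For such ruled surfaces with transversal field \<open>- l\<close> times the position vector, the second fundamental form
  and the volume forms can be computed. Nondegeneracy means \<open>det2 \<alpha> \<alpha>' \<noteq> 0\<close>
  (\<open>nondegenerate_ruled_iff\<close>), and the Blaschke condition is
  \<open>(det2 \<alpha> \<alpha>')\<^sup>2 = 256 \<bar>l\<bar>^5 (det2 \<alpha> \<gamma>)^4 (det2 \<beta> \<beta>')\<^sup>2\<close> (\<open>blaschke_volume_ruled_iff\<close>). With
  \<open>\<gamma> = A \<alpha> + B \<alpha>'\<close> it says that, up to sign, \<open>B\<close> is a constant divided by the square root of
  \<open>\<bar>det2 \<alpha> \<alpha>' * det2 \<beta> \<beta>'\<bar>\<close>. The sign is constant by continuity. Read in one direction this yields the constant \<open>E\<close> of the first part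
  (\<open>ruled_eq_model\<close>); read in the other, with \<open>l\<close> determined by \<open>256 l^5 E^4 = 1\<close>, it yields the second part
  (\<open>model_affine_hypersphere\<close>).
\<close>

section \<open>Calculus of \<open>C\<^sup>k\<close> maps\<close>

lemma Ck_on_subset: "Ck_on k S F \<Longrightarrow> T \<subseteq> S \<Longrightarrow> Ck_on k T F"
  by (induction k arbitrary: F) (auto intro: continuous_on_subset)

lemma Ck_on_cong:
  assumes "open S" "\<And>x. x \<in> S \<Longrightarrow> F x = G x" "Ck_on k S F"
  shows "Ck_on k S G"
  using assms(2,3)
proof (induction k arbitrary: F G)
  case 0
  then show ?case by (simp cong: continuous_on_cong)
next
  case (Suc k)
  have d: "F differentiable at p" if "p \<in> S" for p using Suc.prems that by auto
  have d2: "G differentiable at p" if "p \<in> S" for p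
    using d[OF that] has_derivative_transform_within_open[OF _ \<open>open S\<close> that] Suc.prems(1)
    unfolding differentiable_def by metis
  have e: "frechet_derivative F (at p) = frechet_derivative G (at p)" if "p \<in> S" for p
    using frechet_derivative_transform_within_open[OF d[OF that] \<open>open S\<close> that] Suc.prems by auto
  have "Ck_on k S (\<lambda>p. frechet_derivative G (at p) v)" for v
    by (rule Suc.IH[of "\<lambda>p. frechet_derivative F (at p) v"]) (use Suc.prems e in auto)
  then show ?case using d2 by auto
qed

text \<open>Lets the derivative be given by a formula valid on \<open>S\<close> only.\<close>

lemma Ck_on_SucI:
  assumes S: "open S" and d: "\<And>p. p \<in> S \<Longrightarrow> (F has_derivative F' p) (at p)"
    and "\<And>v. Ck_on k S (\<lambda>p. F' p v)"
  shows "Ck_on (Suc k) S F"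
proof -
  have "frechet_derivative F (at p) = F' p" if "p \<in> S" for p
    using frechet_derivative_at[OF d[OF that]] by simp
  then show ?thesis
    using assms Ck_on_cong[OF S, of "\<lambda>p. F' p v" "\<lambda>p. frechet_derivative F (at p) v" k for v]
    by (auto simp: differentiable_def)
qed

lemma Ck_on_Suc_has_derivative:
  "Ck_on (Suc k) S F \<Longrightarrow> p \<in> S \<Longrightarrow> (F has_derivative frechet_derivative F (at p)) (at p)"
  using frechet_derivative_works by auto

lemma Ck_on_lower: "Ck_on (Suc k) S F \<Longrightarrow> Ck_on k S F"
proof (induction k arbitrary: F)
  case 0
  then show ?case
    by (auto intro!: continuous_at_imp_continuous_on differentiable_imp_continuous_within)
next
  case (Suc k)
  then show ?case by (metis Ck_on.simps(2))
qed

lemma Ck_on_const: "Ck_on k S (\<lambda>_. c)"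
proof (induction k arbitrary: c)
  case (Suc k)
  have "frechet_derivative (\<lambda>_. c) (at p) = (\<lambda>_. 0)" for p
    by (metis frechet_derivative_at has_derivative_const)
  then show ?case using Suc by auto
qed simp

lemma Ck_on_bounded_linear:
  assumes "open S" "bounded_linear L" shows "Ck_on k S L"
proof (cases k)
  case 0
  then show ?thesis using assms by (simp add: linear_continuous_on)
next
  case (Suc j)
  then show ?thesis
    using Ck_on_SucI[OF assms(1), of L "\<lambda>_. L" j] assms(2)
    by (auto simp: Ck_on_const bounded_linear_imp_has_derivative simp del: Ck_on.simps)
qed

lemma Ck_on_id: "open S \<Longrightarrow> Ck_on k S (\<lambda>x. x)"
  by (rule Ck_on_bounded_linear) (auto intro: bounded_linear_ident)

lemma Ck_on_add:
  assumes S: "open S" and "Ck_on k S F" "Ck_on k S G" shows "Ck_on k S (\<lambda>p. F p + G p)"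
  using assms(2,3)
proof (induction k arbitrary: F G)
  case 0
  then show ?case by (auto intro: continuous_on_add)
next
  case (Suc k)
  show ?case
    by (rule Ck_on_SucI[OF S has_derivative_add, OF Ck_on_Suc_has_derivative Ck_on_Suc_has_derivative])
      (use Suc in auto)
qed

lemma Ck_on_bilinear:
  assumes S: "open S" and b: "bounded_bilinear b" and "Ck_on k S F" "Ck_on k S G"
  shows "Ck_on k S (\<lambda>p. b (F p) (G p))"
  using assms(3,4)
proof (induction k arbitrary: F G)
  case 0
  then show ?case using bounded_bilinear.continuous_on[OF b] by auto
next
  case (Suc k)
  have FG: "Ck_on k S F" "Ck_on k S G" using Suc.prems Ck_on_lower by auto
  show ?case
    by (rule Ck_on_SucI[OF S bounded_bilinear.FDERIV[OF b],
          OF Ck_on_Suc_has_derivative Ck_on_Suc_has_derivative])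
      (use Suc FG in \<open>auto intro!: Ck_on_add S\<close>)
qed

lemmas Ck_on_scaleR = Ck_on_bilinear[OF _ bounded_bilinear_scaleR]
lemmas Ck_on_inner = Ck_on_bilinear[OF _ bounded_bilinear_inner]

lemma Ck_on_mult:
  "open S \<Longrightarrow> Ck_on k S F \<Longrightarrow> Ck_on k S G \<Longrightarrow> Ck_on k S (\<lambda>p. F p * G p :: real)"
  by (rule Ck_on_bilinear[OF _ bounded_bilinear_mult])

lemma Ck_on_sum:
  assumes "open S" "\<And>i. i \<in> I \<Longrightarrow> Ck_on k S (F i)"
  shows "Ck_on k S (\<lambda>p. \<Sum>i\<in>I. F i p)"
  using assms(2) by (induction I rule: infinite_finite_induct)
    (auto intro: Ck_on_add Ck_on_const assms(1))

text \<open>The directional derivatives of the composition are sums of products of directional derivatives of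
  the outer map, at fixed basis directions, with components of those of the inner map; so the chain rule
  reduces one order to the product rule and the previous order.\<close>

lemma Ck_on_compose:
  assumes S: "open S" and T: "open T"
    and "Ck_on k S F" "Ck_on k T G" "\<And>p. p \<in> S \<Longrightarrow> F p \<in> T"
  shows "Ck_on k S (\<lambda>p. G (F p))"
  using assms(3-5)
proof (induction k arbitrary: F G)
  case 0
  then show ?case by (auto intro: continuous_on_compose2)
next
  case (Suc k)
  define G' where "G' q = frechet_derivative G (at q)" for q
  define F' where "F' p = frechet_derivative F (at p)" for p
  have dF: "(F has_derivative F' p) (at p)" if "p \<in> S" for p
    using Ck_on_Suc_has_derivative[OF Suc.prems(1) that] by (simp add: F'_def)
  have dG: "(G has_derivative G' q) (at q)" if "q \<in> T" for q
    using Ck_on_Suc_has_derivative[OF Suc.prems(2) that] by (simp add: G'_def)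
  have e: "(\<Sum>b\<in>Basis. (F' p v \<bullet> b) *\<^sub>R G' (F p) b) = G' (F p) (F' p v)" if "p \<in> S" for p v
  proof -
    have l: "linear (G' (F p))"
      using dG[OF Suc.prems(3)[OF that]] has_derivative_linear by blast
    have "G' (F p) (F' p v) = G' (F p) (\<Sum>b\<in>Basis. (F' p v \<bullet> b) *\<^sub>R b)"
      by (simp add: euclidean_representation)
    then show ?thesis by (simp add: linear_sum[OF l] linear_cmul[OF l])
  qed
  have c: "Ck_on k S (\<lambda>p. G' (F p) b)" for b
    using Suc.prems Suc.IH[OF Ck_on_lower[OF Suc.prems(1)], of "\<lambda>q. G' q b"] by (auto simp: G'_def)
  have "Ck_on k S (\<lambda>p. F' p v)" for v using Suc.prems by (auto simp: F'_def)
  then have "Ck_on k S (\<lambda>p. \<Sum>b\<in>Basis. (F' p v \<bullet> b) *\<^sub>R G' (F p) b)" for v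
    by (intro Ck_on_sum Ck_on_scaleR Ck_on_inner S c Ck_on_const)
  then have c': "Ck_on k S (\<lambda>p. G' (F p) (F' p v))" for v
    by (rule Ck_on_cong[OF S e, rotated])
  show ?case
    by (rule Ck_on_SucI[OF S has_derivative_compose[OF dF dG[OF Suc.prems(3)]] c'])
qed

text \<open>The derivatives of \<open>exp\<close> and \<open>inverse\<close> are polynomials in the function itself, so one order of
  differentiability gives the next; the derivative of \<open>ln\<close> is \<open>inverse\<close>.\<close>

lemma Ck_on_exp: "open S \<Longrightarrow> Ck_on k S (exp :: real \<Rightarrow> real)"
proof (induction k)
  case 0 then show ?case by (auto intro: continuous_on_exp continuous_on_id)
next
  case (Suc k)
  show ?case
    by (rule Ck_on_SucI[OF \<open>open S\<close>, where F' = "\<lambda>p v. v * exp p"])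
      (use Suc in \<open>auto intro!: derivative_eq_intros Ck_on_mult Ck_on_const\<close>)
qed

lemma Ck_on_inverse: "Ck_on k (- {0}) (inverse :: real \<Rightarrow> real)"
proof (induction k)
  case 0 then show ?case by (auto intro: continuous_on_inverse continuous_on_id)
next
  case (Suc k)
  show ?case
  proof (rule Ck_on_SucI[where F' = "\<lambda>p v. (- v) * (inverse p * inverse p)"])
    show "Ck_on k (- {0}) (\<lambda>p. - v * (inverse p * inverse p))" for v :: real
      by (intro Ck_on_mult Ck_on_const Suc) auto
  qed (auto intro!: derivative_eq_intros)
qed

lemma Ck_on_ln: "Ck_on k {0<..} (ln :: real \<Rightarrow> real)"
proof (cases k)
  case 0 then show ?thesis by (auto intro!: continuous_on_ln continuous_on_id)
next
  case (Suc k)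
  show ?thesis unfolding Suc
  proof (rule Ck_on_SucI[where F' = "\<lambda>p v. v * inverse p"])
    show "Ck_on k {0<..} (\<lambda>p. v * inverse p)" for v :: real
      by (intro Ck_on_mult Ck_on_const Ck_on_subset[OF Ck_on_inverse]) auto
  qed (auto intro!: derivative_eq_intros simp: field_simps)
qed


lemma Ck_on_componentwise:
  fixes F :: "'a::euclidean_space \<Rightarrow> real^'n"
  assumes "open S" "\<And>i. Ck_on k S (\<lambda>p. F p $ i)"
  shows "Ck_on k S F"
proof -
  have "Ck_on k S (\<lambda>p. \<Sum>i\<in>UNIV. (F p $ i) *\<^sub>R (axis i 1 :: real^'n))"
    by (intro Ck_on_sum Ck_on_scaleR Ck_on_const assms)
  then show ?thesis
    by (rule Ck_on_cong[OF assms(1), rotated]) (simp add: vec_eq_iff axis_def if_distrib cong: if_cong)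
qed

lemma Ck_on_component: "open S \<Longrightarrow> Ck_on k S F \<Longrightarrow> Ck_on k S (\<lambda>p. F p $ i)"
  by (rule Ck_on_compose[where T = UNIV])
    (auto intro: Ck_on_bounded_linear bounded_linear_vec_nth)

lemma Ck_on_prod:
  "open S \<Longrightarrow> (\<And>i. i \<in> I \<Longrightarrow> Ck_on k S (F i)) \<Longrightarrow> Ck_on k S (\<lambda>p. \<Prod>i\<in>I. F i p :: real)"
  by (induction I rule: infinite_finite_induct) (auto intro: Ck_on_mult Ck_on_const)

lemma Ck_on_det:
  fixes A :: "'a::euclidean_space \<Rightarrow> real^'n^'n"
  assumes "open S" "\<And>i j. Ck_on k S (\<lambda>p. A p $ i $ j)"
  shows "Ck_on k S (\<lambda>p. det (A p))"
  unfolding det_def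
  by (intro Ck_on_sum Ck_on_mult Ck_on_const Ck_on_prod assms)

section \<open>Smooth maps\<close>

lemma smooth_on_open: "smooth_on S F \<Longrightarrow> open S"
  by (simp add: smooth_on_def)

lemma smooth_on_Ck_on: "smooth_on S F \<Longrightarrow> Ck_on k S F"
  by (simp add: smooth_on_def)

lemma smooth_on_continuous_on: "smooth_on S F \<Longrightarrow> continuous_on S F"
  using smooth_on_Ck_on[of S F 0] by simp

lemma smooth_on_differentiable: "smooth_on S F \<Longrightarrow> p \<in> S \<Longrightarrow> F differentiable (at p)"
  using smooth_on_Ck_on[of S F "Suc 0"] by simp

lemma smooth_on_has_derivative:
  "smooth_on S F \<Longrightarrow> p \<in> S \<Longrightarrow> (F has_derivative frechet_derivative F (at p)) (at p)"
  using smooth_on_differentiable frechet_derivative_works by blast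

lemma smooth_on_frechet_derivative:
  "smooth_on S F \<Longrightarrow> smooth_on S (\<lambda>p. frechet_derivative F (at p) v)"
  unfolding smooth_on_def by (metis Ck_on.simps(2))

lemma smooth_on_subset: "smooth_on S F \<Longrightarrow> open T \<Longrightarrow> T \<subseteq> S \<Longrightarrow> smooth_on T F"
  unfolding smooth_on_def using Ck_on_subset by blast

lemma smooth_on_cong: "smooth_on S F \<Longrightarrow> (\<And>x. x \<in> S \<Longrightarrow> F x = G x) \<Longrightarrow> smooth_on S G"
  unfolding smooth_on_def using Ck_on_cong by blast

lemma smooth_on_const: "open S \<Longrightarrow> smooth_on S (\<lambda>_. c)"
  by (simp add: smooth_on_def Ck_on_const)

lemma smooth_on_id: "open S \<Longrightarrow> smooth_on S (\<lambda>x. x)"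
  by (simp add: smooth_on_def Ck_on_id)

lemma smooth_on_add: "smooth_on S F \<Longrightarrow> smooth_on S G \<Longrightarrow> smooth_on S (\<lambda>p. F p + G p)"
  by (simp add: smooth_on_def Ck_on_add)

lemma smooth_on_scaleR: "smooth_on S F \<Longrightarrow> smooth_on S G \<Longrightarrow> smooth_on S (\<lambda>p. F p *\<^sub>R G p)"
  by (simp add: smooth_on_def Ck_on_scaleR)

lemma smooth_on_mult:
  "smooth_on S F \<Longrightarrow> smooth_on S G \<Longrightarrow> smooth_on S (\<lambda>p. F p * G p :: real)"
  by (simp add: smooth_on_def Ck_on_mult)

lemma smooth_on_inner: "smooth_on S F \<Longrightarrow> smooth_on S G \<Longrightarrow> smooth_on S (\<lambda>p. F p \<bullet> G p)"
  by (simp add: smooth_on_def Ck_on_inner)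

lemma smooth_on_sum:
  "open S \<Longrightarrow> (\<And>i. i \<in> I \<Longrightarrow> smooth_on S (F i)) \<Longrightarrow> smooth_on S (\<lambda>p. \<Sum>i\<in>I. F i p)"
  by (simp add: smooth_on_def Ck_on_sum)

lemma smooth_on_compose:
  "smooth_on S F \<Longrightarrow> smooth_on T G \<Longrightarrow> (\<And>p. p \<in> S \<Longrightarrow> F p \<in> T) \<Longrightarrow> smooth_on S (\<lambda>p. G (F p))"
  unfolding smooth_on_def using Ck_on_compose by blast

lemma smooth_on_bounded_linear:
  "bounded_linear L \<Longrightarrow> smooth_on S F \<Longrightarrow> smooth_on S (\<lambda>p. L (F p))"
  by (rule smooth_on_compose[where T = UNIV]) (auto simp: smooth_on_def Ck_on_bounded_linear)

lemma smooth_on_minus: "smooth_on S F \<Longrightarrow> smooth_on S (\<lambda>p. - F p)"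
  by (rule smooth_on_bounded_linear[OF bounded_linear_minus[OF bounded_linear_ident]])

lemma smooth_on_diff: "smooth_on S F \<Longrightarrow> smooth_on S G \<Longrightarrow> smooth_on S (\<lambda>p. F p - G p)"
  using smooth_on_add[OF _ smooth_on_minus] by force

lemma smooth_on_exp: "smooth_on S F \<Longrightarrow> smooth_on S (\<lambda>p. exp (F p) :: real)"
  by (rule smooth_on_compose[where T = UNIV]) (auto simp: smooth_on_def Ck_on_exp)

lemma smooth_on_inverse:
  "smooth_on S F \<Longrightarrow> (\<And>p. p \<in> S \<Longrightarrow> F p \<noteq> 0) \<Longrightarrow> smooth_on S (\<lambda>p. inverse (F p) :: real)"
  by (rule smooth_on_compose[where T = "-{0}"]) (auto simp: smooth_on_def Ck_on_inverse)

lemma smooth_on_ln: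
  "smooth_on S F \<Longrightarrow> (\<And>p. p \<in> S \<Longrightarrow> F p > 0) \<Longrightarrow> smooth_on S (\<lambda>p. ln (F p) :: real)"
  by (rule smooth_on_compose[where T = "{0<..}"]) (auto simp: smooth_on_def Ck_on_ln)

lemma smooth_on_divide:
  "smooth_on S F \<Longrightarrow> smooth_on S G \<Longrightarrow> (\<And>p. p \<in> S \<Longrightarrow> G p \<noteq> 0) \<Longrightarrow>
    smooth_on S (\<lambda>p. F p / G p :: real)"
  unfolding divide_inverse by (intro smooth_on_mult smooth_on_inverse) auto

lemma smooth_on_component: "smooth_on S F \<Longrightarrow> smooth_on S (\<lambda>p. F p $ i)"
  by (rule smooth_on_bounded_linear[OF bounded_linear_vec_nth])

lemma smooth_on_componentwise:
  fixes F :: "'a::euclidean_space \<Rightarrow> real^'n"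
  shows "open S \<Longrightarrow> (\<And>i. smooth_on S (\<lambda>p. F p $ i)) \<Longrightarrow> smooth_on S F"
  by (simp add: smooth_on_def Ck_on_componentwise)

section \<open>Smooth inverse functions\<close>

text \<open>The derivative of the inverse is the inverse matrix of the derivative, whose entries are
  rational in the entries of the latter by Cramer's rule; so each order of differentiability of the
  inverse gives the next.\<close>

lemma Ck_on_inverse_map:
  fixes F :: "real^'n \<Rightarrow> real^'n"
  assumes V: "open V" and F: "smooth_on V F" and W: "open W"
    and GV: "\<And>q. q \<in> W \<Longrightarrow> G q \<in> V" 
    and cont: "continuous_on W G"
    and dG: "\<And>q. q \<in> W \<Longrightarrow> (G has_derivative G' q) (at q)"
    and inv: "\<And>q v. q \<in> W \<Longrightarrow> frechet_derivative F (at (G q)) (G' q v) = v"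
    and bij: "\<And>q. q \<in> W \<Longrightarrow> bij (frechet_derivative F (at (G q)))"
  shows "Ck_on k W G"
proof (induction k)
  case 0
  then show ?case using cont by simp
next
  case (Suc k)
  define A where "A q = matrix (frechet_derivative F (at (G q)))" for q
  have lin: "linear (frechet_derivative F (at (G q)))" if "q \<in> W" for q
    using smooth_on_has_derivative[OF F GV[OF that]] has_derivative_linear by blast
  have Av: "A q *v v = frechet_derivative F (at (G q)) v" if "q \<in> W" for q v
    using lin[OF that] matrix_works[of "frechet_derivative F (at (G q))" v]
    by (simp add: A_def linear_matrix_vector_mul_eq)
  have det: "det (A q) \<noteq> 0" if "q \<in> W" for q
    using bij[OF that] lin[OF that] unfolding A_def
    by (metis bij_def det_nz_iff_inj)
  have cA: "Ck_on k W (\<lambda>q. A q $ i $ j)" for i j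
  proof -
    have "Ck_on k W (\<lambda>q. frechet_derivative F (at (G q)) (axis j 1))"
      by (rule Ck_on_compose[OF W V Suc smooth_on_Ck_on[OF smooth_on_frechet_derivative[OF F]] GV])
    then show ?thesis
      unfolding A_def matrix_def by (simp add: Ck_on_component[OF W])
  qed
  have G': "G' q v = (\<chi> c. det (\<chi> i j. if j = c then v $ i else A q $ i $ j) / det (A q))"
    if "q \<in> W" for q v
    using cramer[OF det[OF that], of "G' q v" v] inv[OF that] Av[OF that] by simp
  have cI: "Ck_on k W (\<lambda>q. inverse (det (A q)))"
    by (rule Ck_on_compose[OF W _ Ck_on_det[OF W cA] Ck_on_inverse]) (auto simp: det)
  have "Ck_on k W (\<lambda>q. \<chi> c. det (\<chi> i j. if j = c then v $ i else A q $ i $ j) / det (A q))" for v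
  proof (rule Ck_on_componentwise[OF W])
    fix c
    have "Ck_on k W (\<lambda>q. if j = c then v $ i else A q $ i $ j)" for i j
      by (cases "j = c") (auto simp: Ck_on_const cA)
    then show "Ck_on k W (\<lambda>q. (\<chi> c. det (\<chi> i j. if j = c then v $ i else A q $ i $ j) / det (A q)) $ c)"
      unfolding divide_inverse by (simp add: Ck_on_mult Ck_on_det W cI)
  qed
  then have "Ck_on k W (\<lambda>q. G' q v)" for v
    by (rule Ck_on_cong[OF W G'[symmetric], rotated])
  then show ?case using Ck_on_SucI[OF W dG] by blast
qed

text \<open>The inverse function theorem provides a differentiable local inverse with invertible derivatives,
  to which the preceding lemma applies.\<close>

lemma smooth_local_inverse:
  fixes F :: "real^'n \<Rightarrow> real^'n"
  assumes F: "smooth_on V F" and p: "p \<in> V" and inj: "inj (frechet_derivative F (at p))"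
  obtains U W G where "open U" "U \<subseteq> V" "p \<in> U" "open W" "F p \<in> W" "homeomorphism U W F G"
    "smooth_on W G"
proof -
  define F' where "F' q = Blinfun (frechet_derivative F (at q))" for q
  have bl: "bounded_linear (frechet_derivative F (at q))" if "q \<in> V" for q
    using smooth_on_has_derivative[OF F that] has_derivative_bounded_linear by blast
  have F': "blinfun_apply (F' q) = frechet_derivative F (at q)" if "q \<in> V" for q
    using bounded_linear_Blinfun_apply[OF bl[OF that]] by (simp add: F'_def)
  have dF: "(F has_derivative blinfun_apply (F' q)) (at q)" if "q \<in> V" for q
    using smooth_on_has_derivative[OF F that] by (simp add: F'[OF that])
  have cF: "continuous_on V F'"
  proof (rule continuous_on_blinfun_componentwise)
    fix i :: "real^'n" assume "i \<in> Basis"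
    show "continuous_on V (\<lambda>q. blinfun_apply (F' q) i)"
      using smooth_on_continuous_on[OF smooth_on_frechet_derivative[OF F, of i]] F'
      by (simp cong: continuous_on_cong)
  qed
  obtain h where h: "linear h" "h \<circ> frechet_derivative F (at p) = id"
    using linear_injective_left_inverse[OF bounded_linear.linear[OF bl[OF p]] inj] by blast
  have "Blinfun h o\<^sub>L F' p = id_blinfun"
    using h by (intro blinfun_eqI)
      (simp add: F'[OF p] bounded_linear_Blinfun_apply linear_conv_bounded_linear pointfree_idE)
  from inverse_function_theorem[OF smooth_on_open[OF F] dF cF p this]
  obtain U W G G' where *: "open U" "U \<subseteq> V" "p \<in> U" "open W" "F p \<in> W" "homeomorphism U W F G"
    "\<And>y. y \<in> W \<Longrightarrow> (G has_derivative (G' y)) (at y)"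
    "\<And>y. y \<in> W \<Longrightarrow> G' y = inv (blinfun_apply (F'(G y)))"
    "\<And>y. y \<in> W \<Longrightarrow> bij (blinfun_apply (F'(G y)))"
    by metis
  have GV: "G q \<in> V" if "q \<in> W" for q using *(2,6) that by (auto simp: homeomorphism_def)
  have "Ck_on k W G" for k
  proof (rule Ck_on_inverse_map[OF smooth_on_open[OF F] F *(4) GV _ *(7)])
    show "continuous_on W G" using *(6) by (simp add: homeomorphism_def)
    show b: "bij (frechet_derivative F (at (G q)))" if "q \<in> W" for q
      using *(9)[OF that] F'[OF GV[OF that]] by simp
    show "frechet_derivative F (at (G q)) (G' q v) = v" if "q \<in> W" for q v
      using b[OF that] *(8)[OF that] F'[OF GV[OF that]] by (simp add: bij_is_surj surj_f_inv_f)
  qed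
  then have "smooth_on W G" using *(4) by (simp add: smooth_on_def)
  with * that show thesis by blast
qed

section \<open>Decomposition along a transversal field\<close>

lemma smooth_on_linear_push: "smooth_on V F \<Longrightarrow> p \<in> V \<Longrightarrow> linear (push F p)"
  using smooth_on_has_derivative has_derivative_linear unfolding push_def[abs_def] by blast

lemma transv_part_eqI:
  assumes l: "linear (push F p)" and t: "transversal_at F C p"
    and w: "w = push F p v + c *\<^sub>R C p"
  shows "transv_part F C p w = c"
  unfolding transv_part_def
proof (rule the_equality)
  show "\<exists>v. w = push F p v + c *\<^sub>R C p" using w by blast
  fix c' assume "\<exists>v. w = push F p v + c' *\<^sub>R C p"
  then obtain v' where v': "w = push F p v' + c' *\<^sub>R C p" by blast
  show "c' = c"
  proof (rule ccontr)
    assume ne: "c' \<noteq> c"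
    have "push F p v' + c' *\<^sub>R C p = push F p v + c *\<^sub>R C p"
      by (rule trans[OF v'[symmetric] w])
    from arg_cong[OF this, of "\<lambda>x. x - (push F p v' + c *\<^sub>R C p)"]
    have "c' *\<^sub>R C p - c *\<^sub>R C p = push F p v - push F p v'"
      by (simp only: add_diff_cancel_left add_diff_cancel_right)
    then have "(c' - c) *\<^sub>R C p = push F p (v - v')"
      by (simp only: linear_diff[OF l] scaleR_left_diff_distrib)
    from arg_cong[OF this, of "scaleR (inverse (c' - c))"] ne
    have "C p = inverse (c' - c) *\<^sub>R push F p (v - v')" by simp
    also have "\<dots> = push F p (inverse (c' - c) *\<^sub>R (v - v'))" by (rule linear_cmul[OF l, symmetric])
    finally show False using t unfolding transversal_at_def by blast
  qed
qed

lemma tan_part_eqI: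
  assumes l: "linear (push F p)" and i: "immersed_at F p" and t: "transversal_at F C p"
    and w: "w = push F p v + c *\<^sub>R C p"
  shows "tan_part F C p w = v"
  unfolding tan_part_def
proof (rule the_equality)
  show "\<exists>c. w = push F p v + c *\<^sub>R C p" using w by blast
  fix v' assume "\<exists>c. w = push F p v' + c *\<^sub>R C p"
  then obtain c' where v': "w = push F p v' + c' *\<^sub>R C p" by blast
  have "c' = c" using transv_part_eqI[OF l t w] transv_part_eqI[OF l t v'] by simp
  then have "push F p v' = push F p v" using w v' by (metis add_right_cancel)
  then show "v' = v" using i unfolding immersed_at_def by (simp add: inj_eq)
qed

text \<open>A hyperplane and a transversal line span the space.\<close>

lemma transversal_decomposition:
  assumes l: "linear (push F p)" and i: "immersed_at F p" and t: "transversal_at F C p"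
  obtains v c where "w = push F p v + c *\<^sub>R C p"
proof -
  have d: "dim (range (push F p)) = 3"
    using dim_image_eq[OF l, of UNIV] i by (simp add: immersed_at_def dim_UNIV)
  have s: "span (range (push F p)) = range (push F p)"
    unfolding span_eq_iff by (rule linear_subspace_image[OF l subspace_UNIV])
  have "dim (insert (C p) (range (push F p))) = DIM(real^4)"
    using t by (simp add: dim_insert s transversal_at_def d)
  then have "w \<in> span (insert (C p) (range (push F p)))"
    using dim_eq_full by blast
  then obtain c where "w - c *\<^sub>R C p \<in> range (push F p)"
    unfolding span_insert s by blast
  then obtain v where "w - c *\<^sub>R C p = push F p v" by blast
  then have "w = push F p v + c *\<^sub>R C p" by (simp add: algebra_simps)
  then show thesis by (rule that)
qed

lemma transv_part_decomposition:
  assumes l: "linear (push F p)" and i: "immersed_at F p" and t: "transversal_at F C p"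
  obtains v where "w = push F p v + transv_part F C p w *\<^sub>R C p"
proof -
  obtain v c where w: "w = push F p v + c *\<^sub>R C p" by (rule transversal_decomposition[OF assms])
  have c: "transv_part F C p w = c" using l t w by (rule transv_part_eqI)
  show thesis by (rule that[of v]) (unfold c, rule w)
qed

section \<open>Change of coordinates\<close>

text \<open>Everything below sees the map only through its differential, which a translation does not change;
  this is why a hypersphere may be moved so that its centre is the origin.\<close>

lemma push_translate: "push (\<lambda>p. F p - c) = push F"
proof -
  have "((\<lambda>p. F p - c) has_derivative D) (at p) \<longleftrightarrow> (F has_derivative D) (at p)" for D p
    using has_derivative_diff[of F D "at p" "\<lambda>_. c" "\<lambda>_. 0"]
      has_derivative_add[of "\<lambda>p. F p - c" D "at p" "\<lambda>_. c" "\<lambda>_. 0"] by auto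
  then show ?thesis unfolding push_def frechet_derivative_def by (intro ext) simp
qed

lemma push_cong:
  assumes "open W" "q \<in> W" "F differentiable (at q)" "\<And>r. r \<in> W \<Longrightarrow> F r = G r"
  shows "push F q = push G q"
  unfolding push_def using frechet_derivative_transform_within_open[OF assms(3,1,2,4)] by auto

lemma transv_part_cong:
  assumes "push F p = push G p" "C p = C' p"
  shows "transv_part F C p = transv_part G C' p"
  unfolding transv_part_def using assms by simp

lemma sff_at_cong:
  assumes F: "smooth_on W F" and q: "q \<in> W" and e: "\<And>r. r \<in> W \<Longrightarrow> F r = G r" and C: "C q = C' q"
  shows "sff_at F C q = sff_at G C' q"
proof (intro ext)
  fix u v
  have p: "push F r = push G r" if "r \<in> W" for r
    by (rule push_cong[OF smooth_on_open[OF F] that smooth_on_differentiable[OF F that] e])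
  have "frechet_derivative (\<lambda>r. push F r v) (at q) = frechet_derivative (\<lambda>r. push G r v) (at q)"
  proof (rule frechet_derivative_transform_within_open[OF _ smooth_on_open[OF F] q])
    show "(\<lambda>r. push F r v) differentiable (at q)"
      unfolding push_def by (rule smooth_on_differentiable[OF smooth_on_frechet_derivative[OF F] q])
    show "push F r v = push G r v" if "r \<in> W" for r using p[OF that] by (rule fun_cong)
  qed
  then show "sff_at F C q u v = sff_at G C' q u v"
    unfolding sff_at_def sff_def flat_D_def by (simp only: transv_part_cong[of F q G C C', OF p[OF q] C])
qed

definition smooth_diffeo ::
    "(real^3) set \<Rightarrow> (real^3) set \<Rightarrow> (real^3 \<Rightarrow> real^3) \<Rightarrow> (real^3 \<Rightarrow> real^3) \<Rightarrow> bool" where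
  "smooth_diffeo V W \<Phi> \<Psi> \<longleftrightarrow> smooth_on V \<Phi> \<and> smooth_on W \<Psi> \<and> homeomorphism V W \<Phi> \<Psi>"

lemma smooth_diffeo_maps:
  assumes "smooth_diffeo V W \<Phi> \<Psi>"
  shows "p \<in> V \<Longrightarrow> \<Phi> p \<in> W" "q \<in> W \<Longrightarrow> \<Psi> q \<in> V"
    "p \<in> V \<Longrightarrow> \<Psi> (\<Phi> p) = p" "q \<in> W \<Longrightarrow> \<Phi> (\<Psi> q) = q"
proof -
  have h: "homeomorphism V W \<Phi> \<Psi>" using assms by (simp add: smooth_diffeo_def)
  show "p \<in> V \<Longrightarrow> \<Phi> p \<in> W" using homeomorphism_image1[OF h] by blast
  show "q \<in> W \<Longrightarrow> \<Psi> q \<in> V" using homeomorphism_image2[OF h] by blast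
  show "p \<in> V \<Longrightarrow> \<Psi> (\<Phi> p) = p" by (rule homeomorphism_apply1[OF h])
  show "q \<in> W \<Longrightarrow> \<Phi> (\<Psi> q) = q" by (rule homeomorphism_apply2[OF h])
qed

lemma smooth_diffeo_frechet:
  assumes d: "smooth_diffeo V W \<Phi> \<Psi>" and q: "q \<in> W"
  shows "frechet_derivative \<Phi> (at (\<Psi> q)) (frechet_derivative \<Psi> (at q) v) = v"
    "frechet_derivative \<Psi> (at q) (frechet_derivative \<Phi> (at (\<Psi> q)) v) = v"
proof -
  have *: "frechet_derivative \<Phi> (at (\<Psi> q)) (frechet_derivative \<Psi> (at q) v) = v"
    if d: "smooth_diffeo V W \<Phi> \<Psi>" and q: "q \<in> W" for V W \<Phi> \<Psi> q v
  proof -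
    have s: "smooth_on V \<Phi>" "smooth_on W \<Psi>" using d by (auto simp: smooth_diffeo_def)
    have "((\<lambda>x. \<Phi> (\<Psi> x)) has_derivative
        (\<lambda>v. frechet_derivative \<Phi> (at (\<Psi> q)) (frechet_derivative \<Psi> (at q) v))) (at q)"
      by (rule has_derivative_compose[OF smooth_on_has_derivative[OF s(2) q]
            smooth_on_has_derivative[OF s(1) smooth_diffeo_maps(2)[OF d q]]])
    then have "((\<lambda>x. x) has_derivative
        (\<lambda>v. frechet_derivative \<Phi> (at (\<Psi> q)) (frechet_derivative \<Psi> (at q) v))) (at q)"
      by (rule has_derivative_transform_within_open[OF _ smooth_on_open[OF s(2)] q])
        (rule smooth_diffeo_maps(4)[OF d])
    then show ?thesis using has_derivative_unique[OF _ has_derivative_ident] by metis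
  qed
  show "frechet_derivative \<Phi> (at (\<Psi> q)) (frechet_derivative \<Psi> (at q) v) = v"
    by (rule *[OF d q])
  have "smooth_diffeo W V \<Psi> \<Phi>"
    using d homeomorphism_symD unfolding smooth_diffeo_def by blast
  from *[OF this smooth_diffeo_maps(2)[OF d q]]
  show "frechet_derivative \<Psi> (at q) (frechet_derivative \<Phi> (at (\<Psi> q)) v) = v"
    by (simp add: smooth_diffeo_maps(4)[OF d q])
qed

lemma push_compose:
  assumes d: "smooth_diffeo V W \<Phi> \<Psi>" and F: "smooth_on V F" and q: "q \<in> W"
  shows "push (\<lambda>r. F (\<Psi> r)) q v = push F (\<Psi> q) (frechet_derivative \<Psi> (at q) v)"
proof -
  have \<Psi>: "smooth_on W \<Psi>" using d by (simp add: smooth_diffeo_def)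
  have "((\<lambda>r. F (\<Psi> r)) has_derivative
      (\<lambda>v. frechet_derivative F (at (\<Psi> q)) (frechet_derivative \<Psi> (at q) v))) (at q)"
    by (rule has_derivative_compose[OF smooth_on_has_derivative[OF \<Psi> q]
        smooth_on_has_derivative[OF F smooth_diffeo_maps(2)[OF d q]]])
  then show ?thesis
    unfolding push_def by (metis frechet_derivative_at)
qed

lemma range_push_compose:
  assumes d: "smooth_diffeo V W \<Phi> \<Psi>" and F: "smooth_on V F" and q: "q \<in> W"
  shows "range (push (\<lambda>r. F (\<Psi> r)) q) = range (push F (\<Psi> q))"
proof -
  have "surj (frechet_derivative \<Psi> (at q))"
    using smooth_diffeo_frechet(2)[OF d q] by (rule surjI)
  moreover have "push (\<lambda>r. F (\<Psi> r)) q = push F (\<Psi> q) \<circ> frechet_derivative \<Psi> (at q)"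
    by (simp add: fun_eq_iff push_compose[OF assms])
  ultimately show ?thesis by (metis image_comp)
qed

lemma immersed_at_compose:
  assumes d: "smooth_diffeo V W \<Phi> \<Psi>" and F: "smooth_on V F" and q: "q \<in> W"
    and i: "immersed_at F (\<Psi> q)"
  shows "immersed_at (\<lambda>r. F (\<Psi> r)) q"
proof -
  have "inj (frechet_derivative \<Psi> (at q))"
    using smooth_diffeo_frechet(1)[OF d q] by (rule inj_on_inverseI)
  moreover have "push (\<lambda>r. F (\<Psi> r)) q = push F (\<Psi> q) \<circ> frechet_derivative \<Psi> (at q)"
    by (simp add: fun_eq_iff push_compose[OF d F q])
  ultimately show ?thesis using i by (simp add: immersed_at_def inj_compose)
qed

lemma transversal_at_compose:
  assumes d: "smooth_diffeo V W \<Phi> \<Psi>" and F: "smooth_on V F" and q: "q \<in> W"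
    and i: "transversal_at F C (\<Psi> q)"
  shows "transversal_at (\<lambda>r. F (\<Psi> r)) (\<lambda>r. C (\<Psi> r)) q"
  using i unfolding transversal_at_def range_push_compose[OF d F q] .

lemma transv_part_compose:
  assumes d: "smooth_diffeo V W \<Phi> \<Psi>" and F: "smooth_on V F" and q: "q \<in> W"
  shows "transv_part (\<lambda>r. F (\<Psi> r)) (\<lambda>r. C (\<Psi> r)) q w = transv_part F C (\<Psi> q) w"
proof -
  have "(\<exists>v. w = push G p v + c *\<^sub>R x) \<longleftrightarrow> w - c *\<^sub>R x \<in> range (push G p)" for c G p x
    by (auto simp: algebra_simps image_iff)
  then have "(\<exists>v. w = push (\<lambda>r. F (\<Psi> r)) q v + c *\<^sub>R C (\<Psi> q)) \<longleftrightarrow>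
      (\<exists>v. w = push F (\<Psi> q) v + c *\<^sub>R C (\<Psi> q))" for c
    by (simp only: range_push_compose[OF assms])
  then show ?thesis by (simp add: transv_part_def)
qed

text \<open>A field that is constant in the new coordinates is the field \<open>Y\<close> in the old ones, and tensoriality
  allows \<open>Y\<close> to be replaced by its value at the point.\<close>

lemma sff_at_compose:
  assumes d: "smooth_diffeo V W \<Phi> \<Psi>" and F: "smooth_on V F" and q: "q \<in> W"
  shows "sff_at (\<lambda>r. F (\<Psi> r)) (\<lambda>r. C (\<Psi> r)) q u v =
    sff_at F C (\<Psi> q) (frechet_derivative \<Psi> (at q) u) (frechet_derivative \<Psi> (at q) v)"
proof -
  have \<Phi>: "smooth_on V \<Phi>" and \<Psi>: "smooth_on W \<Psi>" using d by (auto simp: smooth_diffeo_def)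
  note m = smooth_diffeo_maps[OF d]
  define Y where "Y s = frechet_derivative \<Psi> (at (\<Phi> s)) v" for s
  have Y: "smooth_on V Y"
    unfolding Y_def by (rule smooth_on_compose[OF \<Phi> smooth_on_frechet_derivative[OF \<Psi>] m(1)])
  define H where "H s = push F s (Y s)" for s
  have "smooth_on V (\<lambda>s. \<Sum>b\<in>Basis. (Y s \<bullet> b) *\<^sub>R push F s b)"
    unfolding push_def
    by (intro smooth_on_sum smooth_on_scaleR smooth_on_inner Y smooth_on_frechet_derivative[OF F]
        smooth_on_const smooth_on_open[OF F])
  moreover have "(\<Sum>b\<in>Basis. (Y s \<bullet> b) *\<^sub>R push F s b) = H s" if "s \<in> V" for s
  proof -
    have l: "linear (push F s)" by (rule smooth_on_linear_push[OF F that])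
    have "H s = push F s (\<Sum>b\<in>Basis. (Y s \<bullet> b) *\<^sub>R b)" by (simp add: H_def euclidean_representation)
    then show ?thesis by (simp add: linear_sum[OF l] linear_cmul[OF l])
  qed
  ultimately have H: "smooth_on V H" by (rule smooth_on_cong)
  have "((\<lambda>r. H (\<Psi> r)) has_derivative
      (\<lambda>v. frechet_derivative H (at (\<Psi> q)) (frechet_derivative \<Psi> (at q) v))) (at q)"
    by (rule has_derivative_compose[OF smooth_on_has_derivative[OF \<Psi> q]
        smooth_on_has_derivative[OF H m(2)[OF q]]])
  then have "((\<lambda>r. push (\<lambda>r. F (\<Psi> r)) r v) has_derivative
      (\<lambda>v. frechet_derivative H (at (\<Psi> q)) (frechet_derivative \<Psi> (at q) v))) (at q)"
    by (rule has_derivative_transform_within_open[OF _ smooth_on_open[OF \<Psi>] q])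
      (simp add: push_compose[OF d F] H_def Y_def m)
  then have "flat_D (\<lambda>_. u) (\<lambda>r. push (\<lambda>r. F (\<Psi> r)) r v) q
      = flat_D (\<lambda>_. frechet_derivative \<Psi> (at q) u) H (\<Psi> q)"
    unfolding flat_D_def by (metis frechet_derivative_at)
  then have "sff_at (\<lambda>r. F (\<Psi> r)) (\<lambda>r. C (\<Psi> r)) q u v
      = sff F C (\<lambda>_. frechet_derivative \<Psi> (at q) u) Y (\<Psi> q)"
    unfolding sff_at_def sff_def transv_part_compose[OF d F q] H_def by simp
  also have "\<dots> = sff_at F C (\<Psi> q) (frechet_derivative \<Psi> (at q) u) (Y (\<Psi> q))"
    by (rule sff_tensorial[OF F m(2)[OF q] smooth_on_differentiable[OF Y m(2)[OF q]]])
  also have "Y (\<Psi> q) = frechet_derivative \<Psi> (at q) v" by (simp add: Y_def m q)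
  finally show ?thesis .
qed

lemma nondegenerate_at_compose:
  assumes d: "smooth_diffeo V W \<Phi> \<Psi>" and F: "smooth_on V F" and q: "q \<in> W"
    and n: "nondegenerate_at F C (\<Psi> q)"
  shows "nondegenerate_at (\<lambda>r. F (\<Psi> r)) (\<lambda>r. C (\<Psi> r)) q"
  unfolding nondegenerate_at_def
proof (intro allI impI)
  fix u assume u: "\<forall>v. sff_at (\<lambda>r. F (\<Psi> r)) (\<lambda>r. C (\<Psi> r)) q u v = 0"
  have "sff_at F C (\<Psi> q) (frechet_derivative \<Psi> (at q) u) v = 0" for v
    using spec[OF u, of "frechet_derivative \<Phi> (at (\<Psi> q)) v"]
    by (simp add: sff_at_compose[OF d F q] smooth_diffeo_frechet[OF d q])
  then have "frechet_derivative \<Psi> (at q) u = 0" using n by (auto simp: nondegenerate_at_def)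
  then have "u = frechet_derivative \<Phi> (at (\<Psi> q)) 0"
    using smooth_diffeo_frechet(1)[OF d q, of u] by simp
  also have "\<dots> = 0"
    using smooth_on_has_derivative[of V \<Phi> "\<Psi> q"] d smooth_diffeo_maps(2)[OF d q]
    by (auto simp: smooth_diffeo_def intro: linear_0[OF has_derivative_linear])
  finally show "u = 0" .
qed

lemma metric_volume_compose:
  assumes d: "smooth_diffeo V W \<Phi> \<Psi>" and F: "smooth_on V F" and q: "q \<in> W"
    and e: "\<And>u v w. metric_volume F C (\<Psi> q) u v w = induced_volume F C (\<Psi> q) u v w"
  shows "metric_volume (\<lambda>r. F (\<Psi> r)) (\<lambda>r. C (\<Psi> r)) q u v w =
    induced_volume (\<lambda>r. F (\<Psi> r)) (\<lambda>r. C (\<Psi> r)) q u v w"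
proof -
  let ?D = "frechet_derivative \<Psi> (at q)"
  have i: "induced_volume (\<lambda>r. F (\<Psi> r)) (\<lambda>r. C (\<Psi> r)) q u v w =
      induced_volume F C (\<Psi> q) (?D u) (?D v) (?D w)"
    by (simp add: induced_volume_def push_compose[OF d F q])
  have h: "(\<chi> i j. sff_at (\<lambda>r. F (\<Psi> r)) (\<lambda>r. C (\<Psi> r)) q
        ((vector [u, v, w] :: real^3^3) $ i) ((vector [u, v, w] :: real^3^3) $ j) :: real^3^3)
      = (\<chi> i j. sff_at F C (\<Psi> q) ((vector [?D u, ?D v, ?D w] :: real^3^3) $ i)
        ((vector [?D u, ?D v, ?D w] :: real^3^3) $ j))"
    by (simp add: vec_eq_iff forall_3 sff_at_compose[OF d F q])
  show ?thesis
    using e[of "?D u" "?D v" "?D w"] unfolding i metric_volume_def Let_def h .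
qed

lemma Dist_plus_iff:
  assumes "linear (push F p)"
  shows "v \<in> Dist_plus F p \<longleftrightarrow> Jt (push F p v) = push F p v"
proof -
  have "push F p v \<in> Jt ` range (push F p)" if "Jt (push F p v) = push F p v"
    using that by (metis imageI rangeI)
  then show ?thesis by (auto simp: Dist_plus_def Dist_def)
qed

section \<open>Adding a chart\<close>

lemma is_chart_inj_on:
  assumes "is_chart M (U, \<phi>)" shows "inj_on \<phi> U"
proof -
  have "topspace (subtopology M U) = U"
    using assms openin_subset[of M U] by (auto simp: is_chart_def)
  then show ?thesis
    using assms homeomorphic_imp_injective_map[of "subtopology M U" "top_of_set (\<phi> ` U)" \<phi>]
    by (auto simp: is_chart_def)
qed

lemma in_chart_apply:
  assumes "is_chart M c" "m \<in> fst c" shows "in_chart c f (snd c m) = f m"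
  using assms is_chart_inj_on[of M "fst c" "snd c"]
  by (cases c) (simp add: in_chart_def inv_into_f_f)

lemma is_chart_restrict:
  assumes c: "is_chart M c" and d: "smooth_diffeo V W \<Phi> \<Psi>" and V: "V \<subseteq> image_of_chart c"
  defines "U \<equiv> {m \<in> fst c. snd c m \<in> V}"
  shows "is_chart M (U, \<lambda>m. \<Phi> (snd c m))" "(\<lambda>m. \<Phi> (snd c m)) ` U = W"
proof -
  obtain U0 \<phi> where c0: "c = (U0, \<phi>)" by (cases c)
  have U: "U = {m \<in> U0. \<phi> m \<in> V}" by (simp add: U_def c0)
  have o: "openin M U0" and h: "homeomorphic_map (subtopology M U0) (top_of_set (\<phi> ` U0)) \<phi>"
    using c by (auto simp: is_chart_def c0)
  have t: "topspace (subtopology M U0) = U0" using openin_subset[OF o] by auto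
  have oV: "open V" using d smooth_on_open by (auto simp: smooth_diffeo_def)
  have oW: "open W" using d smooth_on_open by (auto simp: smooth_diffeo_def)
  have VU: "\<phi> ` U = V" using V by (auto simp: image_of_chart_def c0 U)
  have "openin (subtopology M U0) {m \<in> topspace (subtopology M U0). \<phi> m \<in> V}"
    by (rule openin_continuous_map_preimage[OF homeomorphic_imp_continuous_map[OF h]])
      (use oV V in \<open>auto simp: image_of_chart_def c0 intro: open_subset\<close>)
  then have oU: "openin M U" using openin_open_subtopology[OF o] by (simp only: t U)
  have h1: "homeomorphic_map (subtopology M U) (top_of_set V) \<phi>"
  proof -
    have "homeomorphic_map (subtopology (subtopology M U0) U) (subtopology (top_of_set (\<phi> ` U0)) V) \<phi>"
      by (rule homeomorphic_map_subtopologies_alt[OF h])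
        (use VU is_chart_inj_on[OF c[unfolded c0]] in \<open>auto simp: t U\<close>)
    moreover have "U0 \<inter> U = U" "\<phi> ` U0 \<inter> V = V" using V by (auto simp: U image_of_chart_def c0)
    ultimately show ?thesis by (simp add: subtopology_subtopology)
  qed
  have hm: "homeomorphism V W \<Phi> \<Psi>" using d by (simp add: smooth_diffeo_def)
  note m = smooth_diffeo_maps[OF d]
  have h2: "homeomorphic_map (top_of_set V) (top_of_set W) \<Phi>"
  proof -
    have "homeomorphic_maps (top_of_set V) (top_of_set W) \<Phi> \<Psi>"
      unfolding homeomorphic_maps_def using hm m by (auto simp: homeomorphism_def)
    then show ?thesis using homeomorphic_maps_imp_map by blast
  qed
  show W: "(\<lambda>m. \<Phi> (snd c m)) ` U = W"
    using VU homeomorphism_image1[OF hm] by (simp add: c0 image_image[symmetric])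
  show "is_chart M (U, \<lambda>m. \<Phi> (snd c m))"
    using oU oW W homeomorphic_map_compose[OF h1 h2] by (simp add: is_chart_def c0 comp_def)
qed

text \<open>The new chart is the chart \<open>c\<close> followed by a diffeomorphism, so all its transition maps factor
  through those of \<open>c\<close>.\<close>

lemma smooth_atlas_insert:
  assumes A: "smooth_atlas M \<A>" and c: "c \<in> \<A>"
    and d: "smooth_diffeo V W \<Phi> \<Psi>" and V: "V \<subseteq> image_of_chart c"
  defines "U \<equiv> {m \<in> fst c. snd c m \<in> V}"
  shows "smooth_atlas M (\<A> \<union> {(U, \<lambda>m. \<Phi> (snd c m))})"
proof -
  let ?n = "(U, \<lambda>m. \<Phi> (snd c m))"
  have ch: "is_chart M b" if "b \<in> \<A>" for b using A that by (simp add: smooth_atlas_def)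
  have n: "is_chart M ?n" and nW: "(\<lambda>m. \<Phi> (snd c m)) ` U = W"
    using is_chart_restrict[OF ch[OF c] d V] by (simp_all add: U_def)
  have tr: "smooth_on (snd a ` (fst a \<inter> fst b)) (in_chart a (snd b))" if "a \<in> \<A>" "b \<in> \<A>" for a b
    using A that by (simp add: smooth_atlas_def)
  have \<Phi>: "smooth_on V \<Phi>" and \<Psi>: "smooth_on W \<Psi>" using d by (auto simp: smooth_diffeo_def)
  note m = smooth_diffeo_maps[OF d]
  have inc: "in_chart b f = (\<lambda>p. f (inv_into (fst b) (snd b) p))" for b :: "'a chart" and f :: "'a \<Rightarrow> real^3"
    by (simp add: in_chart_def case_prod_beta)
  have 1: "smooth_on (snd b ` (fst b \<inter> U)) (in_chart b (\<lambda>m. \<Phi> (snd c m)))" if b: "b \<in> \<A>" for b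
  proof -
    let ?T = "snd b ` (fst b \<inter> fst c)"
    have T: "smooth_on ?T (in_chart b (snd c))" by (rule tr[OF b c])
    have S: "snd b ` (fst b \<inter> U) = ?T \<inter> in_chart b (snd c) -` V"
      using in_chart_apply[OF ch[OF b]] by (auto simp: U_def)
    have "smooth_on (snd b ` (fst b \<inter> U)) (in_chart b (snd c))"
      unfolding S by (rule smooth_on_subset[OF T continuous_open_preimage[OF
            smooth_on_continuous_on[OF T] smooth_on_open[OF T] smooth_on_open[OF \<Phi>]]]) auto
    then have "smooth_on (snd b ` (fst b \<inter> U)) (\<lambda>p. \<Phi> (in_chart b (snd c) p))"
      by (rule smooth_on_compose[OF _ \<Phi>]) (simp add: S)
    then show ?thesis by (simp add: inc)
  qed
  have c1: "smooth_on (snd c ` (fst c \<inter> fst b)) (in_chart c (snd b))" if "b \<in> \<A> \<union> {?n}" for b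
    using that tr[OF c] 1[OF c] by auto
  have 2: "smooth_on ((\<lambda>m. \<Phi> (snd c m)) ` (U \<inter> fst b)) (in_chart ?n (snd b))"
    if b: "b \<in> \<A> \<union> {?n}" for b
  proof -
    let ?T = "snd c ` (fst c \<inter> fst b)"
    note T = c1[OF b]
    have icx: "in_chart ?n f q = in_chart c f (\<Psi> q)" if q: "q \<in> W" for q and f :: "'a \<Rightarrow> real^3"
    proof -
      obtain x where x: "x \<in> U" "q = \<Phi> (snd c x)" using q nW by blast
      then have "in_chart ?n f q = f x" using in_chart_apply[OF n, of x f] by simp
      moreover have "\<Psi> q = snd c x" using x m by (simp add: U_def)
      ultimately show ?thesis using x in_chart_apply[OF ch[OF c], of x f] by (simp add: U_def)
    qed
    have S: "(\<lambda>m. \<Phi> (snd c m)) ` (U \<inter> fst b) = W \<inter> \<Psi> -` ?T"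
    proof (intro subset_antisym subsetI)
      fix q assume "q \<in> (\<lambda>m. \<Phi> (snd c m)) ` (U \<inter> fst b)"
      then show "q \<in> W \<inter> \<Psi> -` ?T" using m by (auto simp: U_def)
    next
      fix q assume "q \<in> W \<inter> \<Psi> -` ?T"
      then obtain x where "q \<in> W" "\<Psi> q = snd c x" "x \<in> fst c" "x \<in> fst b" by auto
      moreover from this have "q = \<Phi> (snd c x)" "snd c x \<in> V" using m by metis+
      ultimately show "q \<in> (\<lambda>m. \<Phi> (snd c m)) ` (U \<inter> fst b)" by (auto simp: U_def)
    qed
    have "smooth_on ((\<lambda>m. \<Phi> (snd c m)) ` (U \<inter> fst b)) \<Psi>"
      unfolding S by (rule smooth_on_subset[OF \<Psi> continuous_open_preimage[OF
            smooth_on_continuous_on[OF \<Psi>] smooth_on_open[OF \<Psi>] smooth_on_open[OF T]]]) auto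
    then have "smooth_on ((\<lambda>m. \<Phi> (snd c m)) ` (U \<inter> fst b)) (\<lambda>q. in_chart c (snd b) (\<Psi> q))"
      by (rule smooth_on_compose[OF _ T]) (simp add: S)
    then show ?thesis by (rule smooth_on_cong) (simp add: icx S)
  qed
  have "U \<subseteq> topspace M" using n openin_subset by (auto simp: is_chart_def)
  then have "(\<Union>b\<in>\<A> \<union> {?n}. fst b) = topspace M" using A by (auto simp: smooth_atlas_def)
  moreover have "smooth_on (snd a ` (fst a \<inter> fst b)) (in_chart a (snd b))"
    if a: "a \<in> \<A> \<union> {?n}" and b: "b \<in> \<A> \<union> {?n}" for a b
  proof (cases "a = ?n")
    case True
    then show ?thesis using 2[OF b] by simp
  next
    case False
    then have a: "a \<in> \<A>" using a by blast
    show ?thesis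
    proof (cases "b = ?n")
      case True
      then show ?thesis using 1[OF a] by simp
    next
      case False
      then show ?thesis using tr[OF a, of b] b by blast
    qed
  qed
  moreover have "is_chart M a" if "a \<in> \<A> \<union> {?n}" for a using that n ch by blast
  ultimately show ?thesis unfolding smooth_atlas_def by blast
qed

section \<open>Bilinearity of the second fundamental form\<close>

lemma linear_transv_part:
  assumes l: "linear (push F p)" and i: "immersed_at F p" and t: "transversal_at F C p"
  shows "linear (transv_part F C p)"
proof (rule linearI)
  fix w w' :: "real^4" and r :: real
  obtain v where v: "w = push F p v + transv_part F C p w *\<^sub>R C p"
    by (rule transv_part_decomposition[OF assms])
  obtain v' where v': "w' = push F p v' + transv_part F C p w' *\<^sub>R C p"
    by (rule transv_part_decomposition[OF assms])
  have "w + w' = (push F p v + transv_part F C p w *\<^sub>R C p) +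
      (push F p v' + transv_part F C p w' *\<^sub>R C p)"
    by (rule arg_cong2[OF v v', of plus])
  also have "\<dots> = push F p (v + v') + (transv_part F C p w + transv_part F C p w') *\<^sub>R C p"
    by (simp only: linear_add[OF l] scaleR_left_distrib add_ac)
  finally have "w + w' = push F p (v + v') + (transv_part F C p w + transv_part F C p w') *\<^sub>R C p" .
  then show "transv_part F C p (w + w') = transv_part F C p w + transv_part F C p w'"
    by (rule transv_part_eqI[OF l t])
  have "r *\<^sub>R w = r *\<^sub>R (push F p v + transv_part F C p w *\<^sub>R C p)"
    by (rule arg_cong[OF v])
  also have "\<dots> = push F p (r *\<^sub>R v) + (r * transv_part F C p w) *\<^sub>R C p"
    by (simp only: linear_cmul[OF l] scaleR_right_distrib scaleR_scaleR)
  finally have "r *\<^sub>R w = push F p (r *\<^sub>R v) + (r * transv_part F C p w) *\<^sub>R C p" .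
  then have "transv_part F C p (r *\<^sub>R w) = r * transv_part F C p w"
    by (rule transv_part_eqI[OF l t])
  then show "transv_part F C p (r *\<^sub>R w) = r *\<^sub>R transv_part F C p w" by simp
qed

lemma bilinear_sff_at:
  assumes F: "smooth_on V F" and p: "p \<in> V" and i: "immersed_at F p" and t: "transversal_at F C p"
  shows "bilinear (sff_at F C p)"
proof -
  note lp = smooth_on_linear_push[OF F]
  have lt: "linear (transv_part F C p)" by (rule linear_transv_part[OF lp[OF p] i t])
  define T where "T v = frechet_derivative (\<lambda>q. push F q v) (at p)" for v
  have T: "((\<lambda>q. push F q v) has_derivative T v) (at p)" for v
    unfolding T_def push_def
    by (rule smooth_on_has_derivative[OF smooth_on_frechet_derivative[OF F] p])
  have h: "sff_at F C p u v = transv_part F C p (T v u)" for u v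
    by (simp add: sff_at_def sff_def flat_D_def T_def)
  have "T (v + v') = (\<lambda>u. T v u + T v' u)" for v v'
  proof (rule has_derivative_unique[OF T])
    show "((\<lambda>q. push F q (v + v')) has_derivative (\<lambda>u. T v u + T v' u)) (at p)"
      by (rule has_derivative_transform_within_open[OF has_derivative_add[OF T T] smooth_on_open[OF F] p])
        (simp add: linear_add[OF lp])
  qed
  moreover have "T (r *\<^sub>R v) = (\<lambda>u. r *\<^sub>R T v u)" for r v
  proof (rule has_derivative_unique[OF T])
    show "((\<lambda>q. push F q (r *\<^sub>R v)) has_derivative (\<lambda>u. r *\<^sub>R T v u)) (at p)"
      by (rule has_derivative_transform_within_open[OF has_derivative_scaleR_right[OF T]
            smooth_on_open[OF F] p])
        (simp add: linear_cmul[OF lp])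
  qed
  moreover have "linear (T v)" for v using T has_derivative_linear by blast
  ultimately show ?thesis
    unfolding bilinear_def h
    by (auto intro!: linearI simp: linear_add linear_cmul linear_add[OF lt] linear_cmul[OF lt])
qed

text \<open>Nondegeneracy tests the first argument of \<open>h\<close>. Writing \<open>h(u, v)\<close> as the inner product of \<open>T u\<close> with
  \<open>v\<close>, it says that \<open>T\<close> is injective; then \<open>T\<close> is onto, and a vector orthogonal to its whole range is
  zero.\<close>

lemma nondegenerate_at_right:
  assumes F: "smooth_on V F" and p: "p \<in> V" and i: "immersed_at F p" and t: "transversal_at F C p"
    and n: "nondegenerate_at F C p" and x: "\<And>u. sff_at F C p u x = 0"
  shows "x = 0"
proof -
  have b: "bilinear (sff_at F C p)" by (rule bilinear_sff_at[OF F p i t])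
  have l1: "linear (\<lambda>u. sff_at F C p u v)" for v using b by (simp add: bilinear_def)
  have l2: "linear (sff_at F C p u)" for u using b by (simp add: bilinear_def)
  define T where "T u = (\<Sum>b\<in>Basis. sff_at F C p u b *\<^sub>R b)" for u
  have T: "T u \<bullet> v = sff_at F C p u v" for u v
  proof -
    have "sff_at F C p u v = sff_at F C p u (\<Sum>b\<in>Basis. (v \<bullet> b) *\<^sub>R b)" by (simp add: euclidean_representation)
    also have "\<dots> = (\<Sum>b\<in>Basis. (v \<bullet> b) * sff_at F C p u b)"
      by (simp add: linear_sum[OF l2] linear_cmul[OF l2])
    also have "\<dots> = (\<Sum>b\<in>Basis. sff_at F C p u b * (b \<bullet> v))"
      by (intro sum.cong refl) (simp only: inner_commute[of v] mult.commute)
    finally show ?thesis unfolding T_def inner_sum_left inner_scaleR_left by (rule sym)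
  qed
  have lT: "linear T"
    by (rule linearI) (simp_all add: T_def linear_add[OF l1] linear_cmul[OF l1]
        scaleR_left_distrib sum.distrib scaleR_sum_right)
  have "inj T" unfolding linear_injective_0[OF lT]
  proof (intro allI impI)
    fix u assume "T u = 0"
    then have "sff_at F C p u v = 0" for v using T[of u v] by simp
    then show "u = 0" using n by (simp add: nondegenerate_at_def)
  qed
  then have "surj T" by (simp add: linear_injective_imp_surjective[OF lT])
  then obtain u where u: "x = T u" by (rule surjE)
  have "x \<bullet> x = T u \<bullet> x" by (rule arg_cong[OF u])
  then have "x \<bullet> x = 0" unfolding T x .
  then show ?thesis by simp
qed

section \<open>The centre\<close>

text \<open>Smoothness comes from Cramer's rule, applied to the invertible matrix \<open>A p\<close> whose columns are the
  coordinate tangent vectors and the transversal vector.\<close>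

lemma smooth_tangent_lift:
  fixes F C K :: "real^3 \<Rightarrow> real^4"
  assumes F: "smooth_on V F" and C: "smooth_on V C" and K: "smooth_on V K"
    and i: "\<And>p. p \<in> V \<Longrightarrow> immersed_at F p" and t: "\<And>p. p \<in> V \<Longrightarrow> transversal_at F C p"
    and r: "\<And>p. p \<in> V \<Longrightarrow> K p \<in> range (push F p)"
  obtains X where "smooth_on V X" "\<And>p. p \<in> V \<Longrightarrow> push F p (X p) = K p"
proof -
  define v3 :: "real^4 \<Rightarrow> real^3" where "v3 y = vector [y $ 1, y $ 2, y $ 3]" for y
  have bl: "bounded_linear v3"
    by (intro linear_conv_bounded_linear[THEN iffD1] linearI)
      (auto simp: v3_def vec_eq_iff forall_3)
  define L where "L p y = push F p (v3 y) + (y $ 4) *\<^sub>R C p" for p y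
  have lin: "linear (L p)" if "p \<in> V" for p
    unfolding L_def using linear_compose[OF bounded_linear.linear[OF bl] smooth_on_linear_push[OF F that]]
    by (intro linear_compose_add) (auto simp: comp_def intro!: linearI simp: algebra_simps)
  define A where "A p = matrix (L p)" for p
  have inj: "inj (L p)" if p: "p \<in> V" for p
    unfolding linear_injective_0[OF lin[OF p]]
  proof (intro allI impI)
    fix y assume y: "L p y = 0"
    note l = smooth_on_linear_push[OF F p]
    have "transv_part F C p 0 = y $ 4"
      by (rule transv_part_eqI[OF l t[OF p], of _ "v3 y"]) (use y in \<open>simp add: L_def\<close>)
    moreover have "transv_part F C p 0 = 0"
      by (rule transv_part_eqI[OF l t[OF p], of _ 0]) (simp add: linear_0[OF l])
    ultimately have y4: "y $ 4 = 0" by simp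
    then have "push F p (v3 y) = 0" using y by (simp add: L_def)
    then have "v3 y = 0"
      using i[OF p] linear_injective_0[OF l] unfolding immersed_at_def by blast
    then show "y = 0" using y4 by (simp add: v3_def vec_eq_iff forall_3 forall_4)
  qed
  have det: "det (A p) \<noteq> 0" if "p \<in> V" for p
    unfolding A_def using det_nz_iff_inj[OF lin[OF that]] inj[OF that] by simp
  have smA: "smooth_on V (\<lambda>p. A p $ a $ b)" for a b
  proof -
    have "smooth_on V (\<lambda>p. L p (axis b 1))"
      unfolding L_def push_def
      by (intro smooth_on_add smooth_on_frechet_derivative F smooth_on_scaleR C smooth_on_const
          smooth_on_open[OF F])
    from smooth_on_component[OF this, of a] show ?thesis by (simp add: A_def matrix_def)
  qed
  define Y where "Y p = (\<chi> k. det (\<chi> a b. if b = k then K p $ a else A p $ a $ b) / det (A p))" for p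
  have smdet: "smooth_on V (\<lambda>p. det (B p))" if "\<And>a b. smooth_on V (\<lambda>p. B p $ a $ b)"
    for B :: "real^3 \<Rightarrow> real^4^4"
    using that smooth_on_open[OF F] unfolding smooth_on_def by (auto intro: Ck_on_det)
  have "smooth_on V Y"
  proof (rule smooth_on_componentwise[OF smooth_on_open[OF F]])
    fix k
    have "smooth_on V (\<lambda>p. if b = k then K p $ a else A p $ a $ b)" for a b
      by (cases "b = k") (auto intro: smooth_on_component K smA)
    then show "smooth_on V (\<lambda>p. Y p $ k)"
      unfolding Y_def by (auto intro!: smooth_on_divide smdet smA det)
  qed
  then have X: "smooth_on V (\<lambda>p. v3 (Y p))" by (rule smooth_on_bounded_linear[OF bl])
  have "push F p (v3 (Y p)) = K p" if p: "p \<in> V" for p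
  proof -
    obtain x where x: "K p = push F p x" using r[OF p] by blast
    define y :: "real^4" where "y = vector [x $ 1, x $ 2, x $ 3, 0]"
    have vy: "v3 y = x" "y $ 4 = 0" by (simp_all add: v3_def y_def vec_eq_iff forall_3 vector_def)
    have "L p y = K p" by (simp add: L_def vy x)
    then have "A p *v y = K p" using matrix_works[of "L p" y] lin[OF p] by (simp add: A_def linear_matrix_vector_mul_eq)
    then have "y = Y p" using cramer[OF det[OF p], of y "K p"] by (simp add: Y_def)
    then show ?thesis using vy x by simp
  qed
  with X that show thesis by blast
qed

lemma affine_hypersphere_chart:
  assumes h: "affine_hypersphere M \<A> f C" and c: "c \<in> \<A>"
  shows "is_chart M c" "smooth_on (image_of_chart c) (in_chart c f)"
    "smooth_on (image_of_chart c) (in_chart c C)"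
    "p \<in> image_of_chart c \<Longrightarrow> linear (push (in_chart c f) p)"
    "p \<in> image_of_chart c \<Longrightarrow> immersed_at (in_chart c f) p"
    "p \<in> image_of_chart c \<Longrightarrow> transversal_at (in_chart c f) (in_chart c C) p"
    "p \<in> image_of_chart c \<Longrightarrow> nondegenerate_at (in_chart c f) (in_chart c C) p"
    "p \<in> image_of_chart c \<Longrightarrow> metric_volume (in_chart c f) (in_chart c C) p u v w =
       induced_volume (in_chart c f) (in_chart c C) p u v w"
proof -
  show "is_chart M c" using h c by (auto simp: affine_hypersphere_def manifold3_def smooth_atlas_def)
  show *: "smooth_on (image_of_chart c) (in_chart c f)"
    using h c by (auto simp: affine_hypersphere_def immersion_def smooth_map_def)
  show "p \<in> image_of_chart c \<Longrightarrow> linear (push (in_chart c f) p)"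
    by (rule smooth_on_linear_push[OF *])
qed (use h c in \<open>auto simp: affine_hypersphere_def immersion_def blaschke_field_def
      transversal_field_def smooth_map_def nondegenerate_def\<close>)

text \<open>Since \<open>\<tau> = 0\<close> and \<open>S = l I\<close>, the differential of \<open>C\<close> is \<open>-l\<close> times that of \<open>f\<close>.\<close>

lemma affine_hypersphere_derivative:
  assumes h: "affine_hypersphere M \<A> f C"
  obtains l where "\<And>c p v. c \<in> \<A> \<Longrightarrow> p \<in> image_of_chart c \<Longrightarrow>
    frechet_derivative (in_chart c C) (at p) v = - l *\<^sub>R push (in_chart c f) p v"
proof -
  obtain l where l: "\<And>c p v. c \<in> \<A> \<Longrightarrow> p \<in> image_of_chart c \<Longrightarrow>
      shape_op (in_chart c f) (in_chart c C) (\<lambda>_. v) p = l *\<^sub>R v"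
    using h by (auto simp: affine_hypersphere_def)
  show thesis
  proof (rule that[of l])
    fix c p v assume c: "c \<in> \<A>" and p: "p \<in> image_of_chart c"
    let ?F = "in_chart c f" and ?C = "in_chart c C"
    let ?w = "frechet_derivative ?C (at p) v"
    note ch = affine_hypersphere_chart(4-6)[OF h c p]
    obtain x where x: "?w = push ?F p x + transv_part ?F ?C p ?w *\<^sub>R ?C p"
      by (rule transv_part_decomposition[OF ch])
    have t0: "transv_part ?F ?C p ?w = 0"
      using h c p by (auto simp: affine_hypersphere_def blaschke_field_def transv_form_def flat_D_def)
    have "tan_part ?F ?C p ?w = x" by (rule tan_part_eqI[OF ch x])
    then have "- x = l *\<^sub>R v" using l[OF c p, of v] by (simp add: shape_op_def flat_D_def)
    from arg_cong[OF this, of uminus] have "x = - l *\<^sub>R v" by simp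
    moreover have "?w = push ?F p x" using x[unfolded t0] by simp
    ultimately have "?w = push ?F p (- l *\<^sub>R v)" by (simp only:)
    then show "?w = - l *\<^sub>R push ?F p v" by (simp only: linear_cmul[OF ch(1)])
  qed
qed

lemma locally_constant_on_connected_space:
  assumes M: "connected_space M"
    and loc: "\<And>m. m \<in> topspace M \<Longrightarrow> \<exists>U. openin M U \<and> m \<in> U \<and> (\<forall>n\<in>U. K n = K m)"
    and "m \<in> topspace M" "n \<in> topspace M"
  shows "K n = K m"
proof -
  have o: "openin M {x \<in> topspace M. P (K x)}" for P
    unfolding openin_subopen[of M "{x \<in> topspace M. P (K x)}"]
  proof
    fix x assume x: "x \<in> {x \<in> topspace M. P (K x)}"
    then have "x \<in> topspace M" and Px: "P (K x)" by simp_all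
    from loc[OF this(1)] obtain U where U: "openin M U" "x \<in> U" "\<forall>n\<in>U. K n = K x" by (elim exE conjE)
    have "y \<in> topspace M \<and> P (K y)" if y: "y \<in> U" for y
    proof -
      have "K y = K x" using U(3) y by (rule bspec)
      then have "P (K y)" using Px by (simp only:)
      then show ?thesis using openin_subset[OF U(1)] y by blast
    qed
    then have "U \<subseteq> {x \<in> topspace M. P (K x)}" by blast
    then show "\<exists>T. openin M T \<and> x \<in> T \<and> T \<subseteq> {x \<in> topspace M. P (K x)}" using U by blast
  qed
  let ?T = "{x \<in> topspace M. K x = K m}"
  have "topspace M - ?T = {x \<in> topspace M. K x \<noteq> K m}" by auto
  then have "closedin M ?T" using o[of "\<lambda>y. y \<noteq> K m"] by (simp add: closedin_def)
  with o[of "\<lambda>y. y = K m"] have "?T = {} \<or> ?T = topspace M"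
    using M unfolding connected_space_clopen_in by blast
  with assms(3,4) show ?thesis by blast
qed

text \<open>The derivative of \<open>C + l f\<close> vanishes in every chart.\<close>

lemma affine_hypersphere_primitive:
  assumes h: "affine_hypersphere M \<A> f C"
    and l: "\<And>c p v. c \<in> \<A> \<Longrightarrow> p \<in> image_of_chart c \<Longrightarrow>
      frechet_derivative (in_chart c C) (at p) v = - l *\<^sub>R push (in_chart c f) p v"
    and mn: "m \<in> topspace M" "n \<in> topspace M"
  shows "C n + l *\<^sub>R f n = C m + l *\<^sub>R f m"
proof (rule locally_constant_on_connected_space[of M "\<lambda>m. C m + l *\<^sub>R f m", OF _ _ mn])
  show "connected_space M" using h by (simp add: affine_hypersphere_def)
  fix m assume m: "m \<in> topspace M"
  have "smooth_atlas M \<A>" using h by (simp add: affine_hypersphere_def manifold3_def)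
  then obtain c where c: "c \<in> \<A>" "m \<in> fst c" using m unfolding smooth_atlas_def by blast
  let ?V = "image_of_chart c"
  have im: "?V = snd c ` fst c" by (simp add: image_of_chart_def case_prod_beta)
  note ch = affine_hypersphere_chart[OF h c(1)]
  have "open ?V" by (rule smooth_on_open[OF ch(2)])
  then obtain e where e: "e > 0" "ball (snd c m) e \<subseteq> ?V"
    by (rule openE[of ?V "snd c m"]) (use c im in auto)
  let ?H = "\<lambda>p. in_chart c C p + l *\<^sub>R in_chart c f p"
  have d: "(?H has_derivative (\<lambda>v. 0)) (at p)" if p: "p \<in> ?V" for p
  proof -
    have "(?H has_derivative (\<lambda>v. frechet_derivative (in_chart c C) (at p) v
        + l *\<^sub>R frechet_derivative (in_chart c f) (at p) v)) (at p)"
      by (intro has_derivative_add has_derivative_scaleR_right smooth_on_has_derivative[OF ch(2) p]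
          smooth_on_has_derivative[OF ch(3) p])
    then show ?thesis using l[OF c(1) p] by (simp add: push_def)
  qed
  have const: "?H p = ?H (snd c m)" if "p \<in> ball (snd c m) e" for p
  proof (rule has_derivative_zero_unique[of "ball (snd c m) e" ?H])
    show "(?H has_derivative (\<lambda>v. 0)) (at x within ball (snd c m) e)" if "x \<in> ball (snd c m) e" for x
      by (rule has_derivative_at_withinI[OF d[OF subsetD[OF e(2) that]]])
  qed (use that e in auto)
  have b: "smooth_diffeo (ball (snd c m) e) (ball (snd c m) e) (\<lambda>x. x) (\<lambda>x. x)"
    by (simp add: smooth_diffeo_def smooth_on_id homeomorphism_def)
  let ?U = "{x \<in> fst c. snd c x \<in> ball (snd c m) e}"
  have "openin M ?U"
    using is_chart_restrict(1)[OF ch(1) b e(2)] by (auto simp: is_chart_def)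
  moreover have "C n + l *\<^sub>R f n = C m + l *\<^sub>R f m" if "n \<in> ?U" for n
  proof -
    have n: "n \<in> fst c" and b: "snd c n \<in> ball (snd c m) e" using that by blast+
    show ?thesis using const[OF b]
      unfolding in_chart_apply[OF ch(1) n] in_chart_apply[OF ch(1) c(2)] .
  qed
  moreover have "m \<in> ?U" using c e by auto
  ultimately show "\<exists>U. openin M U \<and> m \<in> U \<and> (\<forall>n\<in>U. C n + l *\<^sub>R f n = C m + l *\<^sub>R f m)" by blast
qed

text \<open>For \<open>l = 0\<close> the Blaschke field is locally constant, and so is its image under \<open>Jt\<close>. A tangent
  field that is constant in \<open>real^4\<close> lies in the kernel of \<open>h\<close>, so it would vanish.\<close>

lemma Jt_tangent_curvature_nonzero:
  assumes h: "affine_hypersphere M \<A> f C" and J: "Jt_tangent \<A> f C"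
    and l: "\<And>c p v. c \<in> \<A> \<Longrightarrow> p \<in> image_of_chart c \<Longrightarrow>
      frechet_derivative (in_chart c C) (at p) v = - l *\<^sub>R push (in_chart c f) p v"
    and m: "m \<in> topspace M"
  shows "l \<noteq> 0"
proof
  assume l0: "l = 0"
  have "smooth_atlas M \<A>" using h by (simp add: affine_hypersphere_def manifold3_def)
  then obtain c where c: "c \<in> \<A>" "m \<in> fst c" using m unfolding smooth_atlas_def by blast
  let ?V = "image_of_chart c" and ?F = "in_chart c f" and ?C = "in_chart c C" and ?p = "snd c m"
  note ch = affine_hypersphere_chart[OF h c(1)]
  have p: "?p \<in> ?V" using c by (auto simp: image_of_chart_def case_prod_beta)
  have bJ: "bounded_linear Jt"
    by (intro linear_conv_bounded_linear[THEN iffD1] linearI)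
      (auto simp: Jt_def vec_eq_iff forall_4 vector_def)
  have smJ: "smooth_on ?V (\<lambda>p. Jt (?C p))" by (rule smooth_on_bounded_linear[OF bJ ch(3)])
  obtain X where X: "smooth_on ?V X" "\<And>p. p \<in> ?V \<Longrightarrow> push ?F p (X p) = Jt (?C p)"
    by (rule smooth_tangent_lift[OF ch(2,3) smJ ch(5,6)]) (use J c in \<open>auto simp: Jt_tangent_def\<close>)
  have "sff_at ?F ?C ?p u (X ?p) = 0" for u
  proof -
    have "((\<lambda>p. Jt (?C p)) has_derivative (\<lambda>v. Jt (frechet_derivative ?C (at ?p) v))) (at ?p)"
      by (rule bounded_linear.has_derivative[OF bJ smooth_on_has_derivative[OF ch(3) p]])
    then have "((\<lambda>p. Jt (?C p)) has_derivative (\<lambda>v. 0)) (at ?p)"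
      by (simp add: l[OF c(1) p] l0 linear_0[OF bounded_linear.linear[OF bJ]])
    then have "((\<lambda>p. push ?F p (X p)) has_derivative (\<lambda>v. 0)) (at ?p)"
      by (rule has_derivative_transform_within_open[OF _ smooth_on_open[OF ch(2)] p]) (simp add: X(2))
    then have "flat_D (\<lambda>_. u) (\<lambda>p. push ?F p (X p)) ?p = 0"
      unfolding flat_D_def by (metis frechet_derivative_at)
    then have "sff ?F ?C (\<lambda>_. u) X ?p = transv_part ?F ?C ?p 0" by (simp add: sff_def)
    also have "\<dots> = 0"
      by (rule transv_part_eqI[OF ch(4)[OF p] ch(6)[OF p], of _ 0]) (simp add: linear_0[OF ch(4)[OF p]])
    finally show ?thesis
      using sff_tensorial[OF ch(2) p smooth_on_differentiable[OF X(1) p]] by simp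
  qed
  then have "X ?p = 0" by (rule nondegenerate_at_right[OF ch(2) p ch(5-7)[OF p]])
  then have "Jt (?C ?p) = 0" using X(2)[OF p] by (simp add: linear_0[OF ch(4)[OF p]])
  then have "?C ?p = 0" by (simp add: Jt_def vec_eq_iff forall_4 vector_def)
  then have "?C ?p = push ?F ?p 0" by (simp add: linear_0[OF ch(4)[OF p]])
  then show False using ch(6)[OF p] by (auto simp: transversal_at_def)
qed

section \<open>Eigenspaces of the para-complex structure\<close>

text \<open>The planes \<open>range ep\<close> and \<open>range em\<close> are the eigenspaces of \<open>Jt\<close> for \<open>1\<close> and \<open>-1\<close>; \<open>up\<close> and \<open>um\<close>
  are the components of a vector in them.\<close>

definition ep :: "real^2 \<Rightarrow> real^4" where "ep a = join a a"

definition em :: "real^2 \<Rightarrow> real^4" where "em b = join b (- b)"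

definition up :: "real^4 \<Rightarrow> real^2" where "up v = vector [(v $ 1 + v $ 3) / 2, (v $ 2 + v $ 4) / 2]"

definition um :: "real^4 \<Rightarrow> real^2" where "um v = vector [(v $ 1 - v $ 3) / 2, (v $ 2 - v $ 4) / 2]"

lemma vector_4 [simp]:
  "(vector [w, x, y, z] :: 'a::zero^4) $ 1 = w" "(vector [w, x, y, z] :: 'a^4) $ 2 = x"
  "(vector [w, x, y, z] :: 'a^4) $ 3 = y" "(vector [w, x, y, z] :: 'a^4) $ 4 = z"
  by (simp_all add: vector_def)

lemma eigen_components:
  "join a b $ 1 = a $ 1" "join a b $ 2 = a $ 2" "join a b $ 3 = b $ 1" "join a b $ 4 = b $ 2"
  by (simp_all add: join_def)

lemmas eigen_simps = ep_def em_def up_def um_def Jt_def eigen_components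

lemma bounded_linear_eigen:
  "bounded_linear ep" "bounded_linear em" "bounded_linear up" "bounded_linear um" "bounded_linear Jt"
  unfolding linear_conv_bounded_linear[symmetric]
  by (auto intro!: linearI simp: vec_eq_iff forall_4 forall_2 eigen_simps algebra_simps add_divide_distrib diff_divide_distrib)

lemma up_um [simp]: "up (ep a) = a" "up (em b) = 0" "um (ep a) = 0" "um (em b) = b"
  by (simp_all add: vec_eq_iff forall_2 eigen_simps)

lemma ep_up_add_em_um: "ep (up v) + em (um v) = v"
  by (simp add: vec_eq_iff forall_4 eigen_simps field_simps)

lemma Jt_eigen [simp]: "Jt (ep a) = ep a" "Jt (em b) = - em b"
  by (simp_all add: vec_eq_iff forall_4 eigen_simps)

text \<open>The flow \<open>exp (- z Jt)\<close> applied to the point with eigencomponents \<open>a\<close> and \<open>- b\<close>. The sign of \<open>b\<close> is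
  chosen so that \<open>b\<close> becomes the curve \<open>\<beta>\<close> of the models.\<close>

definition twist :: "real \<Rightarrow> real^2 \<Rightarrow> real^2 \<Rightarrow> real^4" where
  "twist z a b = exp (- z) *\<^sub>R ep a - exp z *\<^sub>R em b"

lemma up_um_twist: "up (twist z a b) = exp (- z) *\<^sub>R a" "um (twist z a b) = - exp z *\<^sub>R b"
  by (simp_all add: twist_def linear_diff linear_cmul bounded_linear_eigen[THEN bounded_linear.linear])

lemma twist_eq_iff: "twist z a b = twist z c d \<longleftrightarrow> a = c \<and> b = d"
  by (metis up_um_twist scaleR_left_imp_eq exp_not_eq_zero neg_equal_0_iff_equal)

lemma twist_add: "twist z a b + twist z c d = twist z (a + c) (b + d)"
  by (simp add: twist_def linear_add bounded_linear_eigen[THEN bounded_linear.linear] algebra_simps)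

lemma twist_scaleR: "r *\<^sub>R twist z a b = twist z (r *\<^sub>R a) (r *\<^sub>R b)"
  by (simp add: twist_def linear_cmul bounded_linear_eigen[THEN bounded_linear.linear] algebra_simps)

lemma twist_diff: "twist z a b - twist z c d = twist z (a - c) (b - d)"
  by (simp add: twist_def linear_diff bounded_linear_eigen[THEN bounded_linear.linear] algebra_simps)

lemma twist_zero: "twist z 0 0 = 0"
  by (simp add: twist_def linear_0 bounded_linear_eigen[THEN bounded_linear.linear])

lemma Jt_twist: "Jt (twist z a b) = twist z a (- b)"
  by (simp add: twist_def linear_diff linear_cmul linear_neg bounded_linear_eigen[THEN bounded_linear.linear])

lemma has_derivative_component: "((\<lambda>q::real^'n. q $ i) has_derivative (\<lambda>v. v $ i)) (at q)"
  by (rule bounded_linear_imp_has_derivative[OF bounded_linear_vec_nth])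

text \<open>The summands with \<open>v $ 3\<close> come from the flow parameter, whose velocity field is \<open>- Jt\<close>.\<close>

lemma has_derivative_twist:
  assumes a: "(a has_derivative a') (at q)" and b: "(b has_derivative b') (at q)"
  shows "((\<lambda>q::real^3. twist (q $ 3) (a q) (b q)) has_derivative
    (\<lambda>v. twist (q $ 3) (a' v - v $ 3 *\<^sub>R a q) (b' v + v $ 3 *\<^sub>R b q))) (at q)"
  unfolding twist_def
  by (rule derivative_eq_intros has_derivative_component refl
      bounded_linear.has_derivative[OF bounded_linear_eigen(1) a]
      bounded_linear.has_derivative[OF bounded_linear_eigen(2) b])+
    (auto simp: fun_eq_iff linear_add linear_diff linear_cmul
      bounded_linear_eigen[THEN bounded_linear.linear] algebra_simps)

lemma det2_eq: "det2 a b = a $ 1 * b $ 2 - a $ 2 * b $ 1"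
  by (simp add: det2_def det_2)

lemma det2_coordinates:
  assumes "det2 a b \<noteq> 0"
  shows "v = (det2 v b / det2 a b) *\<^sub>R a + (det2 a v / det2 a b) *\<^sub>R b"
proof -
  have "det2 a b * v $ i = det2 v b * a $ i + det2 a v * b $ i" for i
    using exhaust_2[of i] by (auto simp: det2_eq algebra_simps)
  then have "v $ i = det2 v b / det2 a b * a $ i + det2 a v / det2 a b * b $ i" for i
    using assms by (simp add: field_simps)
  then show ?thesis by (simp add: vec_eq_iff)
qed

lemma det2_independent:
  assumes "det2 a b \<noteq> 0" "r *\<^sub>R a + s *\<^sub>R b = 0"
  shows "r = 0" "s = 0"
proof -
  have "det2 (r *\<^sub>R a + s *\<^sub>R b) b = r * det2 a b" "det2 a (r *\<^sub>R a + s *\<^sub>R b) = s * det2 a b"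
    by (simp_all add: det2_eq algebra_simps)
  then show "r = 0" "s = 0" using assms by (auto simp: det2_eq)
qed

section \<open>Determinants\<close>

lemma det_4:
  fixes A :: "real^4^4"
  shows "det A =
     A$1$1 * (A$2$2 * (A$3$3 * A$4$4 - A$3$4 * A$4$3) - A$2$3 * (A$3$2 * A$4$4 - A$3$4 * A$4$2)
       + A$2$4 * (A$3$2 * A$4$3 - A$3$3 * A$4$2))
   - A$1$2 * (A$2$1 * (A$3$3 * A$4$4 - A$3$4 * A$4$3) - A$2$3 * (A$3$1 * A$4$4 - A$3$4 * A$4$1)
       + A$2$4 * (A$3$1 * A$4$3 - A$3$3 * A$4$1))
   + A$1$3 * (A$2$1 * (A$3$2 * A$4$4 - A$3$4 * A$4$2) - A$2$2 * (A$3$1 * A$4$4 - A$3$4 * A$4$1)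
       + A$2$4 * (A$3$1 * A$4$2 - A$3$2 * A$4$1))
   - A$1$4 * (A$2$1 * (A$3$2 * A$4$3 - A$3$3 * A$4$2) - A$2$2 * (A$3$1 * A$4$3 - A$3$3 * A$4$1)
       + A$2$3 * (A$3$1 * A$4$2 - A$3$2 * A$4$1))"
proof -
  have f1: "finite {2::4, 3, 4}" "1 \<notin> {2::4, 3, 4}" by auto
  have f2: "finite {3::4, 4}" "2 \<notin> {3::4, 4}" by auto
  have f3: "finite {4::4}" "3 \<notin> {4::4}" by auto
  show ?thesis
    unfolding det_def UNIV_4
    unfolding sum_over_permutations_insert[OF f1]
    unfolding sum_over_permutations_insert[OF f2]
    unfolding sum_over_permutations_insert[OF f3]
    unfolding permutes_sing
    by (simp add: sign_swap_id permutation_swap_id permutation_compose sign_compose sign_id swap_id_eq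
        algebra_simps)
qed


text \<open>The flow preserves volume, and \<open>4\<close> is the determinant of the basis of eigenvectors.\<close>

lemma det_twist:
  "det (vector [twist z a1 b1, twist z a2 b2, twist z a3 b3, twist z a4 b4] :: real^4^4) =
    4 * det (vector [join a1 b1, join a2 b2, join a3 b3, join a4 b4] :: real^4^4)"
proof -
  define N :: "real^4^4" where "N = vector
    [exp (- z) *\<^sub>R vector [1, 0, 1, 0], exp (- z) *\<^sub>R vector [0, 1, 0, 1],
     (- exp z) *\<^sub>R vector [1, 0, - 1, 0], (- exp z) *\<^sub>R vector [0, 1, 0, - 1]]"
  have "vector [twist z a1 b1, twist z a2 b2, twist z a3 b3, twist z a4 b4] =
      (vector [join a1 b1, join a2 b2, join a3 b3, join a4 b4] :: real^4^4) ** N"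
    by (simp add: vec_eq_iff forall_4 matrix_matrix_mult_def sum_4 N_def twist_def eigen_simps algebra_simps)
  moreover have "det N = 4 * (exp (- z) * exp z) * (exp (- z) * exp z)"
    by (simp add: det_4 N_def algebra_simps)
  moreover have "exp (- z) * exp z = 1" by (simp add: exp_minus)
  ultimately show ?thesis by (simp add: det_mul)
qed

text \<open>The frame is multiplied by a block matrix with blocks of sizes \<open>3\<close> and \<open>1\<close>.\<close>

lemma det_frame_change:
  fixes X1 X2 X3 X4 :: "real^4" and u v w :: "real^3"
  shows "det (vector [u $ 1 *\<^sub>R X1 + u $ 2 *\<^sub>R X2 + u $ 3 *\<^sub>R X3,
      v $ 1 *\<^sub>R X1 + v $ 2 *\<^sub>R X2 + v $ 3 *\<^sub>R X3,
      w $ 1 *\<^sub>R X1 + w $ 2 *\<^sub>R X2 + w $ 3 *\<^sub>R X3, X4] :: real^4^4) =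
    det (vector [u, v, w] :: real^3^3) * det (vector [X1, X2, X3, X4] :: real^4^4)"
proof -
  define N :: "real^4^4" where "N = vector
    [vector [u $ 1, u $ 2, u $ 3, 0], vector [v $ 1, v $ 2, v $ 3, 0],
     vector [w $ 1, w $ 2, w $ 3, 0], vector [0, 0, 0, 1]]"
  have "vector [u $ 1 *\<^sub>R X1 + u $ 2 *\<^sub>R X2 + u $ 3 *\<^sub>R X3,
      v $ 1 *\<^sub>R X1 + v $ 2 *\<^sub>R X2 + v $ 3 *\<^sub>R X3,
      w $ 1 *\<^sub>R X1 + w $ 2 *\<^sub>R X2 + w $ 3 *\<^sub>R X3, X4]
    = N ** (vector [X1, X2, X3, X4] :: real^4^4)"
    by (simp add: vec_eq_iff forall_4 matrix_matrix_mult_def sum_4 N_def)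
  moreover have "det N = det (vector [u, v, w] :: real^3^3)"
    by (simp add: det_4 det_3 N_def algebra_simps)
  ultimately show ?thesis by (simp add: det_mul)
qed

lemma det_bilinear_form:
  fixes H :: "real^3^3" and X :: "real^3^3"
  shows "det (\<chi> i j. X $ i \<bullet> (H *v X $ j) :: real^3^3) = (det X)\<^sup>2 * det H"
proof -
  have "(\<chi> i j. X $ i \<bullet> (H *v X $ j)) = X ** H ** transpose X"
    by (simp add: vec_eq_iff forall_3 matrix_matrix_mult_def matrix_vector_mult_def transpose_def
        inner_vec_def sum_3 algebra_simps)
  then show ?thesis by (simp add: det_mul power2_eq_square)
qed

section \<open>Velocities of smooth curves\<close>

lemma velocity_eq_frechet:
  assumes "smooth_on I \<gamma>" "y \<in> I" shows "velocity \<gamma> y = frechet_derivative \<gamma> (at y) 1"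
proof -
  let ?D = "frechet_derivative \<gamma> (at y)"
  have d: "(\<gamma> has_derivative ?D) (at y)" by (rule smooth_on_has_derivative[OF assms])
  have "?D = (\<lambda>t. t *\<^sub>R ?D 1)"
  proof
    show "?D t = t *\<^sub>R ?D 1" for t using linear_cmul[OF has_derivative_linear[OF d], of t 1] by simp
  qed
  then have "(\<gamma> has_derivative (\<lambda>t. t *\<^sub>R ?D 1)) (at y)" using d by (simp only:)
  then show ?thesis unfolding velocity_def has_vector_derivative_def[symmetric] by (rule vector_derivative_at)
qed

lemma smooth_on_velocity:
  assumes "smooth_on I \<gamma>" shows "smooth_on I (velocity \<gamma>)"
  using smooth_on_cong[OF smooth_on_frechet_derivative[OF assms, of 1]] velocity_eq_frechet[OF assms]
  by simp

lemma has_derivative_curve: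
  assumes g: "smooth_on I \<gamma>" and y: "y \<in> I"
  shows "(\<gamma> has_derivative (\<lambda>t. t *\<^sub>R velocity \<gamma> y)) (at y)"
proof -
  have d: "(\<gamma> has_derivative frechet_derivative \<gamma> (at y)) (at y)"
    by (rule smooth_on_has_derivative[OF g y])
  have "frechet_derivative \<gamma> (at y) t = t *\<^sub>R velocity \<gamma> y" for t
    using linear_cmul[OF has_derivative_linear[OF d], of t 1]
    by (simp add: velocity_eq_frechet[OF g y])
  then have "frechet_derivative \<gamma> (at y) = (\<lambda>t. t *\<^sub>R velocity \<gamma> y)" by blast
  with d show ?thesis by simp
qed

lemma has_derivative_curve_component:
  assumes g: "smooth_on I \<gamma>" and q: "(q::real^3) $ 2 \<in> I"
  shows "((\<lambda>q. \<gamma> (q $ 2)) has_derivative (\<lambda>v. v $ 2 *\<^sub>R velocity \<gamma> (q $ 2))) (at q)"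
  by (rule has_derivative_compose[OF has_derivative_component has_derivative_curve[OF g q]])

section \<open>Ruled hypersurfaces invariant under the flow\<close>

text \<open>For fixed \<open>y\<close> and \<open>z\<close> this is a straight line in the direction of \<open>ep (\<alpha> y)\<close>, and translations in
  \<open>z\<close> are the flow.\<close>

definition ruled :: "(real \<Rightarrow> real^2) \<Rightarrow> (real \<Rightarrow> real^2) \<Rightarrow> (real \<Rightarrow> real^2) \<Rightarrow> real^3 \<Rightarrow> real^4" where
  "ruled \<alpha> \<gamma> \<beta> q = twist (q $ 3) (q $ 1 *\<^sub>R \<alpha> (q $ 2) + \<gamma> (q $ 2)) (\<beta> (q $ 2))"

lemma model_f_eq_ruled:
  "model_f \<alpha> \<beta> A E = ruled \<alpha> (\<lambda>y. A y *\<^sub>R \<alpha> y + model_B \<alpha> \<beta> E y *\<^sub>R velocity \<alpha> y) \<beta>"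
proof
  fix q :: "real^3"
  have e: "exp (- z) = cosh z - sinh z" "exp z = cosh z + sinh z" for z :: real
    by (simp_all add: cosh_minus_sinh cosh_plus_sinh)
  show "model_f \<alpha> \<beta> A E q = ruled \<alpha> (\<lambda>y. A y *\<^sub>R \<alpha> y + model_B \<alpha> \<beta> E y *\<^sub>R velocity \<alpha> y) \<beta> q"
    unfolding ruled_def twist_def e model_f_def model_g_def
    by (simp add: vec_eq_iff forall_4 eigen_simps algebra_simps)
qed

locale ruled_surface =
  fixes I :: "real set" and \<alpha> \<gamma> \<beta> :: "real \<Rightarrow> real^2"
  assumes \<alpha>: "smooth_on I \<alpha>" and \<gamma>: "smooth_on I \<gamma>" and \<beta>: "smooth_on I \<beta>"
begin

abbreviation (input) "\<alpha>' \<equiv> velocity \<alpha>"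
abbreviation (input) "\<gamma>' \<equiv> velocity \<gamma>"
abbreviation (input) "\<beta>' \<equiv> velocity \<beta>"

lemma has_derivative_ruled:
  assumes q: "q $ 2 \<in> I"
  shows "(ruled \<alpha> \<gamma> \<beta> has_derivative (\<lambda>v. twist (q $ 3)
    (v $ 1 *\<^sub>R \<alpha> (q $ 2) + v $ 2 *\<^sub>R (q $ 1 *\<^sub>R \<alpha>' (q $ 2) + \<gamma>' (q $ 2))
      - v $ 3 *\<^sub>R (q $ 1 *\<^sub>R \<alpha> (q $ 2) + \<gamma> (q $ 2)))
    (v $ 2 *\<^sub>R \<beta>' (q $ 2) + v $ 3 *\<^sub>R \<beta> (q $ 2)))) (at q)"
proof -
  have "((\<lambda>q. twist (q $ 3) (q $ 1 *\<^sub>R \<alpha> (q $ 2) + \<gamma> (q $ 2)) (\<beta> (q $ 2))) has_derivative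
    (\<lambda>v. twist (q $ 3)
    ((q $ 1 *\<^sub>R (v $ 2 *\<^sub>R \<alpha>' (q $ 2)) + v $ 1 *\<^sub>R \<alpha> (q $ 2) + v $ 2 *\<^sub>R \<gamma>' (q $ 2))
      - v $ 3 *\<^sub>R (q $ 1 *\<^sub>R \<alpha> (q $ 2) + \<gamma> (q $ 2)))
    (v $ 2 *\<^sub>R \<beta>' (q $ 2) + v $ 3 *\<^sub>R \<beta> (q $ 2)))) (at q)"
    by (intro has_derivative_twist has_derivative_add has_derivative_scaleR has_derivative_component
        has_derivative_curve_component[OF \<alpha> q] has_derivative_curve_component[OF \<beta> q]
        has_derivative_curve_component[OF \<gamma> q])
  then show ?thesis by (simp add: ruled_def[abs_def] algebra_simps)
qed

lemma push_ruled:
  "q $ 2 \<in> I \<Longrightarrow> push (ruled \<alpha> \<gamma> \<beta>) q v = twist (q $ 3)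
    (v $ 1 *\<^sub>R \<alpha> (q $ 2) + v $ 2 *\<^sub>R (q $ 1 *\<^sub>R \<alpha>' (q $ 2) + \<gamma>' (q $ 2))
      - v $ 3 *\<^sub>R (q $ 1 *\<^sub>R \<alpha> (q $ 2) + \<gamma> (q $ 2)))
    (v $ 2 *\<^sub>R \<beta>' (q $ 2) + v $ 3 *\<^sub>R \<beta> (q $ 2))"
  unfolding push_def frechet_derivative_at[OF has_derivative_ruled, symmetric] ..

lemma open_slab: "open (slab I)"
  unfolding slab_def
  using continuous_open_preimage[of UNIV "\<lambda>q::real^3. q $ 2" I] smooth_on_open[OF \<alpha>]
  by (simp add: vimage_def continuous_on_component)

lemma smooth_ruled: "smooth_on (slab I) (ruled \<alpha> \<gamma> \<beta>)"
proof -
  have c: "smooth_on (slab I) (\<lambda>q. q $ i)" for i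
    by (rule smooth_on_component[OF smooth_on_id[OF open_slab]])
  have g: "smooth_on (slab I) (\<lambda>q. g (q $ 2))" if "smooth_on I g" for g :: "real \<Rightarrow> real^2"
    by (rule smooth_on_compose[OF c that]) (simp add: slab_def)
  show ?thesis
    unfolding ruled_def[abs_def] twist_def
    by (intro smooth_on_diff smooth_on_scaleR smooth_on_exp smooth_on_minus
        smooth_on_bounded_linear[OF bounded_linear_eigen(1)]
        smooth_on_bounded_linear[OF bounded_linear_eigen(2)] smooth_on_add c g \<alpha> \<gamma> \<beta>)
qed

lemma linear_push_ruled: "q $ 2 \<in> I \<Longrightarrow> linear (push (ruled \<alpha> \<gamma> \<beta>) q)"
  by (rule smooth_on_linear_push[OF smooth_ruled]) (simp add: slab_def)

text \<open>The second derivative is grouped by vectors because \<open>h\<close> arises by taking the transversal part of each of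
  them.\<close>

lemma has_derivative_push_ruled:
  assumes q: "q $ 2 \<in> I"
  shows "((\<lambda>q. push (ruled \<alpha> \<gamma> \<beta>) q v) has_derivative (\<lambda>u.
      (u $ 1 * v $ 2 + u $ 2 * v $ 1) *\<^sub>R twist (q $ 3) (\<alpha>' (q $ 2)) 0
    + (u $ 2 * v $ 2) *\<^sub>R twist (q $ 3) (q $ 1 *\<^sub>R velocity \<alpha>' (q $ 2) + velocity \<gamma>' (q $ 2)) (velocity \<beta>' (q $ 2))
    - (u $ 1 * v $ 3 + u $ 3 * v $ 1) *\<^sub>R twist (q $ 3) (\<alpha> (q $ 2)) 0
    - (u $ 2 * v $ 3 + u $ 3 * v $ 2) *\<^sub>R twist (q $ 3) (q $ 1 *\<^sub>R \<alpha>' (q $ 2) + \<gamma>' (q $ 2)) (- \<beta>' (q $ 2))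
    + (u $ 3 * v $ 3) *\<^sub>R ruled \<alpha> \<gamma> \<beta> q)) (at q)" (is "(?P has_derivative ?D) _")
proof -
  note c = has_derivative_curve_component[OF _ q]
  note s = smooth_on_velocity
  have "((\<lambda>q. twist (q $ 3)
    (v $ 1 *\<^sub>R \<alpha> (q $ 2) + v $ 2 *\<^sub>R (q $ 1 *\<^sub>R \<alpha>' (q $ 2) + \<gamma>' (q $ 2))
      - v $ 3 *\<^sub>R (q $ 1 *\<^sub>R \<alpha> (q $ 2) + \<gamma> (q $ 2)))
    (v $ 2 *\<^sub>R \<beta>' (q $ 2) + v $ 3 *\<^sub>R \<beta> (q $ 2))) has_derivative
    (\<lambda>u. twist (q $ 3)
     ((v $ 1 *\<^sub>R (u $ 2 *\<^sub>R \<alpha>' (q $ 2)) + v $ 2 *\<^sub>R ((q $ 1 *\<^sub>R (u $ 2 *\<^sub>R velocity \<alpha>' (q $ 2)) + u $ 1 *\<^sub>R \<alpha>' (q $ 2)) + u $ 2 *\<^sub>R velocity \<gamma>' (q $ 2))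
      - v $ 3 *\<^sub>R ((q $ 1 *\<^sub>R (u $ 2 *\<^sub>R \<alpha>' (q $ 2)) + u $ 1 *\<^sub>R \<alpha> (q $ 2)) + u $ 2 *\<^sub>R \<gamma>' (q $ 2)))
      - u $ 3 *\<^sub>R (v $ 1 *\<^sub>R \<alpha> (q $ 2) + v $ 2 *\<^sub>R (q $ 1 *\<^sub>R \<alpha>' (q $ 2) + \<gamma>' (q $ 2))
      - v $ 3 *\<^sub>R (q $ 1 *\<^sub>R \<alpha> (q $ 2) + \<gamma> (q $ 2))))
     ((v $ 2 *\<^sub>R (u $ 2 *\<^sub>R velocity \<beta>' (q $ 2)) + v $ 3 *\<^sub>R (u $ 2 *\<^sub>R \<beta>' (q $ 2)))
      + u $ 3 *\<^sub>R (v $ 2 *\<^sub>R \<beta>' (q $ 2) + v $ 3 *\<^sub>R \<beta> (q $ 2))))) (at q)"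
    (is "(_ has_derivative ?D') _")
    by (intro has_derivative_twist has_derivative_add has_derivative_diff has_derivative_scaleR
        has_derivative_scaleR_right has_derivative_component c s \<alpha> \<beta> \<gamma>)
  moreover have "?D' = ?D"
    unfolding ruled_def twist_scaleR twist_add
    unfolding twist_diff twist_add twist_eq_iff
    by (simp add: fun_eq_iff twist_eq_iff vec_eq_iff algebra_simps)
  ultimately have "((\<lambda>q. twist (q $ 3)
    (v $ 1 *\<^sub>R \<alpha> (q $ 2) + v $ 2 *\<^sub>R (q $ 1 *\<^sub>R \<alpha>' (q $ 2) + \<gamma>' (q $ 2))
      - v $ 3 *\<^sub>R (q $ 1 *\<^sub>R \<alpha> (q $ 2) + \<gamma> (q $ 2)))
    (v $ 2 *\<^sub>R \<beta>' (q $ 2) + v $ 3 *\<^sub>R \<beta> (q $ 2))) has_derivative ?D) (at q)" by simp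
  then show ?thesis
    by (rule has_derivative_transform_within_open[OF _ open_slab])
      (simp_all add: push_ruled slab_def q)
qed

text \<open>If \<open>\<gamma>\<close> is a multiple of \<open>\<alpha>\<close> at some parameter, both eigencomponents of the position vector are tangent
  there: the first lies on the ruling, and the second is then obtained from the velocity of the flow. The
  vector \<open>e\<close> only expresses that \<open>\<alpha>\<close> does not vanish.\<close>

lemma det_nonzero_of_transversal:
  assumes q: "q $ 2 \<in> I" and t: "ruled \<alpha> \<gamma> \<beta> q \<notin> range (push (ruled \<alpha> \<gamma> \<beta>) q)"
    and a: "det2 (\<alpha> (q $ 2)) e \<noteq> 0"
  shows "det2 (\<alpha> (q $ 2)) (\<gamma> (q $ 2)) \<noteq> 0"
proof
  assume z: "det2 (\<alpha> (q $ 2)) (\<gamma> (q $ 2)) = 0"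
  define k where "k = det2 (\<gamma> (q $ 2)) e / det2 (\<alpha> (q $ 2)) e"
  have k: "\<gamma> (q $ 2) = k *\<^sub>R \<alpha> (q $ 2)"
    using det2_coordinates[OF a, of "\<gamma> (q $ 2)"] z by (simp add: k_def)
  have "x *\<^sub>R a + k *\<^sub>R a = (2 * x + 2 * k) *\<^sub>R a - (x *\<^sub>R a + k *\<^sub>R a)" for x and a :: "real^2"
    by (simp add: vec_eq_iff algebra_simps)
  then have "ruled \<alpha> \<gamma> \<beta> q = push (ruled \<alpha> \<gamma> \<beta>) q (vector [2 * q $ 1 + 2 * k, 0, 1])"
    by (simp add: push_ruled[OF q] ruled_def twist_eq_iff k)
  with t show False by blast
qed

end

section \<open>The Blaschke condition for ruled hypersurfaces\<close>

context ruled_surface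
begin

lemma immersed_ruled:
  assumes q: "q $ 2 \<in> I" and a: "\<alpha> (q $ 2) \<noteq> 0"
    and b: "det2 (\<beta> (q $ 2)) (\<beta>' (q $ 2)) \<noteq> 0"
  shows "immersed_at (ruled \<alpha> \<gamma> \<beta>) q"
  unfolding immersed_at_def linear_injective_0[OF linear_push_ruled[OF q]]
proof (intro allI impI)
  fix v assume "push (ruled \<alpha> \<gamma> \<beta>) q v = 0"
  then have *: "v $ 1 *\<^sub>R \<alpha> (q $ 2) + v $ 2 *\<^sub>R (q $ 1 *\<^sub>R \<alpha>' (q $ 2) + \<gamma>' (q $ 2))
      - v $ 3 *\<^sub>R (q $ 1 *\<^sub>R \<alpha> (q $ 2) + \<gamma> (q $ 2)) = 0"
    "v $ 3 *\<^sub>R \<beta> (q $ 2) + v $ 2 *\<^sub>R \<beta>' (q $ 2) = 0"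
    unfolding push_ruled[OF q] twist_zero[of "q $ 3", symmetric] twist_eq_iff by (simp_all add: add.commute)
  have "v $ 3 = 0" "v $ 2 = 0" using det2_independent[OF b *(2)] by simp_all
  then show "v = 0" using *(1) a by (simp add: vec_eq_iff[of v] forall_3)
qed

lemma transversal_ruled:
  assumes q: "q $ 2 \<in> I" and d: "det2 (\<alpha> (q $ 2)) (\<gamma> (q $ 2)) \<noteq> 0"
    and b: "det2 (\<beta> (q $ 2)) (\<beta>' (q $ 2)) \<noteq> 0"
    and C: "C q = - l *\<^sub>R ruled \<alpha> \<gamma> \<beta> q" and l: "l \<noteq> 0"
  shows "transversal_at (ruled \<alpha> \<gamma> \<beta>) C q"
  unfolding transversal_at_def
proof
  assume "C q \<in> range (push (ruled \<alpha> \<gamma> \<beta>) q)"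
  then obtain v where v: "C q = push (ruled \<alpha> \<gamma> \<beta>) q v" by blast
  define w where "w = (- 1 / l) *\<^sub>R v"
  have "ruled \<alpha> \<gamma> \<beta> q = (- 1 / l) *\<^sub>R C q" using l by (simp add: C)
  also have "\<dots> = push (ruled \<alpha> \<gamma> \<beta>) q w"
    unfolding w_def v by (rule linear_cmul[OF linear_push_ruled[OF q], symmetric])
  finally have *: "q $ 1 *\<^sub>R \<alpha> (q $ 2) + \<gamma> (q $ 2) =
      w $ 1 *\<^sub>R \<alpha> (q $ 2) + w $ 2 *\<^sub>R (q $ 1 *\<^sub>R \<alpha>' (q $ 2) + \<gamma>' (q $ 2))
      - w $ 3 *\<^sub>R (q $ 1 *\<^sub>R \<alpha> (q $ 2) + \<gamma> (q $ 2))"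
    "\<beta> (q $ 2) = w $ 2 *\<^sub>R \<beta>' (q $ 2) + w $ 3 *\<^sub>R \<beta> (q $ 2)"
    by (simp_all add: ruled_def push_ruled[OF q] twist_eq_iff)
  have "(w $ 3 - 1) *\<^sub>R \<beta> (q $ 2) + w $ 2 *\<^sub>R \<beta>' (q $ 2)
      = (w $ 2 *\<^sub>R \<beta>' (q $ 2) + w $ 3 *\<^sub>R \<beta> (q $ 2)) - \<beta> (q $ 2)"
    by (simp add: algebra_simps)
  also have "\<dots> = 0" unfolding *(2)[symmetric] by simp
  finally have w: "w $ 3 = 1" "w $ 2 = 0" using det2_independent[OF b] by fastforce+
  have "(w $ 1 - 2 * q $ 1) *\<^sub>R \<alpha> (q $ 2) + (- 2) *\<^sub>R \<gamma> (q $ 2)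
     = (w $ 1 *\<^sub>R \<alpha> (q $ 2) - (q $ 1 *\<^sub>R \<alpha> (q $ 2) + \<gamma> (q $ 2)))
      - (q $ 1 *\<^sub>R \<alpha> (q $ 2) + \<gamma> (q $ 2))"
    by (simp add: vec_eq_iff algebra_simps)
  also have "\<dots> = (w $ 1 *\<^sub>R \<alpha> (q $ 2) + w $ 2 *\<^sub>R (q $ 1 *\<^sub>R \<alpha>' (q $ 2) + \<gamma>' (q $ 2))
      - w $ 3 *\<^sub>R (q $ 1 *\<^sub>R \<alpha> (q $ 2) + \<gamma> (q $ 2))) - (q $ 1 *\<^sub>R \<alpha> (q $ 2) + \<gamma> (q $ 2))"
    by (simp add: w)
  also have "\<dots> = 0" unfolding *(1)[symmetric] by simp
  finally show False using det2_independent(2)[OF d] by fastforce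
qed

text \<open>In coordinates \<open>h\<close> has the matrix \<open>- 1 / l\<close> times
  \<open>[0, r / 2, 0], [r / 2, s, - t], [0, - t, 1]\<close>, where \<open>r\<close> is the coefficient of \<open>\<gamma>\<close> in
  \<open>\<alpha>'\<close>. The entry \<open>r / 2\<close> arises because \<open>\<alpha>'\<close> is \<open>r \<gamma>\<close> up to a multiple of \<open>\<alpha>\<close>, and the
  eigenvector with component \<open>\<gamma>\<close> is half the position vector up to tangent vectors.\<close>

lemma sff_ruled:
  assumes q: "q $ 2 \<in> I" and d: "det2 (\<alpha> (q $ 2)) (\<gamma> (q $ 2)) \<noteq> 0"
    and b: "det2 (\<beta> (q $ 2)) (\<beta>' (q $ 2)) \<noteq> 0"
    and C: "C q = - l *\<^sub>R ruled \<alpha> \<gamma> \<beta> q" and l: "l \<noteq> 0"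
  defines "r \<equiv> det2 (\<alpha> (q $ 2)) (\<alpha>' (q $ 2)) / det2 (\<alpha> (q $ 2)) (\<gamma> (q $ 2))"
  obtains s t where "\<And>u v. sff_at (ruled \<alpha> \<gamma> \<beta>) C q u v = (- 1 / l) *
    ((u $ 1 * v $ 2 + u $ 2 * v $ 1) * (r / 2) + u $ 2 * v $ 2 * s
      - (u $ 2 * v $ 3 + u $ 3 * v $ 2) * t + u $ 3 * v $ 3)"
proof -
  let ?R = "ruled \<alpha> \<gamma> \<beta>"
  let ?\<tau> = "transv_part ?R C q"
  have a0: "\<alpha> (q $ 2) \<noteq> 0" using d by (auto simp: det2_eq)
  note lin = linear_push_ruled[OF q]
  note im = immersed_ruled[OF q a0 b]
  note tr = transversal_ruled[OF q d b, of C l, OF C l]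
  have lt: "linear ?\<tau>" by (rule linear_transv_part[OF lin im tr])
  have eqI: "?\<tau> w = c" if "w = push ?R q v + c *\<^sub>R C q" for w v c
    by (rule transv_part_eqI[OF lin tr that])
  have tR: "?\<tau> (?R q) = - 1 / l"
    by (rule eqI[of _ 0]) (use l in \<open>simp add: C linear_0[OF lin]\<close>)
  have t1: "?\<tau> (twist (q $ 3) (\<alpha> (q $ 2)) 0) = 0"
    by (rule eqI[of _ "vector [1, 0, 0]"]) (simp add: push_ruled[OF q])
  define p where "p = det2 (\<alpha>' (q $ 2)) (\<gamma> (q $ 2)) / det2 (\<alpha> (q $ 2)) (\<gamma> (q $ 2))"
  have pr: "\<alpha>' (q $ 2) = p *\<^sub>R \<alpha> (q $ 2) + r *\<^sub>R \<gamma> (q $ 2)"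
    unfolding p_def r_def by (rule det2_coordinates[OF d])
  have "twist (q $ 3) (\<alpha>' (q $ 2)) 0 =
      push ?R q (vector [p - r * q $ 1, 0, - r / 2]) + (r / 2) *\<^sub>R ?R q"
  proof -
    have "p *\<^sub>R a + r *\<^sub>R g = (p - r * x) *\<^sub>R a - (- r / 2) *\<^sub>R (x *\<^sub>R a + g) + (r / 2) *\<^sub>R (x *\<^sub>R a + g)"
      for a g :: "real^2" and x
      by (simp add: vec_eq_iff field_simps)
    then show ?thesis
      unfolding push_ruled[OF q] ruled_def twist_scaleR twist_add pr by (simp add: twist_eq_iff)
  qed
  then have tT: "?\<tau> (twist (q $ 3) (\<alpha>' (q $ 2)) 0) = (- 1 / l) * (r / 2)"
    by (intro eqI) (use l in \<open>simp add: C\<close>)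
  define s where "s = - l * ?\<tau> (twist (q $ 3) (q $ 1 *\<^sub>R velocity \<alpha>' (q $ 2) + velocity \<gamma>' (q $ 2)) (velocity \<beta>' (q $ 2)))"
  define t where "t = - l * ?\<tau> (twist (q $ 3) (q $ 1 *\<^sub>R \<alpha>' (q $ 2) + \<gamma>' (q $ 2)) (- \<beta>' (q $ 2)))"
  have st: "?\<tau> (twist (q $ 3) (q $ 1 *\<^sub>R velocity \<alpha>' (q $ 2) + velocity \<gamma>' (q $ 2)) (velocity \<beta>' (q $ 2))) = (- 1 / l) * s"
    "?\<tau> (twist (q $ 3) (q $ 1 *\<^sub>R \<alpha>' (q $ 2) + \<gamma>' (q $ 2)) (- \<beta>' (q $ 2))) = (- 1 / l) * t"
    using l by (simp_all add: s_def t_def)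
  show thesis
  proof (rule that)
    fix u v
    show "sff_at ?R C q u v = (- 1 / l) *
      ((u $ 1 * v $ 2 + u $ 2 * v $ 1) * (r / 2) + u $ 2 * v $ 2 * s
        - (u $ 2 * v $ 3 + u $ 3 * v $ 2) * t + u $ 3 * v $ 3)"
      unfolding sff_at_def sff_def flat_D_def frechet_derivative_at[OF has_derivative_push_ruled[OF q], symmetric]
        linear_add[OF lt] linear_diff[OF lt] linear_cmul[OF lt] tT st t1 tR
      by (simp add: algebra_simps)
  qed
qed

lemma nondegenerate_ruled_iff:
  assumes q: "q $ 2 \<in> I" and d: "det2 (\<alpha> (q $ 2)) (\<gamma> (q $ 2)) \<noteq> 0"
    and b: "det2 (\<beta> (q $ 2)) (\<beta>' (q $ 2)) \<noteq> 0"
    and C: "C q = - l *\<^sub>R ruled \<alpha> \<gamma> \<beta> q" and l: "l \<noteq> 0"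
  shows "nondegenerate_at (ruled \<alpha> \<gamma> \<beta>) C q \<longleftrightarrow> det2 (\<alpha> (q $ 2)) (\<alpha>' (q $ 2)) \<noteq> 0"
proof -
  define r where "r = det2 (\<alpha> (q $ 2)) (\<alpha>' (q $ 2)) / det2 (\<alpha> (q $ 2)) (\<gamma> (q $ 2))"
  obtain s t where h: "\<And>u v. sff_at (ruled \<alpha> \<gamma> \<beta>) C q u v = (- 1 / l) *
    ((u $ 1 * v $ 2 + u $ 2 * v $ 1) * (r / 2) + u $ 2 * v $ 2 * s
      - (u $ 2 * v $ 3 + u $ 3 * v $ 2) * t + u $ 3 * v $ 3)"
    unfolding r_def using sff_ruled[OF q d b, of C l, OF C l] by blast
  have r: "r \<noteq> 0 \<longleftrightarrow> det2 (\<alpha> (q $ 2)) (\<alpha>' (q $ 2)) \<noteq> 0" using d by (simp add: r_def)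
  show ?thesis unfolding r[symmetric]
  proof
    assume n: "nondegenerate_at (ruled \<alpha> \<gamma> \<beta>) C q"
    show "r \<noteq> 0"
    proof
      assume "r = 0"
      then have "\<forall>v. sff_at (ruled \<alpha> \<gamma> \<beta>) C q (vector [1, 0, 0]) v = 0" by (simp add: h)
      then have "vector [1, 0, 0] = (0 :: real^3)" using n unfolding nondegenerate_at_def by blast
      then show False by (simp add: vec_eq_iff forall_3)
    qed
  next
    assume r0: "r \<noteq> 0"
    show "nondegenerate_at (ruled \<alpha> \<gamma> \<beta>) C q"
      unfolding nondegenerate_at_def
    proof (intro allI impI)
      fix u assume u: "\<forall>v. sff_at (ruled \<alpha> \<gamma> \<beta>) C q u v = 0"
      have u2: "u $ 2 = 0" using spec[OF u, of "vector [1, 0, 0]"] r0 l by (simp add: h)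
      then have u3: "u $ 3 = 0" using spec[OF u, of "vector [0, 0, 1]"] l by (simp add: h)
      then have "u $ 1 = 0" using spec[OF u, of "vector [0, 1, 0]"] r0 l u2 by (simp add: h)
      then show "u = 0" using u2 u3 by (simp add: vec_eq_iff forall_3)
    qed
  qed
qed

text \<open>The factor \<open>8\<close> is \<open>4\<close> from the eigenbasis times \<open>2\<close>, since the position vector and the velocity of the
  flow have opposite first and equal second eigencomponents up to a factor.\<close>

lemma induced_volume_ruled:
  assumes q: "q $ 2 \<in> I" and C: "C q = - l *\<^sub>R ruled \<alpha> \<gamma> \<beta> q"
  shows "induced_volume (ruled \<alpha> \<gamma> \<beta>) C q u v w = det (vector [u, v, w] :: real^3^3) *
    (8 * l * det2 (\<alpha> (q $ 2)) (\<gamma> (q $ 2)) * det2 (\<beta> (q $ 2)) (\<beta>' (q $ 2)))"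
proof -
  define X1 where "X1 = twist (q $ 3) (\<alpha> (q $ 2)) 0"
  define X2 where "X2 = twist (q $ 3) (q $ 1 *\<^sub>R \<alpha>' (q $ 2) + \<gamma>' (q $ 2)) (\<beta>' (q $ 2))"
  define X3 where "X3 = twist (q $ 3) (- (q $ 1 *\<^sub>R \<alpha> (q $ 2) + \<gamma> (q $ 2))) (\<beta> (q $ 2))"
  define X4 where "X4 = twist (q $ 3) (- l *\<^sub>R (q $ 1 *\<^sub>R \<alpha> (q $ 2) + \<gamma> (q $ 2))) (- l *\<^sub>R \<beta> (q $ 2))"
  have p: "push (ruled \<alpha> \<gamma> \<beta>) q u = u $ 1 *\<^sub>R X1 + u $ 2 *\<^sub>R X2 + u $ 3 *\<^sub>R X3" for u
    unfolding push_ruled[OF q] X1_def X2_def X3_def twist_scaleR twist_add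
    by (simp add: twist_eq_iff) (simp add: vec_eq_iff algebra_simps)
  have X4: "C q = X4" by (simp only: C ruled_def twist_scaleR X4_def)
  have "det (vector [X1, X2, X3, X4] :: real^4^4) =
      8 * l * det2 (\<alpha> (q $ 2)) (\<gamma> (q $ 2)) * det2 (\<beta> (q $ 2)) (\<beta>' (q $ 2))"
    unfolding X1_def X2_def X3_def X4_def det_twist
    by (simp add: det_4 eigen_components det2_eq algebra_simps)
  then show ?thesis
    unfolding induced_volume_def p X4 det_frame_change by simp
qed

text \<open>Both volume forms are multiples of the determinant. The matrix of \<open>h\<close> has determinant
  \<open>r\<^sup>2 / (4 l^3)\<close>, whatever its entries \<open>s\<close> and \<open>t\<close> are, so the condition is
  \<open>r\<^sup>2 = 4 \<bar>l\<bar>^3 k\<^sup>2\<close> for the factor \<open>k\<close> of the induced volume.\<close>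

lemma blaschke_volume_ruled_iff:
  assumes q: "q $ 2 \<in> I" and d: "det2 (\<alpha> (q $ 2)) (\<gamma> (q $ 2)) \<noteq> 0"
    and b: "det2 (\<beta> (q $ 2)) (\<beta>' (q $ 2)) \<noteq> 0"
    and C: "C q = - l *\<^sub>R ruled \<alpha> \<gamma> \<beta> q" and l: "l \<noteq> 0"
  shows "(\<forall>u v w. metric_volume (ruled \<alpha> \<gamma> \<beta>) C q u v w = induced_volume (ruled \<alpha> \<gamma> \<beta>) C q u v w)
    \<longleftrightarrow> (det2 (\<alpha> (q $ 2)) (\<alpha>' (q $ 2)))\<^sup>2 =
      256 * \<bar>l\<bar> ^ 5 * det2 (\<alpha> (q $ 2)) (\<gamma> (q $ 2)) ^ 4 * (det2 (\<beta> (q $ 2)) (\<beta>' (q $ 2)))\<^sup>2"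
proof -
  define D where "D = det2 (\<alpha> (q $ 2)) (\<gamma> (q $ 2))"
  define B where "B = det2 (\<beta> (q $ 2)) (\<beta>' (q $ 2))"
  define r where "r = det2 (\<alpha> (q $ 2)) (\<alpha>' (q $ 2)) / D"
  define k where "k = 8 * l * D * B"
  have k0: "k \<noteq> 0" using d b l by (simp add: k_def D_def B_def)
  obtain s t where h: "\<And>u v. sff_at (ruled \<alpha> \<gamma> \<beta>) C q u v = (- 1 / l) *
    ((u $ 1 * v $ 2 + u $ 2 * v $ 1) * (r / 2) + u $ 2 * v $ 2 * s
      - (u $ 2 * v $ 3 + u $ 3 * v $ 2) * t + u $ 3 * v $ 3)"
    unfolding r_def D_def using sff_ruled[OF q d b, of C l, OF C l] by blast
  define H :: "real^3^3" where "H = vector [vector [0, (- 1 / l) * (r / 2), 0],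
     vector [(- 1 / l) * (r / 2), (- 1 / l) * s, (1 / l) * t], vector [0, (1 / l) * t, - 1 / l]]"
  have hH: "sff_at (ruled \<alpha> \<gamma> \<beta>) C q u v = u \<bullet> (H *v v)" for u v
    unfolding h by (simp add: H_def inner_vec_def matrix_vector_mult_def sum_3 algebra_simps)
  have dH: "det H = r\<^sup>2 / (4 * l ^ 3)"
    by (simp add: H_def det_3 power2_eq_square power3_eq_cube)
  have ind: "induced_volume (ruled \<alpha> \<gamma> \<beta>) C q u v w = det (vector [u, v, w] :: real^3^3) * k" for u v w
    unfolding induced_volume_ruled[OF q, of C l, OF C] k_def D_def B_def by simp
  have met: "metric_volume (ruled \<alpha> \<gamma> \<beta>) C q u v w =
      det (vector [u, v, w] :: real^3^3) * (sgn k * sqrt \<bar>det H\<bar>)" for u v w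
    unfolding metric_volume_def Let_def hH det_bilinear_form ind abs_mult real_sqrt_mult sgn_mult
    by (simp add: abs_sgn[symmetric] mult.assoc[symmetric]) (simp add: sgn_if)
  have "(\<forall>u v w. metric_volume (ruled \<alpha> \<gamma> \<beta>) C q u v w = induced_volume (ruled \<alpha> \<gamma> \<beta>) C q u v w)
    \<longleftrightarrow> sgn k * sqrt \<bar>det H\<bar> = k"
  proof
    assume "\<forall>u v w. metric_volume (ruled \<alpha> \<gamma> \<beta>) C q u v w = induced_volume (ruled \<alpha> \<gamma> \<beta>) C q u v w"
    then have "det (vector [vector [1, 0, 0], vector [0, 1, 0], vector [0, 0, 1]] :: real^3^3) * (sgn k * sqrt \<bar>det H\<bar>)
      = det (vector [vector [1, 0, 0], vector [0, 1, 0], vector [0, 0, 1]] :: real^3^3) * k"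
      unfolding met ind by blast
    then show "sgn k * sqrt \<bar>det H\<bar> = k" by (simp add: det_3)
  qed (simp add: met ind)
  also have "\<dots> \<longleftrightarrow> sqrt \<bar>det H\<bar> = \<bar>k\<bar>"
    using k0 by (auto simp: sgn_if)
  also have "\<dots> \<longleftrightarrow> \<bar>det H\<bar> = k\<^sup>2"
    by (metis abs_ge_zero power2_abs real_sqrt_abs real_sqrt_eq_iff)
  also have "\<dots> \<longleftrightarrow> r\<^sup>2 = 4 * \<bar>l\<bar> ^ 3 * k\<^sup>2"
    using l by (auto simp: dH abs_mult power_abs field_simps)
  also have "\<dots> \<longleftrightarrow> (det2 (\<alpha> (q $ 2)) (\<alpha>' (q $ 2)))\<^sup>2 = 4 * \<bar>l\<bar> ^ 3 * k\<^sup>2 * D\<^sup>2"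
    using d by (auto simp: r_def D_def power_divide field_simps)
  also have "4 * \<bar>l\<bar> ^ 3 * k\<^sup>2 * D\<^sup>2 = 256 * (\<bar>l\<bar> ^ 3 * \<bar>l\<bar>\<^sup>2) * D ^ 4 * B\<^sup>2"
    unfolding k_def power_mult_distrib power2_abs by (simp add: algebra_simps flip: power_add)
  also have "\<bar>l\<bar> ^ 3 * \<bar>l\<bar>\<^sup>2 = \<bar>l\<bar> ^ 5" by (simp only: power_add[symmetric]) simp
  finally show ?thesis by (simp add: D_def B_def)
qed

end

section \<open>Open subsets of coordinate space as manifolds\<close>

text \<open>Outside \<open>V\<close> the coordinate expression in the identity chart takes a default value, so the two maps
  have to be compared near points of the open set \<open>V\<close> only.\<close>

lemma in_chart_id: "q \<in> V \<Longrightarrow> in_chart (V, id) f q = f q"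
  using inv_into_f_f[of id V q] by (simp add: in_chart_def)

lemma image_of_chart_id [simp]: "image_of_chart (V, id) = V"
  by (simp add: image_of_chart_def)

lemma smooth_in_chart_id:
  "smooth_on V f \<Longrightarrow> smooth_on V (in_chart (V, id) f)"
  by (rule smooth_on_cong) (simp_all add: in_chart_id)

lemma push_in_chart_id:
  assumes "smooth_on V f" "q \<in> V" shows "push (in_chart (V, id) f) q = push f q"
  by (rule push_cong[OF smooth_on_open[OF assms(1)] assms(2)
        smooth_on_differentiable[OF smooth_in_chart_id[OF assms(1)] assms(2)]]) (rule in_chart_id)

lemma sff_at_in_chart_id:
  assumes "smooth_on V f" "q \<in> V"
  shows "sff_at (in_chart (V, id) f) (in_chart (V, id) C) q = sff_at f C q"
  by (rule sff_at_cong[OF smooth_in_chart_id[OF assms(1)] assms(2)]) (simp_all add: in_chart_id assms)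

lemma frechet_in_chart_id:
  assumes "smooth_on V f" "q \<in> V"
  shows "frechet_derivative (in_chart (V, id) f) (at q) = frechet_derivative f (at q)"
  by (rule frechet_derivative_transform_within_open[OF
        smooth_on_differentiable[OF smooth_in_chart_id[OF assms(1)] assms(2)]
        smooth_on_open[OF assms(1)] assms(2)]) (rule in_chart_id)

lemma open_set_manifold:
  fixes V :: "(real^3) set"
  assumes V: "open V" "connected V"
  shows "manifold3 (top_of_set V) {(V, id)}" "connected_space (top_of_set V)"
    "orientable3 (top_of_set V) {(V, id)}"
proof -
  have sid: "smooth_on V (id :: real^3 \<Rightarrow> real^3)" using smooth_on_id[OF V(1)] by (simp add: id_def)
  have at: "smooth_atlas (top_of_set V) {(V, id)}"
    using V smooth_in_chart_id[OF sid]
    by (simp add: smooth_atlas_def is_chart_def subtopology_subtopology)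
  have "second_countable (euclidean :: (real^3) topology)"
  proof -
    obtain B :: "(real^3) set set" where B: "countable B" "\<And>S. S \<in> B \<Longrightarrow> open S"
      "\<And>S. open S \<Longrightarrow> \<exists>U. U \<subseteq> B \<and> S = \<Union>U"
      using univ_second_countable by metis
    show ?thesis unfolding second_countable_def
    proof (intro exI[of _ B] conjI ballI allI impI)
      fix U x assume "openin euclidean U \<and> (x::real^3) \<in> U"
      then show "\<exists>S\<in>B. x \<in> S \<and> S \<subseteq> U" using B(3)[of U] by auto
    qed (use B in auto)
  qed
  moreover have "Hausdorff_space (euclidean :: (real^3) topology)"
    unfolding Hausdorff_space_def using hausdorff by (auto simp: disjnt_def) 
  ultimately show "manifold3 (top_of_set V) {(V, id)}"
    using at by (simp add: manifold3_def second_countable_subtopology Hausdorff_space_subtopology)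
  show "connected_space (top_of_set V)" using V(2) by (simp add: connected_space_subtopology)
  have "det (matrix (frechet_derivative (in_chart (V, id) (id :: real^3 \<Rightarrow> real^3)) (at p))) > 0" if "p \<in> V" for p
  proof -
    have "frechet_derivative (id :: real^3 \<Rightarrow> real^3) (at p) = id"
      using frechet_derivative_at[OF has_derivative_id] by (simp add: id_def)
    then show ?thesis by (simp add: frechet_in_chart_id[OF sid that] matrix_id_mat_1)
  qed
  then show "orientable3 (top_of_set V) {(V, id)}"
    using at unfolding orientable3_def by (intro exI[of _ "{(V, id)}"]) simp
qed

section \<open>The models are affine hyperspheres\<close>

text \<open>The square root of \<open>\<bar>t\<bar>\<close> is rewritten as \<open>exp (ln (t * t) / 4)\<close>, a composition of smooth functions where
  \<open>t \<noteq> 0\<close>.\<close>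

lemma smooth_model_B:
  assumes m: "model_data I \<alpha> \<beta> A E"
  shows "smooth_on I (model_B \<alpha> \<beta> E)"
proof -
  define t where "t y = det2 (\<alpha> y) (velocity \<alpha> y) * det2 (\<beta> y) (velocity \<beta> y)" for y
  have \<alpha>: "smooth_on I \<alpha>" and \<beta>: "smooth_on I \<beta>" and t0: "\<And>y. y \<in> I \<Longrightarrow> t y \<noteq> 0"
    using m by (auto simp: model_data_def t_def)
  have t: "smooth_on I t"
    unfolding t_def det2_eq
    by (intro smooth_on_mult smooth_on_diff smooth_on_component smooth_on_velocity \<alpha> \<beta>)
  have tt: "t y * t y > 0" if "y \<in> I" for y
    using t0[OF that] not_real_square_gt_zero[of "t y"] by blast
  have "smooth_on I (\<lambda>y. E * inverse (exp (ln (t y * t y) * (1 / 4))))"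
    by (intro smooth_on_mult smooth_on_inverse smooth_on_exp smooth_on_ln t
        smooth_on_const[OF smooth_on_open[OF t]]) (simp_all only: tt exp_not_eq_zero not_False_eq_True)
  moreover have "E * inverse (exp (ln (t y * t y) * (1 / 4))) = model_B \<alpha> \<beta> E y" if "y \<in> I" for y
  proof -
    have pos: "\<bar>t y\<bar> > 0" using t0[OF that] by simp
    have "ln (t y * t y) = ln \<bar>t y\<bar> + ln \<bar>t y\<bar>"
      using ln_mult_pos[OF pos pos] by (simp only: abs_mult_self_eq)
    then have "exp (ln (t y * t y) * (1 / 4)) * exp (ln (t y * t y) * (1 / 4)) = exp (ln \<bar>t y\<bar>)"
      unfolding exp_add[symmetric] by simp
    then have "exp (ln (t y * t y) * (1 / 4)) ^ 2 = \<bar>t y\<bar>"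
      using pos by (simp only: power2_eq_square exp_ln)
    then have "exp (ln (t y * t y) * (1 / 4)) = sqrt \<bar>t y\<bar>"
      by (rule real_sqrt_unique[symmetric]) (rule exp_ge_zero)
    then show ?thesis unfolding model_B_def divide_inverse t_def by (simp only:)
  qed
  ultimately show ?thesis by (rule smooth_on_cong)
qed

text \<open>For \<open>\<gamma> = A \<alpha> + B \<alpha>'\<close> one has \<open>det2 \<alpha> \<gamma> = B det2 \<alpha> \<alpha>'\<close>, and the Blaschke condition of the model turns into
  this equation for \<open>l\<close>.\<close>

lemma ex_model_curvature:
  assumes "E \<noteq> (0::real)" obtains l where "l > 0" "256 * l ^ 5 * E ^ 4 = 1"
proof
  have p: "1 / (256 * E ^ 4) > 0" using assms by simp
  show "root 5 (1 / (256 * E ^ 4)) > 0" using p by simp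
  have "root 5 (1 / (256 * E ^ 4)) ^ 5 = 1 / (256 * E ^ 4)" using p by (intro real_root_pow_pos) auto
  then show "256 * root 5 (1 / (256 * E ^ 4)) ^ 5 * E ^ 4 = 1" using assms by simp
qed

lemma Dist_plus_ruled:
  assumes "ruled_surface I \<alpha> \<gamma> \<beta>" and q: "q $ 2 \<in> I" and b: "det2 (\<beta> (q $ 2)) (velocity \<beta> (q $ 2)) \<noteq> 0"
  shows "Dist_plus (ruled \<alpha> \<gamma> \<beta>) q = span {vector [1, 0, 0]}"
proof -
  interpret ruled_surface I \<alpha> \<gamma> \<beta> by fact
  have neg: "- a = a \<longleftrightarrow> a = 0" for a :: "real^2" by (simp add: vec_eq_iff)
  have "v \<in> Dist_plus (ruled \<alpha> \<gamma> \<beta>) q \<longleftrightarrow> v \<in> span {vector [1, 0, 0]}" for v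
  proof -
    have "v \<in> Dist_plus (ruled \<alpha> \<gamma> \<beta>) q \<longleftrightarrow>
        - (v $ 2 *\<^sub>R velocity \<beta> (q $ 2) + v $ 3 *\<^sub>R \<beta> (q $ 2)) = v $ 2 *\<^sub>R velocity \<beta> (q $ 2) + v $ 3 *\<^sub>R \<beta> (q $ 2)"
      unfolding Dist_plus_iff[OF linear_push_ruled[OF q]] push_ruled[OF q] Jt_twist twist_eq_iff by simp
    also have "\<dots> \<longleftrightarrow> v $ 3 *\<^sub>R \<beta> (q $ 2) + v $ 2 *\<^sub>R velocity \<beta> (q $ 2) = 0"
      unfolding neg by (simp only: add.commute)
    also have "\<dots> \<longleftrightarrow> v $ 2 = 0 \<and> v $ 3 = 0" using det2_independent[OF b] by auto
    also have "\<dots> \<longleftrightarrow> v \<in> span {vector [1, 0, 0]}"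
      by (auto simp: span_singleton vec_eq_iff forall_3)
    finally show ?thesis .
  qed
  then show ?thesis by blast
qed

text \<open>The Blaschke field is \<open>- l\<close> times the position vector. Its image under \<open>Jt\<close> is \<open>l\<close> times the coordinate
  vector field of \<open>z\<close>.\<close>

lemma model_affine_hypersphere:
  assumes m: "model_data I \<alpha> \<beta> A E"
  obtains N where "affine_hypersphere (top_of_set (slab I)) {(slab I, id)} (model_f \<alpha> \<beta> A E) N"
    "Jt_tangent {(slab I, id)} (model_f \<alpha> \<beta> A E) N"
    "null_direction {(slab I, id)} (model_f \<alpha> \<beta> A E) N (D_plus (model_f \<alpha> \<beta> A E))"
proof -
  define \<gamma> where "\<gamma> y = A y *\<^sub>R \<alpha> y + model_B \<alpha> \<beta> E y *\<^sub>R velocity \<alpha> y" for y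
  define R where "R = ruled \<alpha> \<gamma> \<beta>"
  have f: "model_f \<alpha> \<beta> A E = R" unfolding model_f_eq_ruled R_def \<gamma>_def ..
  have \<alpha>: "smooth_on I \<alpha>" and \<beta>: "smooth_on I \<beta>" and A: "smooth_on I A" and E: "E \<noteq> 0"
    and I: "is_interval I" "open I" using m by (auto simp: model_data_def open_interval_def)
  have \<gamma>: "smooth_on I \<gamma>"
    unfolding \<gamma>_def by (intro smooth_on_add smooth_on_scaleR A \<alpha> smooth_on_velocity smooth_model_B[OF m])
  interpret ruled_surface I \<alpha> \<gamma> \<beta> by unfold_locales fact+
  let ?V = "slab I" and ?c = "(slab I, id :: real^3 \<Rightarrow> real^3)"
  have ab: "det2 (\<alpha> y) (velocity \<alpha> y) \<noteq> 0" "det2 (\<beta> y) (velocity \<beta> y) \<noteq> 0" if "y \<in> I" for y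
    using m that by (auto simp: model_data_def)
  have dg: "det2 (\<alpha> y) (\<gamma> y) = model_B \<alpha> \<beta> E y * det2 (\<alpha> y) (velocity \<alpha> y)" for y
    by (simp add: \<gamma>_def det2_eq algebra_simps)
  have d: "det2 (\<alpha> y) (\<gamma> y) \<noteq> 0" if "y \<in> I" for y
    unfolding dg using ab[OF that] E by (simp add: model_B_def)
  obtain l where l: "l > 0" "256 * l ^ 5 * E ^ 4 = 1" using ex_model_curvature[OF E] .
  define N where "N q = - l *\<^sub>R R q" for q
  have l0: "l \<noteq> 0" using l by simp
  have NR: "N q = - l *\<^sub>R ruled \<alpha> \<gamma> \<beta> q" for q by (simp add: N_def R_def)
  have qI: "q $ 2 \<in> I" if "q \<in> ?V" for q using that by (simp add: slab_def)
  have sR: "smooth_on ?V R" using smooth_ruled by (simp add: R_def)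
  have sN: "smooth_on ?V N"
    unfolding N_def by (intro smooth_on_scaleR smooth_on_const open_slab sR)
  have con: "connected ?V"
  proof -
    have "convex ?V"
      using convex_linear_vimage[of "\<lambda>q::real^3. q $ 2" I] I
      by (simp add: slab_def vimage_def is_interval_convex bounded_linear.linear[OF bounded_linear_vec_nth])
    then show ?thesis by (rule convex_connected)
  qed
  have pR: "push (in_chart ?c R) q = push R q" if "q \<in> ?V" for q by (rule push_in_chart_id[OF sR that])
  have lin: "linear (push R q)" if "q \<in> ?V" for q by (rule smooth_on_linear_push[OF sR that])
  have im: "immersed_at R q" if "q \<in> ?V" for q
    unfolding R_def using d[OF qI[OF that]] ab[OF qI[OF that]]
    by (intro immersed_ruled qI that) (auto simp: det2_eq)
  have tr: "transversal_at R N q" if "q \<in> ?V" for q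
    unfolding R_def by (rule transversal_ruled[OF qI[OF that] d[OF qI[OF that]] ab(2)[OF qI[OF that]], of N, OF NR l0])
  have nd: "nondegenerate_at R N q" if "q \<in> ?V" for q
    unfolding R_def nondegenerate_ruled_iff[OF qI[OF that] d[OF qI[OF that]] ab(2)[OF qI[OF that]], of N, OF NR l0]
    by (rule ab(1)[OF qI[OF that]])
  have vol: "metric_volume R N q u v w = induced_volume R N q u v w" if "q \<in> ?V" for q u v w
  proof -
    let ?y = "q $ 2"
    define a where "a = det2 (\<alpha> ?y) (velocity \<alpha> ?y)"
    define b where "b = det2 (\<beta> ?y) (velocity \<beta> ?y)"
    have ab0: "a \<noteq> 0" "b \<noteq> 0" using ab[OF qI[OF that]] by (simp_all add: a_def b_def)
    have "sqrt \<bar>a * b\<bar> ^ 4 = (sqrt \<bar>a * b\<bar> ^ 2) ^ 2"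
      by (simp only: power_mult[symmetric]) simp
    also have "\<dots> = (a * b)\<^sup>2" by (simp only: real_sqrt_pow2 abs_ge_zero power2_abs)
    finally have "sqrt \<bar>a * b\<bar> ^ 4 = (a * b)\<^sup>2" .
    then have "model_B \<alpha> \<beta> E ?y ^ 4 = E ^ 4 / (a * b) ^ 2"
      unfolding model_B_def a_def[symmetric] b_def[symmetric] power_divide by simp
    then have "(model_B \<alpha> \<beta> E ?y * a) ^ 4 * b\<^sup>2 = E ^ 4 / (a * b) ^ 2 * (a ^ 4 * b\<^sup>2)"
      by (simp only: power_mult_distrib mult.assoc)
    also have "\<dots> = E ^ 4 * a\<^sup>2"
      using ab0 by (simp add: power2_eq_square power4_eq_xxxx)
    finally have "256 * \<bar>l\<bar> ^ 5 * ((model_B \<alpha> \<beta> E ?y * a) ^ 4 * b\<^sup>2) = (256 * l ^ 5 * E ^ 4) * a\<^sup>2"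
      using l(1) by (simp only: abs_of_pos mult.assoc)
    then have "a\<^sup>2 = 256 * \<bar>l\<bar> ^ 5 * det2 (\<alpha> ?y) (\<gamma> ?y) ^ 4 * b\<^sup>2"
      unfolding l(2) dg a_def by (simp only: mult.assoc mult_1_left)
    then show ?thesis
      using blaschke_volume_ruled_iff[OF qI[OF that] d[OF qI[OF that]] ab(2)[OF qI[OF that]], of N, OF NR l0]
      unfolding R_def a_def b_def by blast
  qed
  have DN: "frechet_derivative N (at q) v = push R q (- l *\<^sub>R v)" if "q \<in> ?V" for q v
  proof -
    have *: "(N has_derivative (\<lambda>v. - l *\<^sub>R push R q v)) (at q)"
      unfolding N_def push_def by (intro has_derivative_scaleR_right smooth_on_has_derivative[OF sR that])
    show ?thesis
      unfolding frechet_derivative_at[OF *, symmetric] by (rule linear_cmul[OF lin[OF that], symmetric])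
  qed
  have DN': "flat_D (\<lambda>_. v) (in_chart ?c N) q = push R q (- l *\<^sub>R v)" if "q \<in> ?V" for q v
    unfolding flat_D_def frechet_in_chart_id[OF sN that] by (rule DN[OF that])
  have sm: "smooth_on ?V (in_chart ?c R)" "smooth_on ?V (in_chart ?c N)"
    by (rule smooth_in_chart_id[OF sR], rule smooth_in_chart_id[OF sN])
  have im': "immersed_at (in_chart ?c R) q" if "q \<in> ?V" for q
    using im[OF that] by (simp add: immersed_at_def pR[OF that])
  have tr': "transversal_at (in_chart ?c R) (in_chart ?c N) q" if "q \<in> ?V" for q
    using tr[OF that] by (simp add: transversal_at_def pR[OF that] in_chart_id[OF that])
  have nd': "nondegenerate_at (in_chart ?c R) (in_chart ?c N) q" if "q \<in> ?V" for q
    using nd[OF that] by (simp add: nondegenerate_at_def sff_at_in_chart_id[OF sR that])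
  have ind: "induced_volume (in_chart ?c R) (in_chart ?c N) q = induced_volume R N q" if "q \<in> ?V" for q
    by (intro ext) (simp add: induced_volume_def pR[OF that] in_chart_id[OF that])
  have vol': "metric_volume (in_chart ?c R) (in_chart ?c N) q u v w =
      induced_volume (in_chart ?c R) (in_chart ?c N) q u v w" if "q \<in> ?V" for q u v w
    using vol[OF that, of u v w] by (simp add: metric_volume_def ind[OF that] sff_at_in_chart_id[OF sR that])
  have lin': "linear (push (in_chart ?c R) q)" if "q \<in> ?V" for q using lin[OF that] by (simp add: pR[OF that])
  have tau: "transv_form (in_chart ?c R) (in_chart ?c N) (\<lambda>_. v) q = 0" if "q \<in> ?V" for q v
    unfolding transv_form_def DN'[OF that]
    by (rule transv_part_eqI[OF lin'[OF that] tr'[OF that], of _ "- l *\<^sub>R v"]) (simp add: pR[OF that])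
  have shape: "shape_op (in_chart ?c R) (in_chart ?c N) (\<lambda>_. v) q = l *\<^sub>R v" if "q \<in> ?V" for q v
  proof -
    have "tan_part (in_chart ?c R) (in_chart ?c N) q (push R q (- l *\<^sub>R v)) = - l *\<^sub>R v"
      by (rule tan_part_eqI[OF lin'[OF that] im'[OF that] tr'[OF that], of _ _ 0]) (simp add: pR[OF that])
    then show ?thesis by (simp add: shape_op_def DN'[OF that])
  qed
  have "affine_hypersphere (top_of_set ?V) {?c} R N"
    unfolding affine_hypersphere_def
  proof (intro conjI)
    show "\<exists>l. \<forall>c\<in>{?c}. \<forall>p\<in>image_of_chart c. \<forall>v. shape_op (in_chart c R) (in_chart c N) (\<lambda>_. v) p = l *\<^sub>R v"
      using shape by auto
  qed (auto simp: open_set_manifold[OF open_slab con] immersion_def smooth_map_def sm im' nondegenerate_def nd'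
      blaschke_field_def transversal_field_def tr' tau vol')
  moreover have "Jt_tangent {?c} R N"
    unfolding Jt_tangent_def
  proof (intro ballI)
    fix c q assume "c \<in> {?c}" "q \<in> image_of_chart c"
    then have c: "c = ?c" and q: "q \<in> ?V" by auto
    have "Jt (N q) = push R q (vector [0, 0, l])"
      unfolding NR R_def push_ruled[OF qI[OF q]] ruled_def twist_scaleR Jt_twist by (simp add: twist_eq_iff)
    then show "Jt (in_chart c N q) \<in> range (push (in_chart c R) q)"
      by (simp add: c in_chart_id[OF q] pR[OF q])
  qed
  moreover have "null_direction {?c} R N (D_plus R)"
  proof -
    have D: "D_plus R ?c q = span {vector [1, 0, 0]}" if "q \<in> ?V" for q
    proof -
      have "D_plus R ?c q = Dist_plus R q"
        by (simp add: D_plus_def Dist_plus_def Dist_def pR[OF that])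
      then show ?thesis
        using Dist_plus_ruled[OF ruled_surface_axioms qI[OF that] ab(2)[OF qI[OF that]]] by (simp add: R_def)
    qed
    have "smooth_line_distribution ?V (D_plus R ?c)"
      unfolding smooth_line_distribution_def
      by (intro ballI exI[of _ ?V] exI[of _ "\<lambda>_. vector [1, 0, 0]"])
        (auto simp: D smooth_on_const[OF open_slab] vec_eq_iff forall_3)
    moreover have "sff_at (in_chart ?c R) (in_chart ?c N) q v v = 0"
      if q: "q \<in> ?V" and v: "v \<in> D_plus R ?c q" for q v
    proof -
      obtain k where k: "v = k *\<^sub>R vector [1, 0, 0]" using v by (auto simp: D[OF q] span_singleton)
      obtain s t where "sff_at (ruled \<alpha> \<gamma> \<beta>) N q v v = (- 1 / l) *
        ((v $ 1 * v $ 2 + v $ 2 * v $ 1) * (det2 (\<alpha> (q $ 2)) (\<alpha>' (q $ 2)) / det2 (\<alpha> (q $ 2)) (\<gamma> (q $ 2)) / 2)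
          + v $ 2 * v $ 2 * s - (v $ 2 * v $ 3 + v $ 3 * v $ 2) * t + v $ 3 * v $ 3)"
        using sff_ruled[OF qI[OF q] d[OF qI[OF q]] ab(2)[OF qI[OF q]], of N, OF NR l0] by metis
      then have "sff_at R N q v v = 0" by (simp add: R_def k)
      then show ?thesis unfolding sff_at_in_chart_id[OF sR q] .
    qed
    ultimately show ?thesis by (auto simp: null_direction_def)
  qed
  ultimately show thesis using that[of N] by (simp add: f)
qed

section \<open>Boxes in coordinate space\<close>

lemma open_contains_centred_box:
  fixes W :: "(real^'n) set"
  assumes "open W" "p \<in> W"
  obtains d where "d > 0" "box (\<chi> i. p $ i - d) (\<chi> i. p $ i + d) \<subseteq> W"
proof -
  obtain r where r: "r > 0" "ball p r \<subseteq> W" using assms openE by blast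
  define d where "d = r / real (CARD('n))"
  have "q \<in> ball p r" if "q \<in> box (\<chi> i. p $ i - d) (\<chi> i. p $ i + d)" for q
  proof -
    have "norm (p - q) \<le> (\<Sum>i\<in>UNIV. \<bar>(p - q) $ i\<bar>)" by (rule norm_le_l1_cart)
    also have "\<dots> < (\<Sum>i\<in>(UNIV :: 'n set). d)"
    proof (rule sum_strict_mono)
      fix i
      have "p $ i - d < q $ i \<and> q $ i < p $ i + d" using that by (simp add: mem_box_cart)
      then show "\<bar>(p - q) $ i\<bar> < d" by (simp add: abs_less_iff)
    qed auto
    also have "\<dots> = r" by (simp add: d_def)
    finally show ?thesis by (simp add: dist_norm)
  qed
  then show thesis using that[of d] r by (force simp: d_def)
qed

lemma constant_along_segment:
  fixes g :: "real^3 \<Rightarrow> real"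
  assumes g: "smooth_on B g" and B: "convex B" and pq: "p \<in> B" "q \<in> B"
    and z: "\<And>t. 0 \<le> t \<Longrightarrow> t \<le> 1 \<Longrightarrow> frechet_derivative g (at (p + t *\<^sub>R (q - p))) (q - p) = 0"
  shows "g q = g p"
proof -
  let ?s = "\<lambda>t. p + t *\<^sub>R (q - p)"
  have "((\<lambda>t. g (?s t)) has_derivative (\<lambda>h. 0)) (at t within {0..1})" if t: "t \<in> {0..1}" for t
  proof -
    have "?s t = (1 - t) *\<^sub>R p + t *\<^sub>R q" by (simp add: algebra_simps)
    then have "?s t \<in> B" using convexD_alt[OF B pq, of t] t by simp
    note d = smooth_on_has_derivative[OF g this]
    have "(?s has_derivative (\<lambda>h. h *\<^sub>R (q - p))) (at t)"
      by (auto intro!: derivative_eq_intros)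
    from has_derivative_compose[OF this d]
    have "((\<lambda>t. g (?s t)) has_derivative (\<lambda>h. frechet_derivative g (at (?s t)) (h *\<^sub>R (q - p)))) (at t)" .
    moreover have "frechet_derivative g (at (?s t)) (h *\<^sub>R (q - p)) = 0" for h
      using z[of t] t linear_cmul[OF has_derivative_linear[OF d]] by simp
    ultimately show ?thesis by (simp add: has_derivative_at_withinI)
  qed
  from has_derivative_zero_unique[of "{0..1}" "\<lambda>t. g (?s t)" 1 0, OF _ this]
  show ?thesis by simp
qed

section \<open>Normal form of the coordinate expression\<close>

lemma frechet_of_twist:
  assumes B: "open B" and Q: "smooth_on B Q"
    and G: "\<And>q. q \<in> B \<Longrightarrow> G q = twist (q $ 3) (q $ 1 *\<^sub>R a + Q q *\<^sub>R b) (- (e + q $ 2 *\<^sub>R e'))"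
    and q: "q \<in> B"
  shows "push G q v = twist (q $ 3)
    (v $ 1 *\<^sub>R a + frechet_derivative Q (at q) v *\<^sub>R b - v $ 3 *\<^sub>R (q $ 1 *\<^sub>R a + Q q *\<^sub>R b))
    (- (v $ 2 *\<^sub>R e' + v $ 3 *\<^sub>R (e + q $ 2 *\<^sub>R e')))"
proof -
  have "((\<lambda>q. twist (q $ 3) (q $ 1 *\<^sub>R a + Q q *\<^sub>R b) (- (e + q $ 2 *\<^sub>R e'))) has_derivative
    (\<lambda>v. twist (q $ 3) ((v $ 1 *\<^sub>R a + frechet_derivative Q (at q) v *\<^sub>R b) - v $ 3 *\<^sub>R (q $ 1 *\<^sub>R a + Q q *\<^sub>R b))
      (- (0 + v $ 2 *\<^sub>R e') + v $ 3 *\<^sub>R (- (e + q $ 2 *\<^sub>R e'))))) (at q)"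
    by (intro has_derivative_twist has_derivative_add has_derivative_minus has_derivative_scaleR_left
        has_derivative_component smooth_on_has_derivative[OF Q q] has_derivative_const)
  then have "(G has_derivative
    (\<lambda>v. twist (q $ 3) ((v $ 1 *\<^sub>R a + frechet_derivative Q (at q) v *\<^sub>R b) - v $ 3 *\<^sub>R (q $ 1 *\<^sub>R a + Q q *\<^sub>R b))
      (- (0 + v $ 2 *\<^sub>R e') + v $ 3 *\<^sub>R (- (e + q $ 2 *\<^sub>R e'))))) (at q)"
    by (rule has_derivative_transform_within_open[OF _ B q]) (simp add: G)
  from frechet_derivative_at[OF this, symmetric] show ?thesis
    unfolding push_def by (simp add: algebra_simps)
qed

text \<open>Here \<open>e + y e'\<close> with constant \<open>e\<close>, \<open>e'\<close> is a straight-line choice of the curve \<open>- \<beta>\<close>.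
  Invariance under the flow makes \<open>Q\<close> independent of the third coordinate, and the null condition
  for the first coordinate direction makes it affine in the first coordinate.\<close>

lemma twist_normal_form:
  assumes B: "B = box lo hi" and p: "p \<in> B" and Q: "smooth_on B Q"
    and ab: "det2 a b = 1" and ee: "det2 e e' = 1"
    and G: "\<And>q. q \<in> B \<Longrightarrow> G q = twist (q $ 3) (q $ 1 *\<^sub>R a + Q q *\<^sub>R b) (- (e + q $ 2 *\<^sub>R e'))"
    and im: "\<And>q. q \<in> B \<Longrightarrow> immersed_at G q"
    and tr: "\<And>q. q \<in> B \<Longrightarrow> transversal_at G C q"
    and J: "\<And>q. q \<in> B \<Longrightarrow> Jt (G q) \<in> range (push G q)"
    and null: "\<And>q v. q \<in> B \<Longrightarrow> Jt (push G q v) = push G q v \<Longrightarrow> sff_at G C q v v = 0"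
  obtains k c where "smooth_on {lo $ 2<..<hi $ 2} k" "smooth_on {lo $ 2<..<hi $ 2} c"
    "\<And>q. q \<in> B \<Longrightarrow> Q q = q $ 1 * k (q $ 2) + c (q $ 2)"
proof -
  have oB: "open B" and cB: "convex B" by (simp_all add: B open_box convex_box)
  have push: "push G q v = twist (q $ 3)
      (v $ 1 *\<^sub>R a + frechet_derivative Q (at q) v *\<^sub>R b - v $ 3 *\<^sub>R (q $ 1 *\<^sub>R a + Q q *\<^sub>R b))
      (- (v $ 2 *\<^sub>R e' + v $ 3 *\<^sub>R (e + q $ 2 *\<^sub>R e')))" if "q \<in> B" for q v
    by (rule frechet_of_twist[OF oB Q G that])
  have lG: "linear (push G q)" if "q \<in> B" for q
  proof -
    have "smooth_on B (\<lambda>q. q $ i)" for i by (rule smooth_on_component[OF smooth_on_id[OF oB]])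
    then have "smooth_on B (\<lambda>q. twist (q $ 3) (q $ 1 *\<^sub>R a + Q q *\<^sub>R b) (- (e + q $ 2 *\<^sub>R e')))"
      unfolding twist_def
      by (intro smooth_on_diff smooth_on_scaleR smooth_on_exp smooth_on_minus
        smooth_on_bounded_linear[OF bounded_linear_eigen(1)]
        smooth_on_bounded_linear[OF bounded_linear_eigen(2)] smooth_on_add Q smooth_on_const[OF oB])
    then have "smooth_on B G" by (rule smooth_on_cong) (simp add: G)
    then show ?thesis by (rule smooth_on_linear_push[OF _ that])
  qed
  have ab0: "det2 a b \<noteq> 0" using ab by simp
  define e1 e3 :: "real^3" where "e1 = vector [1, 0, 0]" and "e3 = vector [0, 0, 1]"
  have e1s: "e1 $ 1 = 1" "e1 $ 2 = 0" "e1 $ 3 = 0" and e3s: "e3 $ 1 = 0" "e3 $ 2 = 0" "e3 $ 3 = 1"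
    by (simp_all add: e1_def e3_def)
  define Q1 where "Q1 q = frechet_derivative Q (at q) e1" for q
  have Q1: "smooth_on B Q1" unfolding Q1_def by (rule smooth_on_frechet_derivative[OF Q])
  have lQ: "linear (frechet_derivative Q (at q))" if "q \<in> B" for q
    by (rule has_derivative_linear[OF smooth_on_has_derivative[OF Q that]])
  have em: "y = 0 \<and> x = 0" if "y *\<^sub>R e' + x *\<^sub>R (e + r *\<^sub>R e') = 0" for x y r
  proof -
    have "x *\<^sub>R e + (y + x * r) *\<^sub>R e' = y *\<^sub>R e' + x *\<^sub>R (e + r *\<^sub>R e')"
      by (simp add: algebra_simps)
    then have "x = 0" "y + x * r = 0" using det2_independent[of e e'] ee that by auto
    then show ?thesis by simp
  qed
  (* the tangent vector mapped to Jt (G q) can only be - e3 *)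
  have Q3: "frechet_derivative Q (at q) e3 = 0" if q: "q \<in> B" for q
  proof -
    obtain v where v: "Jt (G q) = push G q v" using J[OF q] by blast
    have *: "q $ 1 *\<^sub>R a + Q q *\<^sub>R b =
        v $ 1 *\<^sub>R a + frechet_derivative Q (at q) v *\<^sub>R b - v $ 3 *\<^sub>R (q $ 1 *\<^sub>R a + Q q *\<^sub>R b)"
      "e + q $ 2 *\<^sub>R e' = - (v $ 2 *\<^sub>R e' + v $ 3 *\<^sub>R (e + q $ 2 *\<^sub>R e'))"
      using v unfolding G[OF q] push[OF q] Jt_twist twist_eq_iff minus_minus by blast+
    have "v $ 2 *\<^sub>R e' + (v $ 3 + 1) *\<^sub>R (e + q $ 2 *\<^sub>R e')
        = (e + q $ 2 *\<^sub>R e') - (- (v $ 2 *\<^sub>R e' + v $ 3 *\<^sub>R (e + q $ 2 *\<^sub>R e')))"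
      by (simp add: algebra_simps)
    also have "\<dots> = 0" unfolding *(2)[symmetric] by simp
    finally have v23: "v $ 2 = 0" "v $ 3 = - 1" using em by fastforce+
    have "v $ 1 *\<^sub>R a + frechet_derivative Q (at q) v *\<^sub>R b =
        (v $ 1 *\<^sub>R a + frechet_derivative Q (at q) v *\<^sub>R b - v $ 3 *\<^sub>R (q $ 1 *\<^sub>R a + Q q *\<^sub>R b))
        - (q $ 1 *\<^sub>R a + Q q *\<^sub>R b)"
      by (simp add: v23)
    also have "\<dots> = 0" unfolding *(1)[symmetric] by simp
    finally have v1: "v $ 1 = 0" "frechet_derivative Q (at q) v = 0"
      using det2_independent[OF ab0] by blast+
    have "v = (- 1) *\<^sub>R e3" using v23 v1 by (simp add: vec_eq_iff forall_3 e3s)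
    then show ?thesis using v1(2) linear_cmul[OF lQ[OF q], of "- 1" e3] by simp
  qed
  (* e1 spans the null direction, so the second derivative along it is tangent; its em-component is
     zero and its ep-component is a multiple of b, which no nonzero tangent vector achieves *)
  have Q11: "frechet_derivative Q1 (at q) e1 = 0" if q: "q \<in> B" for q
  proof -
    have p1: "push G r e1 = twist (r $ 3) (a + Q1 r *\<^sub>R b) 0" if "r \<in> B" for r
      unfolding push[OF that] by (simp add: e1s Q1_def)
    have "((\<lambda>r. twist (r $ 3) (a + Q1 r *\<^sub>R b) 0) has_derivative (\<lambda>v. twist (q $ 3)
        (0 + frechet_derivative Q1 (at q) v *\<^sub>R b - v $ 3 *\<^sub>R (a + Q1 q *\<^sub>R b)) (0 + v $ 3 *\<^sub>R 0))) (at q)"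
      by (intro has_derivative_twist has_derivative_add has_derivative_const has_derivative_scaleR_left
        smooth_on_has_derivative[OF Q1 q])
    then have d: "((\<lambda>r. push G r e1) has_derivative (\<lambda>v. twist (q $ 3)
        (0 + frechet_derivative Q1 (at q) v *\<^sub>R b - v $ 3 *\<^sub>R (a + Q1 q *\<^sub>R b)) (0 + v $ 3 *\<^sub>R 0))) (at q)"
      by (rule has_derivative_transform_within_open[OF _ oB q]) (simp add: p1)
    let ?w = "twist (q $ 3) (frechet_derivative Q1 (at q) e1 *\<^sub>R b) 0"
    have "flat_D (\<lambda>_. e1) (\<lambda>r. push G r e1) q = ?w"
      unfolding flat_D_def frechet_derivative_at[OF d, symmetric] by (simp add: e1s)
    then have "sff_at G C q e1 e1 = transv_part G C q ?w" by (simp add: sff_at_def sff_def)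
    moreover have "sff_at G C q e1 e1 = 0" by (rule null[OF q]) (simp add: p1[OF q] Jt_twist)
    ultimately have t: "transv_part G C q ?w = 0" by simp
    obtain v where "?w = push G q v + transv_part G C q ?w *\<^sub>R C q"
      by (rule transv_part_decomposition[OF lG[OF q] im[OF q] tr[OF q]])
    then have w: "?w = push G q v" unfolding t by simp
    have "v $ 2 *\<^sub>R e' + v $ 3 *\<^sub>R (e + q $ 2 *\<^sub>R e') = 0"
      using w unfolding push[OF q] twist_eq_iff by (metis neg_0_equal_iff_equal)
    then have v23: "v $ 2 = 0" "v $ 3 = 0" using em by blast+
    then have "frechet_derivative Q1 (at q) e1 *\<^sub>R b = v $ 1 *\<^sub>R a + frechet_derivative Q (at q) v *\<^sub>R b"
      using w unfolding push[OF q] twist_eq_iff by simp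
    then have "v $ 1 *\<^sub>R a + (frechet_derivative Q (at q) v - frechet_derivative Q1 (at q) e1) *\<^sub>R b = 0"
      by (simp add: algebra_simps)
    from det2_independent[OF ab0 this]
    have *: "v $ 1 = 0" "frechet_derivative Q (at q) v - frechet_derivative Q1 (at q) e1 = 0" .
    have "v = 0" using v23 *(1) by (simp add: vec_eq_iff forall_3)
    then show ?thesis using *(2) linear_0[OF lQ[OF q]] by simp
  qed
  define I where "I = {lo $ 2<..<hi $ 2}"
  define s :: "real \<Rightarrow> real^3" where "s y = vector [p $ 1, y, p $ 3]" for y
  have sB: "s y \<in> B" if "y \<in> I" for y
    using that p by (simp add: I_def s_def B mem_box_cart forall_3)
  have sI: "smooth_on I s"
  proof (rule smooth_on_componentwise)
    show oI: "open I" by (simp add: I_def)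
    have "smooth_on I (\<lambda>y. y)" by (rule smooth_on_id[OF oI])
    then show "smooth_on I (\<lambda>y. s y $ i)" for i
      using exhaust_3[of i] by (auto simp: s_def smooth_on_const[OF oI])
  qed
  define k where "k y = Q1 (s y)" for y
  define c where "c y = Q (s y) - p $ 1 * k y" for y
  have k: "smooth_on I k" unfolding k_def by (rule smooth_on_compose[OF sI Q1 sB])
  have c: "smooth_on I c"
    unfolding c_def
    by (intro smooth_on_diff smooth_on_mult smooth_on_compose[OF sI Q sB] k
        smooth_on_const[OF smooth_on_open[OF k]])
  have "Q q = q $ 1 * k (q $ 2) + c (q $ 2)" if q: "q \<in> B" for q
  proof -
    let ?y = "q $ 2"
    have y: "?y \<in> I" using q by (simp add: B I_def mem_box_cart)
    define q' :: "real^3" where "q' = vector [q $ 1, ?y, p $ 3]"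
    have q's: "q' $ 1 = q $ 1" "q' $ 2 = ?y" "q' $ 3 = p $ 3" by (simp_all add: q'_def)
    have q'B: "q' \<in> B" using p q by (simp add: q's B mem_box_cart forall_3)
    have seg: "x + t *\<^sub>R (x' - x) \<in> B" if "x \<in> B" "x' \<in> B" "0 \<le> t" "t \<le> 1" for x x' and t :: real
    proof -
      have "x + t *\<^sub>R (x' - x) = (1 - t) *\<^sub>R x + t *\<^sub>R x'" by (simp add: algebra_simps)
      then show ?thesis using convexD_alt[OF cB that(1,2), of t] that by simp
    qed
    have dq: "q - q' = (q $ 3 - p $ 3) *\<^sub>R e3" by (simp add: vec_eq_iff forall_3 q's e3s)
    have d0: "frechet_derivative Q (at r) (q - q') = 0" if "r \<in> B" for r
      unfolding dq by (simp add: linear_cmul[OF lQ[OF that]] Q3[OF that])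
    have 1: "Q q = Q q'" by (intro constant_along_segment[OF Q cB q'B q] d0 seg[OF q'B q])
    have dir: "x - s ?y = (x $ 1 - p $ 1) *\<^sub>R e1" if "x $ 2 = ?y" "x $ 3 = p $ 3" for x
      using that by (simp add: vec_eq_iff forall_3 s_def e1s)
    have Q1k: "Q1 x = k ?y" if x: "x \<in> B" "x $ 2 = ?y" "x $ 3 = p $ 3" for x
    proof -
      have d1: "frechet_derivative Q1 (at r) (x - s ?y) = 0" if "r \<in> B" for r
        unfolding dir[OF x(2,3)]
        by (simp add: linear_cmul[OF has_derivative_linear[OF smooth_on_has_derivative[OF Q1 that]]] Q11[OF that])
      show ?thesis unfolding k_def
        by (intro constant_along_segment[OF Q1 cB sB[OF y] x(1)] d1 seg[OF sB[OF y] x(1)])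
    qed
    define g where "g x = Q x - k ?y * x $ 1" for x
    have sg: "smooth_on B g"
      unfolding g_def
      by (intro smooth_on_diff smooth_on_mult Q smooth_on_const[OF oB] smooth_on_component[OF smooth_on_id[OF oB]])
    have "g q' = g (s ?y)"
    proof (rule constant_along_segment[OF sg cB sB[OF y] q'B])
      fix t :: real assume t: "0 \<le> t" "t \<le> 1"
      let ?r = "s ?y + t *\<^sub>R (q' - s ?y)"
      have r: "?r \<in> B" by (rule seg[OF sB[OF y] q'B t])
      have "?r $ 2 = ?y" "?r $ 3 = p $ 3" by (simp_all add: s_def q's)
      then have Q1r: "frechet_derivative Q (at ?r) e1 = k ?y" using Q1k[OF r] by (simp add: Q1_def)
      have "(g has_derivative (\<lambda>v. frechet_derivative Q (at ?r) v - k ?y * v $ 1)) (at ?r)"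
        unfolding g_def
        by (intro has_derivative_diff smooth_on_has_derivative[OF Q r] has_derivative_mult_right
            has_derivative_component)
      note dg = frechet_derivative_at[OF this, symmetric]
      show "frechet_derivative g (at ?r) (q' - s ?y) = 0"
      proof -
        have "frechet_derivative Q (at ?r) (q' - s ?y) =
            frechet_derivative Q (at ?r) ((q' $ 1 - p $ 1) *\<^sub>R e1)"
          by (rule arg_cong[OF dir[OF q's(2,3)]])
        also have "\<dots> = (q' $ 1 - p $ 1) *\<^sub>R k ?y"
          by (simp only: linear_cmul[OF lQ[OF r]] Q1r)
        finally show ?thesis unfolding dg by (simp add: s_def)
      qed
    qed
    then have "Q q' - k ?y * q $ 1 = Q (s ?y) - k ?y * p $ 1" by (simp add: g_def q's s_def)
    then show ?thesis using 1 by (simp add: c_def algebra_simps)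
  qed
  with k c show thesis using that unfolding I_def by blast
qed

section \<open>Ruled affine hyperspheres are models\<close>

lemma velocity_of_derivative:
  assumes "(\<gamma> has_derivative (\<lambda>t. t *\<^sub>R v)) (at y)" shows "velocity \<gamma> y = v"
  unfolding velocity_def using assms by (intro vector_derivative_at) (simp add: has_vector_derivative_def)

text \<open>A continuous function with at most two values on a connected set is constant.\<close>

lemma constant_of_constant_power:
  fixes g :: "real \<Rightarrow> real"
  assumes I: "connected I" and g: "continuous_on I g" and c: "\<And>y. y \<in> I \<Longrightarrow> g y ^ 4 = r"
  obtains E where "\<And>y. y \<in> I \<Longrightarrow> g y = E"
proof -
  have "g ` I \<subseteq> {root 4 r, - root 4 r}"
  proof
    fix x assume "x \<in> g ` I"
    then have "x ^ 4 = r" using c by blast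
    then have "root 4 r = \<bar>x\<bar>" using real_root_power_cancel[of 4 "\<bar>x\<bar>"] by (simp add: power_even_abs)
    then show "x \<in> {root 4 r, - root 4 r}" by (auto simp: abs_if split: if_splits)
  qed
  then have "finite (g ` I)" using finite_subset by blast
  then have "g constant_on I" using I g continuous_finite_range_constant_eq[of I] by blast
  then show thesis using that by (auto simp: constant_on_def)
qed

text \<open>Here \<open>\<alpha>' = k' b\<close>, so \<open>\<gamma> = c b\<close> is \<open>A \<alpha> + B \<alpha>'\<close> with \<open>A = 0\<close> and
  \<open>B = c / k'\<close>. The constant must therefore be \<open>g = c sqrt \<bar>k'\<bar> / k'\<close>, and the Blaschke condition
  \<open>k'\<^sup>2 = 256 \<bar>l\<bar>^5 c^4\<close> says that its fourth power is constant.\<close>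

lemma ruled_eq_model:
  fixes k c :: "real \<Rightarrow> real"
  assumes I: "open_interval I" and k: "smooth_on I k" and c: "smooth_on I c"
    and ab: "det2 a b = 1" and ee: "det2 e e' = 1" and l: "l \<noteq> 0"
  defines "\<alpha> \<equiv> \<lambda>y. a + k y *\<^sub>R b" and "\<gamma> \<equiv> \<lambda>y. c y *\<^sub>R b" and "\<beta> \<equiv> \<lambda>y. - (e + y *\<^sub>R e')"
  assumes pt: "\<And>y. y \<in> I \<Longrightarrow> \<exists>q. q $ 2 = y \<and> C q = - l *\<^sub>R ruled \<alpha> \<gamma> \<beta> q \<and>
      transversal_at (ruled \<alpha> \<gamma> \<beta>) C q \<and> nondegenerate_at (ruled \<alpha> \<gamma> \<beta>) C q \<and>
      (\<forall>u v w. metric_volume (ruled \<alpha> \<gamma> \<beta>) C q u v w = induced_volume (ruled \<alpha> \<gamma> \<beta>) C q u v w)"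
  obtains E where "model_data I \<alpha> \<beta> (\<lambda>_. 0) E"
    "\<And>q. q $ 2 \<in> I \<Longrightarrow> model_f \<alpha> \<beta> (\<lambda>_. 0) E q = ruled \<alpha> \<gamma> \<beta> q"
proof -
  have oI: "open I" and iI: "is_interval I" and nI: "I \<noteq> {}" using I by (auto simp: open_interval_def)
  have \<alpha>: "smooth_on I \<alpha>" and \<gamma>: "smooth_on I \<gamma>" and \<beta>: "smooth_on I \<beta>"
    unfolding \<alpha>_def \<gamma>_def \<beta>_def
    by (intro smooth_on_add smooth_on_minus smooth_on_scaleR smooth_on_const[OF oI] smooth_on_id[OF oI] k c)+
  interpret ruled_surface I \<alpha> \<gamma> \<beta> by unfold_locales fact+
  define k' where "k' y = frechet_derivative k (at y) 1" for y
  have k': "smooth_on I k'" unfolding k'_def by (rule smooth_on_frechet_derivative[OF k])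
  have v\<alpha>: "velocity \<alpha> y = k' y *\<^sub>R b" if "y \<in> I" for y
  proof (rule velocity_of_derivative)
    have d: "(k has_derivative frechet_derivative k (at y)) (at y)" by (rule smooth_on_has_derivative[OF k that])
    have "(\<alpha> has_derivative (\<lambda>t. 0 + frechet_derivative k (at y) t *\<^sub>R b)) (at y)"
      unfolding \<alpha>_def by (intro has_derivative_add has_derivative_const has_derivative_scaleR_left d)
    moreover have "frechet_derivative k (at y) t = t * k' y" for t
      using linear_cmul[OF has_derivative_linear[OF d], of t 1] by (simp add: k'_def)
    ultimately show "(\<alpha> has_derivative (\<lambda>t. t *\<^sub>R k' y *\<^sub>R b)) (at y)" by simp
  qed
  have v\<beta>: "velocity \<beta> y = - e'" for y
  proof (rule velocity_of_derivative)
    have "(\<beta> has_derivative (\<lambda>t. - (0 + t *\<^sub>R e'))) (at y)"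
      unfolding \<beta>_def by (intro has_derivative_minus has_derivative_add has_derivative_const
          has_derivative_scaleR_left has_derivative_ident)
    then show "(\<beta> has_derivative (\<lambda>t. t *\<^sub>R (- e'))) (at y)" by simp
  qed
  have lin2: "det2 (u + r *\<^sub>R v) (t *\<^sub>R v) = t * det2 u v" for u v r t
    by (simp add: det2_eq algebra_simps)
  have b1: "det2 (\<beta> y) (velocity \<beta> y) = 1" for y
  proof -
    have "det2 (\<beta> y) (velocity \<beta> y) = det2 (- (e + y *\<^sub>R e')) (- e')"
      unfolding v\<beta> by (simp only: \<beta>_def)
    also have "\<dots> = det2 (e + y *\<^sub>R e') (1 *\<^sub>R e')" by (simp add: det2_eq algebra_simps)
    finally show ?thesis unfolding lin2 ee by simp
  qed
  have a1: "det2 (\<alpha> y) (velocity \<alpha> y) = k' y" if "y \<in> I" for y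
    unfolding v\<alpha>[OF that] unfolding \<alpha>_def lin2 ab by simp
  have g1: "det2 (\<alpha> y) (\<gamma> y) = c y" for y
    unfolding \<alpha>_def \<gamma>_def lin2 ab by simp
  have ab1: "det2 (\<alpha> y) b = 1" for y using ab by (simp add: \<alpha>_def det2_eq algebra_simps)
  have *: "c y \<noteq> 0 \<and> k' y \<noteq> 0 \<and> (k' y)\<^sup>2 = 256 * \<bar>l\<bar> ^ 5 * c y ^ 4" if y: "y \<in> I" for y
  proof -
    obtain q where q: "q $ 2 = y" and C: "C q = - l *\<^sub>R ruled \<alpha> \<gamma> \<beta> q"
      and t: "transversal_at (ruled \<alpha> \<gamma> \<beta>) C q" and n: "nondegenerate_at (ruled \<alpha> \<gamma> \<beta>) C q"
      and v: "\<forall>u v w. metric_volume (ruled \<alpha> \<gamma> \<beta>) C q u v w = induced_volume (ruled \<alpha> \<gamma> \<beta>) C q u v w"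
      using pt[OF y] by blast
    have qI: "q $ 2 \<in> I" using q y by simp
    have "ruled \<alpha> \<gamma> \<beta> q \<notin> range (push (ruled \<alpha> \<gamma> \<beta>) q)"
    proof
      assume "ruled \<alpha> \<gamma> \<beta> q \<in> range (push (ruled \<alpha> \<gamma> \<beta>) q)"
      then obtain x where "ruled \<alpha> \<gamma> \<beta> q = push (ruled \<alpha> \<gamma> \<beta>) q x" by blast
      then have "C q = push (ruled \<alpha> \<gamma> \<beta>) q (- l *\<^sub>R x)"
        using C by (simp only: linear_cmul[OF linear_push_ruled[OF qI]])
      then show False using t by (auto simp: transversal_at_def)
    qed
    then have d: "det2 (\<alpha> (q $ 2)) (\<gamma> (q $ 2)) \<noteq> 0"
      by (rule det_nonzero_of_transversal[OF qI, of b]) (simp add: ab1)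
    have b: "det2 (\<beta> (q $ 2)) (velocity \<beta> (q $ 2)) \<noteq> 0" by (simp add: b1)
    have "k' y \<noteq> 0"
      using nondegenerate_ruled_iff[OF qI d b, of C, OF C l] n by (simp add: q a1[OF y])
    moreover have "(k' y)\<^sup>2 = 256 * \<bar>l\<bar> ^ 5 * c y ^ 4"
      using blaschke_volume_ruled_iff[OF qI d b, of C, OF C l] v by (simp add: q a1[OF y] g1 b1)
    moreover have "c y \<noteq> 0" using d by (simp add: g1 q)
    ultimately show ?thesis by blast
  qed
  define g where "g y = c y * sqrt \<bar>k' y\<bar> / k' y" for y
  have "continuous_on I g"
    unfolding g_def using * smooth_on_continuous_on[OF k'] smooth_on_continuous_on[OF c]
    by (intro continuous_intros) auto
  moreover have "g y ^ 4 = 1 / (256 * \<bar>l\<bar> ^ 5)" if y: "y \<in> I" for y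
  proof -
    have "sqrt \<bar>k' y\<bar> ^ 4 = (sqrt \<bar>k' y\<bar> ^ 2) ^ 2" by (simp only: power_mult[symmetric]) simp
    also have "\<dots> = (k' y)\<^sup>2" by (simp only: real_sqrt_pow2 abs_ge_zero power2_abs)
    finally have "g y ^ 4 = c y ^ 4 * (k' y)\<^sup>2 / k' y ^ 4" by (simp only: g_def power_divide power_mult_distrib)
    also have "\<dots> = c y ^ 4 / (k' y)\<^sup>2"
    proof -
      have "k' y \<noteq> 0" using *[OF y] by blast
      then show ?thesis by (simp add: power2_eq_square power4_eq_xxxx)
    qed
    also have "\<dots> = c y ^ 4 / (256 * \<bar>l\<bar> ^ 5 * c y ^ 4)"
      by (rule arg_cong[where f = "\<lambda>t. c y ^ 4 / t"]) (use *[OF y] in blast)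
    also have "\<dots> = 1 / (256 * \<bar>l\<bar> ^ 5)"
      by (rule nonzero_divide_mult_cancel_right) (use *[OF y] in simp)
    finally show ?thesis .
  qed
  moreover have "connected I" using iI by (simp add: is_interval_connected)
  ultimately obtain E where E: "\<And>y. y \<in> I \<Longrightarrow> g y = E" using constant_of_constant_power by metis
  have E0: "E \<noteq> 0"
  proof -
    obtain y where y: "y \<in> I" using nI by blast
    then show ?thesis using E[OF y] *[OF y] by (auto simp: g_def)
  qed
  have B: "model_B \<alpha> \<beta> E y * k' y = c y" if y: "y \<in> I" for y
  proof -
    have "sqrt \<bar>k' y\<bar> \<noteq> 0" using *[OF y] by simp
    then show ?thesis
      using *[OF y] unfolding E[OF y, symmetric] g_def model_B_def a1[OF y] b1 by simp
  qed
  show thesis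
  proof (rule that[of E])
    show "model_data I \<alpha> \<beta> (\<lambda>_. 0) E"
      unfolding model_data_def using I \<alpha> \<beta> smooth_on_const[OF oI] E0 * by (simp add: a1 b1)
    show "model_f \<alpha> \<beta> (\<lambda>_. 0) E q = ruled \<alpha> \<gamma> \<beta> q" if "q $ 2 \<in> I" for q
      unfolding model_f_eq_ruled ruled_def using B[OF that] by (simp add: v\<alpha>[OF that] \<gamma>_def)
  qed
qed

section \<open>Adapted coordinates\<close>

lemma ex_det2_one:
  assumes "a \<noteq> 0" obtains b where "det2 a b = 1"
proof -
  define n where "n = a $ 1 * a $ 1 + a $ 2 * a $ 2"
  have "n \<noteq> 0"
    using assms by (simp add: n_def vec_eq_iff forall_2 sum_squares_eq_zero_iff)
  moreover have "det2 a (vector [- (a $ 2 / n), a $ 1 / n]) = (a $ 1 * a $ 1 + a $ 2 * a $ 2) / n"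
    by (simp add: det2_eq add_divide_distrib)
  ultimately have "det2 a (vector [- (a $ 2 / n), a $ 1 / n]) = 1" unfolding n_def by simp
  then show thesis by (rule that)
qed

text \<open>The coordinates of a point with eigencomponents \<open>u\<close> and \<open>w\<close>: polar-type coordinates \<open>y\<close>, \<open>z\<close> of
  \<open>w\<close>, in which the flow is a translation of \<open>z\<close>, and the \<open>a\<close>-component of \<open>u\<close> rescaled so as to be
  invariant under the flow.\<close>

definition adapted :: "real^2 \<Rightarrow> real^2 \<Rightarrow> real^2 \<Rightarrow> real^4 \<Rightarrow> real^3" where
  "adapted b e e' v = vector [det2 (um v) e' * det2 (up v) b, det2 e (um v) / det2 (um v) e',
     ln (det2 (um v) e')]"

text \<open>So a point is recovered from its coordinates up to the \<open>b\<close>-component of \<open>u\<close>.\<close>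

lemma twist_adapted:
  assumes ab: "det2 a b = 1" and ee: "det2 e e' = 1" and pos: "det2 (um v) e' > 0"
  defines "q \<equiv> adapted b e e' v"
  shows "um v = exp (q $ 3) *\<^sub>R (e + q $ 2 *\<^sub>R e')"
    "det2 (up v) b = exp (- (q $ 3)) * q $ 1"
    "v = twist (q $ 3) (q $ 1 *\<^sub>R a + (exp (q $ 3) * det2 a (up v)) *\<^sub>R b) (- (e + q $ 2 *\<^sub>R e'))"
proof -
  have z: "exp (q $ 3) = det2 (um v) e'" using pos by (simp add: q_def adapted_def)
  have "um v = det2 (um v) e' *\<^sub>R e + det2 e (um v) *\<^sub>R e'"
    using det2_coordinates[of e e' "um v"] ee by simp
  then show um: "um v = exp (q $ 3) *\<^sub>R (e + q $ 2 *\<^sub>R e')"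
    using pos by (simp add: z scaleR_add_right) (simp add: q_def adapted_def)
  show up: "det2 (up v) b = exp (- (q $ 3)) * q $ 1"
    using pos by (simp add: z exp_minus) (simp add: q_def adapted_def)
  have "up v = det2 (up v) b *\<^sub>R a + det2 a (up v) *\<^sub>R b"
    using det2_coordinates[of a b "up v"] ab by simp
  then have upv: "up v = exp (- (q $ 3)) *\<^sub>R (q $ 1 *\<^sub>R a + (exp (q $ 3) * det2 a (up v)) *\<^sub>R b)"
    unfolding up scaleR_add_right scaleR_scaleR mult.assoc[symmetric] exp_add[symmetric] by simp
  have "v = ep (up v) + em (um v)" by (rule ep_up_add_em_um[symmetric])
  also have "ep (up v) = exp (- (q $ 3)) *\<^sub>R ep (q $ 1 *\<^sub>R a + (exp (q $ 3) * det2 a (up v)) *\<^sub>R b)"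
    by (subst upv) (rule linear_cmul[OF bounded_linear.linear[OF bounded_linear_eigen(1)]])
  also have "em (um v) = - (exp (q $ 3) *\<^sub>R em (- (e + q $ 2 *\<^sub>R e')))"
    unfolding um by (simp add: linear_cmul linear_neg bounded_linear.linear[OF bounded_linear_eigen(2)]
        del: minus_add_distrib)
  finally show "v = twist (q $ 3) (q $ 1 *\<^sub>R a + (exp (q $ 3) * det2 a (up v)) *\<^sub>R b) (- (e + q $ 2 *\<^sub>R e'))"
    unfolding twist_def by (simp only: diff_conv_add_uminus)
qed

text \<open>Let \<open>v\<close> be in the kernel of the derivative of the coordinates. As they determine the component \<open>um\<close> of
  the surface, that component does not change along \<open>v\<close>, so \<open>v\<close> lies on the line \<open>\<D>\<^sup>+\<close>. They also
  determine the \<open>a\<close>-component of \<open>up\<close>, and \<open>a\<close> is chosen as the direction in which \<open>\<D>\<^sup>+\<close> is mapped; so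
  \<open>v = 0\<close>. The coordinates are then cut down to a box, in order that functions can be
  compared along coordinate lines.\<close>

lemma adapted_chart:
  assumes F: "smooth_on V F" and p: "p \<in> V" and w0: "um (F p) \<noteq> 0" and im: "immersed_at F p"
    and D: "Dist_plus F p = span {X}" and X: "X \<noteq> 0"
  obtains a b e e' lo hi V' \<Phi> \<Psi> Q where "det2 a b = 1" "det2 e e' = 1" "V' \<subseteq> V" "p \<in> V'"
    "smooth_diffeo V' (box lo hi) \<Phi> \<Psi>" "smooth_on (box lo hi) Q"
    "\<And>q. q \<in> box lo hi \<Longrightarrow>
      F (\<Psi> q) = twist (q $ 3) (q $ 1 *\<^sub>R a + Q q *\<^sub>R b) (- (e + q $ 2 *\<^sub>R e'))"
proof -
  note lin = smooth_on_linear_push[OF F p]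
  define a where "a = up (push F p X)"
  have "X \<in> Dist_plus F p" unfolding D by (simp add: span_base)
  then have JX: "Jt (push F p X) = push F p X" by (simp add: Dist_plus_iff[OF lin])
  have um0: "um v = 0" if "Jt v = v" for v
  proof -
    have "um (Jt v) = - um v" by (simp add: vec_eq_iff forall_2 eigen_simps field_simps)
    then have "um v = - um v" unfolding that .
    then show ?thesis by (simp add: vec_eq_iff)
  qed
  have "a \<noteq> 0"
  proof
    assume "a = 0"
    then have "push F p X = 0"
      using ep_up_add_em_um[of "push F p X"] um0[OF JX]
      by (simp add: a_def linear_0 bounded_linear_eigen[THEN bounded_linear.linear])
    then show False using X im lin by (auto simp: immersed_at_def linear_injective_0)
  qed
  then obtain b where ab: "det2 a b = 1" by (rule ex_det2_one)
  define e where "e = um (F p)"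
  have "e \<noteq> 0" using w0 by (simp add: e_def)
  then obtain e' where ee: "det2 e e' = 1" by (rule ex_det2_one)
  have up: "smooth_on S (\<lambda>p. up (H p))" and um: "smooth_on S (\<lambda>p. um (H p))"
    if "smooth_on S H" for S and H :: "real^3 \<Rightarrow> real^4"
    using that by (auto intro: smooth_on_bounded_linear bounded_linear_eigen)
  have dt: "smooth_on S (\<lambda>p. det2 (g p) (h p))" if "smooth_on S g" "smooth_on S h"
    for S and g h :: "real^3 \<Rightarrow> real^2"
    unfolding det2_eq using that by (intro smooth_on_diff smooth_on_mult smooth_on_component)
  note oV = smooth_on_open[OF F]
  have s: "smooth_on V (\<lambda>p. det2 (um (F p)) e')" by (intro dt um F smooth_on_const oV)
  define V1 where "V1 = V \<inter> (\<lambda>p. det2 (um (F p)) e') -` {0<..}"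
  have oV1: "open V1"
    unfolding V1_def by (intro continuous_open_preimage smooth_on_continuous_on[OF s] oV) simp
  have V1V: "V1 \<subseteq> V" by (auto simp: V1_def)
  have pV1: "p \<in> V1" using p ee by (simp add: V1_def e_def)
  have F1: "smooth_on V1 F" by (rule smooth_on_subset[OF F oV1 V1V])
  define \<Phi> where "\<Phi> p = adapted b e e' (F p)" for p
  have pos: "det2 (um (F r)) e' > 0" if "r \<in> V1" for r using that by (simp add: V1_def)
  have \<Phi>: "smooth_on V1 \<Phi>"
  proof (rule smooth_on_componentwise[OF oV1])
    have s1: "smooth_on V1 (\<lambda>p. det2 (um (F p)) e')" by (intro dt um F1 smooth_on_const oV1)
    have "smooth_on V1 (\<lambda>p. det2 (um (F p)) e' * det2 (up (F p)) b)"
      by (intro smooth_on_mult s1 dt up F1 smooth_on_const oV1)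
    moreover have "smooth_on V1 (\<lambda>p. det2 e (um (F p)) / det2 (um (F p)) e')"
      using pos by (intro smooth_on_divide s1 dt um F1 smooth_on_const oV1) force
    moreover have "smooth_on V1 (\<lambda>p. ln (det2 (um (F p)) e'))"
      by (intro smooth_on_ln s1 pos)
    ultimately show "smooth_on V1 (\<lambda>p. \<Phi> p $ i)" for i
      using exhaust_3[of i] by (auto simp: \<Phi>_def adapted_def)
  qed
  have inj: "inj (frechet_derivative \<Phi> (at p))"
  proof -
    define K where "K q = exp (q $ 3) *\<^sub>R (e + q $ 2 *\<^sub>R e')" for q :: "real^3"
    define L where "L q = exp (- (q $ 3)) * q $ 1" for q :: "real^3"
    have sq: "smooth_on UNIV (\<lambda>q::real^3. q $ i)" for i by (rule smooth_on_component[OF smooth_on_id]) simp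
    have K: "smooth_on UNIV K" and L: "smooth_on UNIV L"
      unfolding K_def L_def
      by (intro smooth_on_scaleR smooth_on_mult smooth_on_exp smooth_on_minus smooth_on_add sq smooth_on_const; simp)+
    have d\<Phi>: "(\<Phi> has_derivative frechet_derivative \<Phi> (at p)) (at p)" by (rule smooth_on_has_derivative[OF \<Phi> pV1])
    have dF: "(F has_derivative push F p) (at p)"
      using smooth_on_has_derivative[OF F p] by (simp add: push_def[abs_def])
    show ?thesis unfolding linear_injective_0[OF has_derivative_linear[OF d\<Phi>]]
    proof (intro allI impI)
      fix v assume v: "frechet_derivative \<Phi> (at p) v = 0"
      have "((\<lambda>r. K (\<Phi> r)) has_derivative (\<lambda>v. frechet_derivative K (at (\<Phi> p)) (frechet_derivative \<Phi> (at p) v))) (at p)"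
        by (rule has_derivative_compose[OF d\<Phi> smooth_on_has_derivative[OF K UNIV_I]])
      then have "((\<lambda>r. um (F r)) has_derivative (\<lambda>v. frechet_derivative K (at (\<Phi> p)) (frechet_derivative \<Phi> (at p) v))) (at p)"
        by (rule has_derivative_transform_within_open[OF _ oV1 pV1])
          (simp only: twist_adapted(1)[OF ab ee pos] K_def \<Phi>_def)
      moreover have "((\<lambda>r. um (F r)) has_derivative (\<lambda>v. um (push F p v))) (at p)"
        by (rule bounded_linear.has_derivative[OF bounded_linear_eigen(4) dF])
      ultimately have "(\<lambda>v. um (push F p v)) = (\<lambda>v. frechet_derivative K (at (\<Phi> p)) (frechet_derivative \<Phi> (at p) v))"
        using has_derivative_unique by blast
      then have "um (push F p v) = frechet_derivative K (at (\<Phi> p)) (frechet_derivative \<Phi> (at p) v)" by (rule fun_cong)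
      also have "\<dots> = 0"
        unfolding v by (rule linear_0[OF has_derivative_linear[OF smooth_on_has_derivative[OF K UNIV_I]]])
      finally have "push F p v = ep (up (push F p v))"
        using ep_up_add_em_um[of "push F p v"]
        by (simp add: linear_0 bounded_linear_eigen[THEN bounded_linear.linear])
      then have "Jt (push F p v) = push F p v" by (metis Jt_eigen(1))
      then have "v \<in> span {X}" unfolding D[symmetric] Dist_plus_iff[OF lin] .
      then obtain k where k: "v = k *\<^sub>R X" by (auto simp: span_singleton)
      have bl: "bounded_linear (\<lambda>v. det2 (up v) b)"
        unfolding linear_conv_bounded_linear[symmetric]
        by (auto intro!: linearI simp: det2_eq eigen_simps algebra_simps add_divide_distrib)
      have "((\<lambda>r. L (\<Phi> r)) has_derivative (\<lambda>v. frechet_derivative L (at (\<Phi> p)) (frechet_derivative \<Phi> (at p) v))) (at p)"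
        by (rule has_derivative_compose[OF d\<Phi> smooth_on_has_derivative[OF L UNIV_I]])
      then have "((\<lambda>r. det2 (up (F r)) b) has_derivative (\<lambda>v. frechet_derivative L (at (\<Phi> p)) (frechet_derivative \<Phi> (at p) v))) (at p)"
        by (rule has_derivative_transform_within_open[OF _ oV1 pV1])
          (simp only: twist_adapted(2)[OF ab ee pos] L_def \<Phi>_def)
      moreover have "((\<lambda>r. det2 (up (F r)) b) has_derivative (\<lambda>v. det2 (up (push F p v)) b)) (at p)"
        by (rule bounded_linear.has_derivative[OF bl dF])
      ultimately have "(\<lambda>v. det2 (up (push F p v)) b) = (\<lambda>v. frechet_derivative L (at (\<Phi> p)) (frechet_derivative \<Phi> (at p) v))"
        using has_derivative_unique by blast
      then have "det2 (up (push F p v)) b = frechet_derivative L (at (\<Phi> p)) (frechet_derivative \<Phi> (at p) v)" by (rule fun_cong)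
      also have "\<dots> = 0"
        unfolding v by (rule linear_0[OF has_derivative_linear[OF smooth_on_has_derivative[OF L UNIV_I]]])
      finally have "k * det2 a b = 0"
        unfolding k a_def linear_cmul[OF lin] linear_cmul[OF bounded_linear.linear[OF bl], simplified] .
      then show "v = 0" using ab k by simp
    qed
  qed
  obtain U W \<Psi> where U: "open U" "U \<subseteq> V1" "p \<in> U" and W: "open W" "\<Phi> p \<in> W"
    and hom: "homeomorphism U W \<Phi> \<Psi>" and \<Psi>: "smooth_on W \<Psi>"
    by (rule smooth_local_inverse[OF \<Phi> pV1 inj])
  obtain d where d: "d > 0" "box (\<chi> i. \<Phi> p $ i - d) (\<chi> i. \<Phi> p $ i + d) \<subseteq> W"
    by (rule open_contains_centred_box[OF W])
  define lo hi :: "real^3" where "lo = (\<chi> i. \<Phi> p $ i - d)" and "hi = (\<chi> i. \<Phi> p $ i + d)"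
  let ?B = "box lo hi"
  have BW: "?B \<subseteq> W" using d by (simp add: lo_def hi_def)
  define V' where "V' = U \<inter> \<Phi> -` ?B"
  have smU: "smooth_on U \<Phi>" by (rule smooth_on_subset[OF \<Phi> U(1,2)])
  have oV': "open V'"
    unfolding V'_def by (rule continuous_open_preimage[OF smooth_on_continuous_on[OF smU] U(1) open_box])
  have hom': "homeomorphism V' ?B \<Phi> \<Psi>"
  proof (rule homeomorphism_of_subsets[OF hom])
    show "V' \<subseteq> U" by (auto simp: V'_def)
    show "?B \<subseteq> W" by (rule BW)
    show "\<Phi> ` V' = ?B"
      using homeomorphism_image1[OF hom] BW by (auto simp: V'_def)
  qed
  have diffeo: "smooth_diffeo V' ?B \<Phi> \<Psi>"
    using hom' smooth_on_subset[OF smU oV'] smooth_on_subset[OF \<Psi> open_box BW]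
    by (auto simp: smooth_diffeo_def V'_def)
  have V'V: "V' \<subseteq> V" and V'V1: "V' \<subseteq> V1" using U V1V by (auto simp: V'_def)
  have pV': "p \<in> V'" using U d by (simp add: V'_def mem_box_cart lo_def hi_def)
  define Q where "Q q = exp (q $ 3) * det2 a (up (F (\<Psi> q)))" for q
  have FP: "smooth_on ?B (\<lambda>q. F (\<Psi> q))"
    using diffeo smooth_diffeo_maps(2)[OF diffeo] V'V
    by (intro smooth_on_compose[OF _ F]) (auto simp: smooth_diffeo_def)
  have Q: "smooth_on ?B Q"
    unfolding Q_def
    by (intro smooth_on_mult smooth_on_exp dt up FP smooth_on_const smooth_on_component[OF smooth_on_id] open_box)
  have "F (\<Psi> q) = twist (q $ 3) (q $ 1 *\<^sub>R a + Q q *\<^sub>R b) (- (e + q $ 2 *\<^sub>R e'))" if q: "q \<in> ?B" for q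
  proof -
    have "adapted b e e' (F (\<Psi> q)) = q" using smooth_diffeo_maps(4)[OF diffeo q] by (simp add: \<Phi>_def)
    then show ?thesis
      using twist_adapted(3)[OF ab ee pos, of "\<Psi> q"] smooth_diffeo_maps(2)[OF diffeo q] V'V1
      by (auto simp: Q_def)
  qed
  with ab ee V'V pV' diffeo Q show thesis by (rule that)
qed

section \<open>Affine hyperspheres with null direction are locally models\<close>

lemma transversal_at_translate: "transversal_at (\<lambda>p. F p - c) = transversal_at F"
  by (simp add: fun_eq_iff transversal_at_def push_translate)

lemma sff_at_translate: "sff_at (\<lambda>p. F p - c) = sff_at F"
  by (simp add: fun_eq_iff sff_at_def sff_def transv_part_def push_translate)

lemma volume_translate:
  "induced_volume (\<lambda>p. F p - c) = induced_volume F" "metric_volume (\<lambda>p. F p - c) = metric_volume F"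
proof -
  show i: "induced_volume (\<lambda>p. F p - c) = induced_volume F"
    by (simp add: fun_eq_iff induced_volume_def push_translate)
  show "metric_volume (\<lambda>p. F p - c) = metric_volume F"
    by (simp add: fun_eq_iff metric_volume_def i sff_at_translate)
qed

text \<open>In adapted coordinates the hypersphere is ruled. All hypotheses are carried over to these coordinates first,
  and then from the coordinate expression to the ruled surface that agrees with it on a box.\<close>

lemma affine_hypersphere_local_model:
  assumes h: "affine_hypersphere M \<A> f C" and J: "Jt_tangent \<A> f C"
    and n: "null_direction \<A> f C (D_plus f)" and l: "l \<noteq> 0"
    and C: "\<And>m. m \<in> topspace M \<Longrightarrow> C m = - l *\<^sub>R (f m - ctr)" and m: "m \<in> topspace M"
  shows "\<exists>U \<phi> I \<alpha> \<beta> A E. m \<in> U \<and> smooth_atlas M (\<A> \<union> {(U, \<phi>)}) \<and>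
    model_data I \<alpha> \<beta> A E \<and> \<phi> ` U \<subseteq> slab I \<and> (\<forall>q\<in>U. f q - ctr = model_f \<alpha> \<beta> A E (\<phi> q))"
proof -
  have at: "smooth_atlas M \<A>" using h by (simp add: affine_hypersphere_def manifold3_def)
  then obtain ch where ch: "ch \<in> \<A>" "m \<in> fst ch" using m unfolding smooth_atlas_def by blast
  note chart = affine_hypersphere_chart[OF h ch(1)]
  define V where "V = image_of_chart ch"
  have V: "V = snd ch ` fst ch" by (simp add: V_def image_of_chart_def case_prod_beta)
  define p where "p = snd ch m"
  have p: "p \<in> V" using ch by (simp add: V p_def)
  define F where "F = (\<lambda>r. in_chart ch f r - ctr)"
  define N where "N = in_chart ch C"
  have F: "smooth_on V F"
    unfolding F_def V_def by (intro smooth_on_diff chart(2) smooth_on_const smooth_on_open[OF chart(2)])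
  have pF: "push F = push (in_chart ch f)" unfolding F_def by (rule push_translate)
  have lin: "linear (push F r)" if "r \<in> V" for r by (rule smooth_on_linear_push[OF F that])
  have im: "immersed_at F r" if "r \<in> V" for r
    using chart(5)[of r] that by (simp add: immersed_at_def pF V_def)
  have tr: "transversal_at F N r" if "r \<in> V" for r
    using chart(6)[of r] that by (simp add: F_def N_def transversal_at_translate V_def)
  have nd: "nondegenerate_at F N r" if "r \<in> V" for r
    using chart(7)[of r] that by (simp add: F_def N_def nondegenerate_at_def sff_at_translate V_def)
  have vol: "metric_volume F N r u v w = induced_volume F N r u v w" if "r \<in> V" for r u v w
    using chart(8)[of r u v w] that by (simp add: F_def N_def volume_translate V_def)
  have NF: "N r = - l *\<^sub>R F r" if "r \<in> V" for r
  proof -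
    obtain x where x: "x \<in> fst ch" "r = snd ch x" using \<open>r \<in> V\<close> by (auto simp: V)
    have "x \<in> topspace M" using at ch(1) x(1) unfolding smooth_atlas_def by blast
    then show ?thesis
      unfolding N_def F_def x(2) in_chart_apply[OF chart(1) x(1)] by (rule C)
  qed
  have JF: "Jt (F r) \<in> range (push F r)" if r: "r \<in> V" for r
  proof -
    obtain v where v: "Jt (N r) = push F r v"
      using J ch(1) r by (auto simp: Jt_tangent_def N_def pF V_def)
    have "F r = (- 1 / l) *\<^sub>R N r" using l by (simp add: NF[OF r])
    then have "Jt (F r) = (- 1 / l) *\<^sub>R Jt (N r)"
      by (simp only: linear_cmul[OF bounded_linear.linear[OF bounded_linear_eigen(5)]])
    also have "\<dots> = push F r ((- 1 / l) *\<^sub>R v)" unfolding v by (rule linear_cmul[OF lin[OF r], symmetric])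
    finally show ?thesis by blast
  qed
  have um0: "um (F p) \<noteq> 0"
  proof
    assume "um (F p) = 0"
    then have "F p = ep (up (F p))"
      using ep_up_add_em_um[of "F p"] by (simp add: linear_0[OF bounded_linear.linear[OF bounded_linear_eigen(2)]])
    then have "Jt (F p) = F p" by (metis Jt_eigen(1))
    then obtain v where "F p = push F p v" using JF[OF p] by auto
    then have "N p = push F p (- l *\<^sub>R v)" by (simp only: NF[OF p] linear_cmul[OF lin[OF p]])
    then show False using tr[OF p] by (auto simp: transversal_at_def)
  qed
  have DF: "D_plus f ch r = Dist_plus F r" for r
    by (simp add: D_plus_def Dist_plus_def Dist_def pF)
  obtain X where X: "X \<noteq> 0" "Dist_plus F p = span {X}"
    using n ch(1) p DF by (fastforce simp: null_direction_def smooth_line_distribution_def V_def)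
  have null: "sff_at F N r v v = 0" if "r \<in> V" "v \<in> Dist_plus F r" for r v
    using n ch(1) that by (auto simp: null_direction_def DF V_def F_def N_def sff_at_translate)
  obtain a b e e' lo hi V' \<Phi> \<Psi> Q where ab: "det2 a b = 1" and ee: "det2 e e' = 1" and V'V: "V' \<subseteq> V"
    and pV': "p \<in> V'" and d: "smooth_diffeo V' (box lo hi) \<Phi> \<Psi>" and Q: "smooth_on (box lo hi) Q"
    and FQ: "\<And>q. q \<in> box lo hi \<Longrightarrow>
      F (\<Psi> q) = twist (q $ 3) (q $ 1 *\<^sub>R a + Q q *\<^sub>R b) (- (e + q $ 2 *\<^sub>R e'))"
    using adapted_chart[OF F p um0 im[OF p] X(2,1)] by metis
  let ?B = "box lo hi"
  note dm = smooth_diffeo_maps[OF d]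
  have F': "smooth_on V' F"
    using d smooth_on_open by (intro smooth_on_subset[OF F _ V'V]) (auto simp: smooth_diffeo_def)
  have \<Psi>V: "\<Psi> q \<in> V" if "q \<in> ?B" for q using dm(2)[OF that] V'V by blast
  define G where "G = (\<lambda>q. F (\<Psi> q))"
  define N' where "N' = (\<lambda>q. N (\<Psi> q))"
  have GQ: "G q = twist (q $ 3) (q $ 1 *\<^sub>R a + Q q *\<^sub>R b) (- (e + q $ 2 *\<^sub>R e'))" if "q \<in> ?B" for q
    unfolding G_def by (rule FQ[OF that])
  have sG: "smooth_on ?B G"
    unfolding G_def using d dm by (intro smooth_on_compose[OF _ F']) (auto simp: smooth_diffeo_def)
  have im': "immersed_at G q" if "q \<in> ?B" for q
    unfolding G_def by (rule immersed_at_compose[OF d F' that im[OF \<Psi>V[OF that]]])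
  have tr': "transversal_at G N' q" if "q \<in> ?B" for q
    unfolding G_def N'_def by (rule transversal_at_compose[OF d F' that tr[OF \<Psi>V[OF that]]])
  have nd': "nondegenerate_at G N' q" if "q \<in> ?B" for q
    unfolding G_def N'_def by (rule nondegenerate_at_compose[OF d F' that nd[OF \<Psi>V[OF that]]])
  have vol': "metric_volume G N' q u v w = induced_volume G N' q u v w" if "q \<in> ?B" for q u v w
    unfolding G_def N'_def by (rule metric_volume_compose[OF d F' that vol[OF \<Psi>V[OF that]]])
  have NG: "N' q = - l *\<^sub>R G q" if "q \<in> ?B" for q
    unfolding G_def N'_def by (rule NF[OF \<Psi>V[OF that]])
  have JG: "Jt (G q) \<in> range (push G q)" if "q \<in> ?B" for q
    unfolding G_def range_push_compose[OF d F' that] by (rule JF[OF \<Psi>V[OF that]])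
  have null': "sff_at G N' q v v = 0" if q: "q \<in> ?B" and v: "Jt (push G q v) = push G q v" for q v
  proof -
    have "frechet_derivative \<Psi> (at q) v \<in> Dist_plus F (\<Psi> q)"
      using v unfolding Dist_plus_iff[OF lin[OF \<Psi>V[OF q]]] G_def push_compose[OF d F' q] .
    then show ?thesis
      unfolding G_def N'_def sff_at_compose[OF d F' q] by (rule null[OF \<Psi>V[OF q]])
  qed
  have pB: "\<Phi> p \<in> ?B" by (rule dm(1)[OF pV'])
  define I where "I = {lo $ 2<..<hi $ 2}"
  obtain k c where k: "smooth_on I k" and c: "smooth_on I c"
    and Qkc: "\<And>q. q \<in> ?B \<Longrightarrow> Q q = q $ 1 * k (q $ 2) + c (q $ 2)"
    using twist_normal_form[OF refl pB Q ab ee GQ im' tr' JG null'] unfolding I_def by metis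
  have I: "open_interval I"
  proof -
    have "\<Phi> p $ 2 \<in> I" using pB by (simp add: I_def mem_box_cart)
    then show ?thesis by (auto simp: open_interval_def I_def is_interval_oo)
  qed
  let ?R = "ruled (\<lambda>y. a + k y *\<^sub>R b) (\<lambda>y. c y *\<^sub>R b) (\<lambda>y. - (e + y *\<^sub>R e'))"
  have GR: "G q = ?R q" if "q \<in> ?B" for q
    unfolding GQ[OF that] ruled_def Qkc[OF that] by (simp add: twist_eq_iff algebra_simps)
  have pt: "\<exists>q. q $ 2 = y \<and> N' q = - l *\<^sub>R ?R q \<and> transversal_at ?R N' q \<and> nondegenerate_at ?R N' q \<and>
      (\<forall>u v w. metric_volume ?R N' q u v w = induced_volume ?R N' q u v w)" if y: "y \<in> I" for y
  proof -
    define q :: "real^3" where "q = vector [\<Phi> p $ 1, y, \<Phi> p $ 3]"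
    have q2: "q $ 2 = y" by (simp add: q_def)
    have q: "q \<in> ?B" using pB y by (simp add: q_def I_def mem_box_cart forall_3)
    have pR: "push G q = push ?R q"
      by (rule push_cong[OF open_box q smooth_on_differentiable[OF sG q] GR])
    have sR: "sff_at G N' q = sff_at ?R N' q" by (rule sff_at_cong[OF sG q GR refl])
    have ind: "induced_volume G N' q = induced_volume ?R N' q"
      by (simp add: fun_eq_iff induced_volume_def pR)
    have met: "metric_volume G N' q = metric_volume ?R N' q"
      by (simp add: fun_eq_iff metric_volume_def ind sR)
    have "transversal_at ?R N' q" using tr'[OF q] by (simp add: transversal_at_def pR)
    moreover have "nondegenerate_at ?R N' q" using nd'[OF q] by (simp add: nondegenerate_at_def sR)
    moreover have "\<forall>u v w. metric_volume ?R N' q u v w = induced_volume ?R N' q u v w"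
      using vol'[OF q] unfolding met ind by blast
    moreover have "N' q = - l *\<^sub>R ?R q" using NG[OF q] by (simp only: GR[OF q])
    ultimately show ?thesis using q2 by blast
  qed
  obtain E where md: "model_data I (\<lambda>y. a + k y *\<^sub>R b) (\<lambda>y. - (e + y *\<^sub>R e')) (\<lambda>_. 0) E"
    and mf: "\<And>q. q $ 2 \<in> I \<Longrightarrow> model_f (\<lambda>y. a + k y *\<^sub>R b) (\<lambda>y. - (e + y *\<^sub>R e')) (\<lambda>_. 0) E q = ?R q"
    using ruled_eq_model[OF I k c ab ee l pt] by metis
  define U where "U = {x \<in> fst ch. snd ch x \<in> V'}"
  define \<phi> where "\<phi> = (\<lambda>x. \<Phi> (snd ch x))"
  have V'i: "V' \<subseteq> image_of_chart ch" using V'V by (simp add: V_def)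
  have "m \<in> U" using ch pV' by (simp add: U_def p_def)
  moreover have "smooth_atlas M (\<A> \<union> {(U, \<phi>)})"
    unfolding U_def \<phi>_def by (rule smooth_atlas_insert[OF at ch(1) d V'i])
  moreover have \<phi>B: "\<phi> ` U = ?B"
    unfolding U_def \<phi>_def by (rule is_chart_restrict(2)[OF chart(1) d V'i])
  moreover have BI: "q $ 2 \<in> I" if "q \<in> ?B" for q using that by (simp add: I_def mem_box_cart)
  moreover have "f x - ctr = model_f (\<lambda>y. a + k y *\<^sub>R b) (\<lambda>y. - (e + y *\<^sub>R e')) (\<lambda>_. 0) E (\<phi> x)" if x: "x \<in> U" for x
  proof -
    have \<phi>x: "\<phi> x \<in> ?B" using \<phi>B x by blast
    have xc: "x \<in> fst ch" "snd ch x \<in> V'" using x by (auto simp: U_def)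
    have "f x - ctr = F (snd ch x)" by (simp add: F_def in_chart_apply[OF chart(1) xc(1)])
    also have "\<dots> = G (\<phi> x)" by (simp add: G_def \<phi>_def dm(3)[OF xc(2)])
    also have "\<dots> = ?R (\<phi> x)" by (rule GR[OF \<phi>x])
    finally show ?thesis by (simp only: mf[OF BI[OF \<phi>x]])
  qed
  ultimately show ?thesis using md
    by (intro exI[of _ U] exI[of _ \<phi>] exI[of _ I] exI[of _ "\<lambda>y. a + k y *\<^sub>R b"]
        exI[of _ "\<lambda>y. - (e + y *\<^sub>R e')"] exI[of _ "\<lambda>_. 0"] exI[of _ E]) (auto simp: slab_def)
qed

theorem theorem5p1:
  fixes M :: "'m topology" and \<A> :: "'m chart set" and f C :: "'m \<Rightarrow> real^4"
  shows
    "(affine_hypersphere M \<A> f C \<and> Jt_tangent \<A> f C \<and> null_direction \<A> f C (D_plus f)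
      \<longrightarrow> (\<exists>ctr. centre M f C ctr \<and>
            (\<forall>m\<in>topspace M. \<exists>U \<phi> I \<alpha> \<beta> A E.
               m \<in> U \<and> smooth_atlas M (\<A> \<union> {(U, \<phi>)}) \<and>
               model_data I \<alpha> \<beta> A E \<and> \<phi> ` U \<subseteq> slab I \<and>
               (\<forall>q\<in>U. f q - ctr = model_f \<alpha> \<beta> A E (\<phi> q)))))
     \<and>
     (\<forall>I \<alpha> \<beta> A E. model_data I \<alpha> \<beta> A E
      \<longrightarrow> (\<exists>N. affine_hypersphere (top_of_set (slab I)) {(slab I, id)} (model_f \<alpha> \<beta> A E) N \<and>
               Jt_tangent {(slab I, id)} (model_f \<alpha> \<beta> A E) N \<and>
               null_direction {(slab I, id)} (model_f \<alpha> \<beta> A E) N (D_plus (model_f \<alpha> \<beta> A E))))"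
proof (intro conjI impI allI)
  assume "affine_hypersphere M \<A> f C \<and> Jt_tangent \<A> f C \<and> null_direction \<A> f C (D_plus f)"
  then have h: "affine_hypersphere M \<A> f C" and J: "Jt_tangent \<A> f C"
    and n: "null_direction \<A> f C (D_plus f)" by auto
  (* on the empty manifold nothing determines l or the centre *)
  show "\<exists>ctr. centre M f C ctr \<and> (\<forall>m\<in>topspace M. \<exists>U \<phi> I \<alpha> \<beta> A E.
      m \<in> U \<and> smooth_atlas M (\<A> \<union> {(U, \<phi>)}) \<and> model_data I \<alpha> \<beta> A E \<and> \<phi> ` U \<subseteq> slab I \<and>
      (\<forall>q\<in>U. f q - ctr = model_f \<alpha> \<beta> A E (\<phi> q)))"
  proof (cases "topspace M = {}")
    case True
    then show ?thesis by (auto simp: centre_def intro: exI[of _ 1])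
  next
    case False
    then obtain m0 where m0: "m0 \<in> topspace M" by blast
    obtain l where dC: "\<And>c p v. c \<in> \<A> \<Longrightarrow> p \<in> image_of_chart c \<Longrightarrow>
        frechet_derivative (in_chart c C) (at p) v = - l *\<^sub>R push (in_chart c f) p v"
      using affine_hypersphere_derivative[OF h] by metis
    have l: "l \<noteq> 0" by (rule Jt_tangent_curvature_nonzero[OF h J dC m0])
    define ctr where "ctr = (1 / l) *\<^sub>R (C m0 + l *\<^sub>R f m0)"
    have C: "C m = - l *\<^sub>R (f m - ctr)" if "m \<in> topspace M" for m
    proof -
      have "C m + l *\<^sub>R f m = l *\<^sub>R ctr"
        using affine_hypersphere_primitive[OF h dC m0 that] l by (simp add: ctr_def)
      then show ?thesis by (simp add: algebra_simps eq_diff_eq)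
    qed
    have "centre M f C ctr" using l C by (auto simp: centre_def)
    with affine_hypersphere_local_model[OF h J n l C] show ?thesis by blast
  qed
next
  fix I :: "real set" and \<alpha> \<beta> :: "real \<Rightarrow> real^2" and A :: "real \<Rightarrow> real" and E :: real
  assume "model_data I \<alpha> \<beta> A E"
  from model_affine_hypersphere[OF this]
  show "\<exists>N. affine_hypersphere (top_of_set (slab I)) {(slab I, id)} (model_f \<alpha> \<beta> A E) N \<and>
      Jt_tangent {(slab I, id)} (model_f \<alpha> \<beta> A E) N \<and>
      null_direction {(slab I, id)} (model_f \<alpha> \<beta> A E) N (D_plus (model_f \<alpha> \<beta> A E))"
    by metis
qed

end
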